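(* Let $G$ be a finite triangle free planar graph and let $X \subseteq V(G)$ be an independent set of $G$. Let $L$ be a list assignment of $G$ such that $|L(v)| = 3$ for every $v \in X$ and $|L(v)| = 4$ for every $v \in V(G) - X$. Then $G$ is $L$-colourable.
   Context: All graphs are finite and simple. A list assignment $L$ of a graph $G$ assigns to each vertex $v$ a finite set $L(v)$ of integers (available colours). An $L$-colouring of $G$ is a mapping $\phi$ on $V(G)$ such that $\phi(v) \in L(v)$ for each vertex $v$ and $\phi(x) \neq \phi(y)$ for each edge $xy$ of $G$. $G$ is $L$-colourable if it has an $L$-colouring. *)

theory Defs
  imports "HOL-Analysis.Analysis"
begin

definition simple_graph :: "'a set \<Rightarrow> 'a set set \<Rightarrow> bool" where
  "simple_graph V E \<longleftrightarrow> finite V \<and> (\<forall>e\<in>E. e \<subseteq> V \<and> card e = 2)"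

(* No distinctness is required of x, y, z: the edges of a simple graph have two elements. *)
definition triangle_free :: "'a set set \<Rightarrow> bool" where
  "triangle_free E \<longleftrightarrow> \<not> (\<exists>x y z. {x, y} \<in> E \<and> {y, z} \<in> E \<and> {x, z} \<in> E)"

definition independent_in :: "'a set \<Rightarrow> 'a set set \<Rightarrow> 'a set \<Rightarrow> bool" where
  "independent_in V E X \<longleftrightarrow> X \<subseteq> V \<and> (\<forall>x\<in>X. \<forall>y\<in>X. {x, y} \<notin> E)"

(* A drawing in the plane without crossings: p places the vertices at distinct points, and
   each edge e is drawn as an arc (injective continuous path) \<gamma> e joining the images of its
   two ends, which meets the vertices only at these ends and any other drawn edge only at
   common ends.  The direction in which \<gamma> e is traversed is irrelevant. *)
definition plane_drawing ::
    "'a set \<Rightarrow> 'a set set \<Rightarrow> ('a \<Rightarrow> complex) \<Rightarrow> ('a set \<Rightarrow> real \<Rightarrow> complex) \<Rightarrow> bool" where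
  "plane_drawing V E p \<gamma> \<longleftrightarrow>
     inj_on p V \<and>
     (\<forall>e\<in>E. arc (\<gamma> e) \<and> {pathstart (\<gamma> e), pathfinish (\<gamma> e)} = p ` e \<and>
            path_image (\<gamma> e) \<inter> p ` V = p ` e) \<and>
     (\<forall>e\<in>E. \<forall>f\<in>E. e \<noteq> f \<longrightarrow> path_image (\<gamma> e) \<inter> path_image (\<gamma> f) = p ` (e \<inter> f))"

definition planar_graph :: "'a set \<Rightarrow> 'a set set \<Rightarrow> bool" where
  "planar_graph V E \<longleftrightarrow> (\<exists>p \<gamma>. plane_drawing V E p \<gamma>)"

definition list_colouring ::
    "'a set \<Rightarrow> 'a set set \<Rightarrow> ('a \<Rightarrow> int set) \<Rightarrow> ('a \<Rightarrow> int) \<Rightarrow> bool" where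
  "list_colouring V E L \<phi> \<longleftrightarrow>
     (\<forall>v\<in>V. \<phi> v \<in> L v) \<and> (\<forall>x y. {x, y} \<in> E \<longrightarrow> \<phi> x \<noteq> \<phi> y)"

definition list_colourable :: "'a set \<Rightarrow> 'a set set \<Rightarrow> ('a \<Rightarrow> int set) \<Rightarrow> bool" where
  "list_colourable V E L \<longleftrightarrow> (\<exists>\<phi>. list_colouring V E L \<phi>)"

end

theory Submission
  imports Defs
begin

text \<open>
  The proof is by induction on a stronger statement in the style of Thomassen. Suppose a connected set
  \<open>R\<close> of vertices has been coloured and removed, and that every remaining neighbour of \<open>R\<close> (these are boundary
  vertices) has lost one colour, so that lists have size at least \<open>4\<close>, minus one on \<open>X\<close>, minus one on
  the boundary; then the rest can be coloured, even if two adjacent boundary vertices \<open>p1\<close>, \<open>p2\<close> are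
  precoloured. One may delete a set \<open>S\<close> of coloured boundary vertices whenever no other boundary vertex, and
  no interior vertex more than once, loses a colour. Planarity enters only through the absence of
  \<open>K\<^sub>3\<^sub>,\<^sub>3\<close> and \<open>K\<^sub>5\<close> minors, with \<open>R\<close> as a branch set: in a minimal counterexample no edge joining
  two boundary vertices separates, hence the boundary walk \<open>p1, p2 = v 0, v 1, \<dots>\<close> is an induced path, and a common
  interior neighbour \<open>u\<close> of \<open>v a\<close> and \<open>v b\<close> makes \<open>{v a, u, v b}\<close> a separator.

  The deletion of \<open>v 1, \<dots>, v j\<close> succeeds if the colour of \<open>v j\<close> can be chosen outside the list of \<open>v (j + 1)\<close>.
  If it never succeeds, then the boundary starts with a chain on which vertices outside and inside \<open>X\<close>
  alternate and are coloured from the same two colours, and continues with a run outside \<open>X\<close>.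
  This stretch can be coloured as a whole, unless some interior vertex sees two different
  colours; in that case one colours the part outside a separator \<open>{v a, u, v b}\<close> first, and inside it deletes a part of
  the boundary between \<open>v a\<close> and \<open>v b\<close>, keeping \<open>u\<close> and \<open>v b\<close>, or \<open>u\<close> and \<open>v a\<close>, as the two precoloured vertices.

  That there are no \<open>K\<^sub>3\<^sub>,\<^sub>3\<close> and \<open>K\<^sub>5\<close> minors is derived from Janiszewski's theorem: if three arcs form a theta
  curve, no point is, for each of the three arcs, on the same side as that arc of the closed curve formed by the other two.
\<close>

section \<open>Theta curves in the plane\<close>

text \<open>No faces or outer cycles occur. The removed set \<open>R\<close> can stand in for the
  outer face because its properties survive every operation without re-embedding: deleted boundary
  vertices join \<open>R\<close>, and cutting off a part of \<open>U\<close> leaves \<open>R\<close>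
  alone. Every connected set that meets the boundary is adjacent to \<open>R\<close>, so a forbidden
  minor has to be found only up to this one branch set.

  The count 4 - 1 - 1 leaves just two colours to a boundary vertex in \<open>X\<close>. That is why
  deletions can fail to stop, and why failure forces the lists along the path to agree. The second
  obstacle is an interior vertex \<open>u\<close> next to two deleted vertices, which may lose two
  colours. (Consecutive path vertices have no common neighbour, as there are no triangles.) Cutting
  along \<open>u\<close> leaves three precoloured vertices \<open>v a\<close>, \<open>u\<close>,
  \<open>v b\<close>, one too many. But deleting \<open>v a\<close> moves it into \<open>R\<close>
  and turns \<open>u\<close> into a boundary vertex, so that the admissible precoloured edge from
  \<open>u\<close> to \<open>v b\<close> remains.\<close>

definition arc_between :: "complex set \<Rightarrow> complex \<Rightarrow> complex \<Rightarrow> bool" where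
  "arc_between C a b \<longleftrightarrow> (\<exists>g. arc g \<and> pathstart g = a \<and> pathfinish g = b \<and> path_image g = C)"

lemma arc_between_sym: "arc_between C a b \<Longrightarrow> arc_between C b a"
  unfolding arc_between_def
  by (metis arc_reversepath path_image_reversepath pathfinish_reversepath pathstart_reversepath)

lemma arc_between_props:
  assumes "arc_between C a b"
  shows "compact C" "closed C" "connected C" "connected (C - {a, b})" "C - {a, b} \<noteq> {}" "a \<in> C" "b \<in> C" "a \<noteq> b"
proof -
  obtain g where g: "arc g" "pathstart g = a" "pathfinish g = b" "path_image g = C"
    using assms by (auto simp: arc_between_def)
  have sp: "simple_path g"
    using g(1) by (rule arc_imp_simple_path)
  show "compact C" "connected C"
    using g compact_arc_image connected_arc_image by blast+
  then show "closed C"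
    by (simp add: compact_imp_closed)
  show "connected (C - {a, b})" "C - {a, b} \<noteq> {}"
    using connected_simple_path_endless[OF sp] nonempty_simple_path_endless[OF sp] g by auto
  show "a \<in> C" "b \<in> C" "a \<noteq> b"
    using g(2-4) arc_distinct_ends[OF g(1)] by (auto simp: pathstart_in_path_image pathfinish_in_path_image)
qed

lemma arc_between_join:
  assumes "arc_between C a b" "arc_between D b c" "C \<inter> D \<subseteq> {b}"
  shows "arc_between (C \<union> D) a c"
proof -
  obtain g where g: "arc g" "pathstart g = a" "pathfinish g = b" "path_image g = C"
    using assms by (auto simp: arc_between_def)
  obtain h where h: "arc h" "pathstart h = b" "pathfinish h = c" "path_image h = D"
    using assms by (auto simp: arc_between_def)
  have "arc (g +++ h)"
    by (rule arc_join) (use g h assms(3) in auto)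
  then show ?thesis
    unfolding arc_between_def using g h
    by (metis path_image_join pathfinish_join pathstart_join)
qed

lemma two_arcs_sides:
  assumes "arc_between C a b" "arc_between D a b" "C \<inter> D = {a, b}"
  obtains A B where "open A" "open B" "connected A" "connected B" "A \<noteq> {}" "B \<noteq> {}" "A \<inter> B = {}"
    "A \<union> B = - (C \<union> D)" "frontier A = C \<union> D" "frontier B = C \<union> D"
proof -
  obtain g where g: "arc g" "pathstart g = a" "pathfinish g = b" "path_image g = C"
    using assms by (auto simp: arc_between_def)
  obtain h where h: "arc h" "pathstart h = b" "pathfinish h = a" "path_image h = D"
    using arc_between_sym[OF assms(2)] by (auto simp: arc_between_def)
  have sp: "simple_path (g +++ h)"
    by (rule simple_path_join_loop) (use g h assms(3) in auto)
  have im: "path_image (g +++ h) = C \<union> D"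
    using g h by (simp add: path_image_join)
  have "pathfinish (g +++ h) = pathstart (g +++ h)"
    using g h by simp
  from Jordan_inside_outside[OF sp this] show ?thesis
    unfolding im by (intro that[of "inside (C \<union> D)" "outside (C \<union> D)"]) auto
qed

text \<open>A connected set stays connected when a point of its closure is added, so
  \<open>E\<close> and \<open>F\<close> are joined through \<open>w\<close> even if \<open>w\<close>
  is not in \<open>E\<close>.\<close>

lemma connected_component_touch:
  assumes "connected E" "x \<in> E" "E \<subseteq> S" "open S" "w \<in> closure E" "w \<in> F" "connected F" "F \<subseteq> S" "y \<in> F"
  shows "connected_component S x y"
proof -
  have "connected (insert w E)"
    by (rule connected_intermediate_closure[OF assms(1)]) (use assms(5) closure_subset in auto)
  then have "connected_component S x w"
    unfolding connected_component_def using assms by blast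
  moreover have "connected_component S w y"
    unfolding connected_component_def using assms by blast
  ultimately show ?thesis
    by (rule connected_component_trans)
qed

text \<open>The face \<open>F\<close> touches the interiors of \<open>C1\<close> and
  \<open>C2\<close>, so neither \<open>C1 \<union> C3\<close> nor \<open>C2 \<union> C3\<close>
  separates \<open>x\<close> from \<open>F\<close>. These two closed curves meet in the connected
  set \<open>C3\<close>; by Janiszewski \<open>x\<close> is joined to \<open>F\<close> off all three
  arcs, in particular off \<open>C1 \<union> C2\<close>. But \<open>x\<close> was on the side of
  \<open>C3\<close>, which is not \<open>F\<close>.\<close>

lemma theta_point:
  assumes c: "arc_between C1 a b" "arc_between C2 a b" "arc_between C3 a b"
    and i: "C1 \<inter> C2 = {a, b}" "C1 \<inter> C3 = {a, b}" "C2 \<inter> C3 = {a, b}"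
    and y: "y1 \<in> C1 - {a, b}" "y2 \<in> C2 - {a, b}" "y3 \<in> C3 - {a, b}"
    and x: "connected_component (- (C1 \<union> C2)) x y3" "connected_component (- (C1 \<union> C3)) x y2"
      "connected_component (- (C2 \<union> C3)) x y1"
  shows False
proof -
  note p1 = arc_between_props[OF c(1)] and p2 = arc_between_props[OF c(2)] and p3 = arc_between_props[OF c(3)]
  obtain A B where AB: "open A" "open B" "connected A" "connected B" "A \<noteq> {}" "B \<noteq> {}" "A \<inter> B = {}"
    "A \<union> B = - (C1 \<union> C2)" "frontier A = C1 \<union> C2" "frontier B = C1 \<union> C2"
    using two_arcs_sides[OF c(1,2) i(1)] by metis
  have y3: "y3 \<in> A \<union> B"
    using AB(8) y(3) i by auto
  \<comment> \<open>\<open>F\<close> is the side of the closed curve \<open>C1 \<union> C2\<close> that does not contain \<open>C3\<close>.\<close>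
  define F where "F = (if y3 \<in> A then B else A)"
  define G where "G = (if y3 \<in> A then A else B)"
  have F: "open F" "connected F" "F \<noteq> {}" "F \<inter> G = {}" "F \<union> G = - (C1 \<union> C2)" "frontier F = C1 \<union> C2"
    and G: "open G" "y3 \<in> G"
    using AB y3 by (auto simp: F_def G_def)
  have C3G: "C3 - {a, b} \<subseteq> G"
  proof -
    have "C3 - {a, b} \<subseteq> F \<union> G"
      using F(5) i by auto
    then show ?thesis
      using connectedD[OF p3(4) F(1) G(1)] F(4) G(2) y(3) by blast
  qed
  obtain z where z: "z \<in> F"
    using F(3) by blast
  have cl: "C1 \<union> C2 \<subseteq> closure F"
    using F(6) by (auto simp: frontier_def)
  have "connected_component (- (C1 \<union> C3)) z y2"
  proof (rule connected_component_touch[OF F(2) z _ _ _ _ p2(4)])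
    show "F \<subseteq> - (C1 \<union> C3)"
      using F(4,5) C3G p1(6,7) by blast
    show "open (- (C1 \<union> C3))"
      using p1(2) p3(2) by (intro open_Compl closed_Un)
  qed (use cl y i in auto)
  then have z1: "connected_component (- (C1 \<union> C3)) x z"
    using x(2) connected_component_sym connected_component_trans by metis
  have "connected_component (- (C2 \<union> C3)) z y1"
  proof (rule connected_component_touch[OF F(2) z _ _ _ _ p1(4)])
    show "F \<subseteq> - (C2 \<union> C3)"
      using F(4,5) C3G p2(6,7) by blast
    show "open (- (C2 \<union> C3))"
      using p2(2) p3(2) by (intro open_Compl closed_Un)
  qed (use cl y i in auto)
  then have z2: "connected_component (- (C2 \<union> C3)) x z"
    using x(3) connected_component_sym connected_component_trans by metis
  have "(C1 \<union> C3) \<inter> (C2 \<union> C3) = C3"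
    using p3(6,7) by (simp add: Un_Int_distrib2[symmetric] i(1) insert_absorb)
  then have "connected_component (- ((C1 \<union> C3) \<union> (C2 \<union> C3))) x z"
    using p3(3)
    by (intro Janiszewski[OF compact_Un[OF p1(1) p3(1)] closed_Un[OF p2(2) p3(2)] _ z1 z2]) (simp only:)
  then have "connected_component (- (C1 \<union> C2)) x z"
    by (rule connected_component_of_subset) auto
  then have "connected_component (- (C1 \<union> C2)) z y3"
    using x(1) connected_component_sym connected_component_trans by metis
  then obtain T where T: "connected T" "T \<subseteq> F \<union> G" "z \<in> T" "y3 \<in> T"
    unfolding connected_component_def F(5) by auto
  then show False
    using connectedD[OF T(1) F(1) G(1)] F(4) G(2) z by blast
qed

lemma touch_component:
  assumes "connected E" "x \<in> E" "E \<inter> (C \<union> C') = {}" "closed C" "closed C'"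
    and "arc_between D a b" "C \<inter> D = {a, b}" "C' \<inter> D = {a, b}"
    and "closure E \<inter> (D - {a, b}) \<noteq> {}" "y \<in> D - {a, b}"
  shows "connected_component (- (C \<union> C')) x y"
proof -
  obtain w where w: "w \<in> closure E" "w \<in> D - {a, b}"
    using assms(9) by blast
  show ?thesis
    by (rule connected_component_touch[OF assms(1,2) _ _ w arc_between_props(4)[OF assms(6)] _ assms(10)])
      (use assms in \<open>auto simp: open_Compl closed_Un\<close>)
qed

text \<open>The topological form of excluding K_{3,3}: on one side \<open>a\<close>,
  \<open>b\<close> and \<open>E\<close>, on the other the three arcs.\<close>

lemma theta_touch:
  assumes c: "arc_between C1 a b" "arc_between C2 a b" "arc_between C3 a b"
    and i: "C1 \<inter> C2 = {a, b}" "C1 \<inter> C3 = {a, b}" "C2 \<inter> C3 = {a, b}"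
    and E: "connected E" "E \<inter> (C1 \<union> C2 \<union> C3) = {}" "E \<noteq> {}"
    and t: "closure E \<inter> (C1 - {a, b}) \<noteq> {}" "closure E \<inter> (C2 - {a, b}) \<noteq> {}" "closure E \<inter> (C3 - {a, b}) \<noteq> {}"
  shows False
proof -
  obtain x where x: "x \<in> E"
    using E by blast
  obtain y1 y2 y3 where y: "y1 \<in> C1 - {a, b}" "y2 \<in> C2 - {a, b}" "y3 \<in> C3 - {a, b}"
    using arc_between_props(5)[OF c(1)] arc_between_props(5)[OF c(2)] arc_between_props(5)[OF c(3)] by blast
  note cl = arc_between_props(2)[OF c(1)] arc_between_props(2)[OF c(2)] arc_between_props(2)[OF c(3)]
  show False
  proof (rule theta_point[OF c i y])
    show "connected_component (- (C1 \<union> C2)) x y3"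
      by (rule touch_component[OF E(1) x _ cl(1,2) c(3) i(2,3) t(3) y(3)]) (use E in auto)
    show "connected_component (- (C1 \<union> C3)) x y2"
      by (rule touch_component[OF E(1) x _ cl(1,3) c(2) i(1) _ t(2) y(2)]) (use E i in auto)
    show "connected_component (- (C2 \<union> C3)) x y1"
      by (rule touch_component[OF E(1) x _ cl(2,3) c(1) _ _ t(1) y(1)]) (use E i in auto)
  qed
qed

text \<open>Touching \<open>C1\<close> and \<open>C2\<close> gives two of the three hypotheses of
  \<open>theta_point\<close>, so the third one must fail. Hence whatever joins \<open>C1\<close> to
  \<open>C2\<close> without meeting \<open>C3\<close> runs on the other side of the closed curve
  \<open>C1 \<union> C2\<close>.\<close>

lemma crossing_sides:
  assumes c: "arc_between C1 a b" "arc_between C2 a b" "arc_between C3 a b"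
    and i: "C1 \<inter> C2 = {a, b}" "C1 \<inter> C3 = {a, b}" "C2 \<inter> C3 = {a, b}"
    and E: "connected E" "E \<inter> (C1 \<union> C2 \<union> C3) = {}" "x \<in> E"
    and t: "closure E \<inter> (C1 - {a, b}) \<noteq> {}" "closure E \<inter> (C2 - {a, b}) \<noteq> {}"
    and y3: "y3 \<in> C3 - {a, b}"
  shows "\<not> connected_component (- (C1 \<union> C2)) x y3"
proof
  assume *: "connected_component (- (C1 \<union> C2)) x y3"
  obtain y1 y2 where y: "y1 \<in> C1 - {a, b}" "y2 \<in> C2 - {a, b}"
    using arc_between_props(5)[OF c(1)] arc_between_props(5)[OF c(2)] by blast
  note cl = arc_between_props(2)[OF c(1)] arc_between_props(2)[OF c(2)] arc_between_props(2)[OF c(3)]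
  show False
  proof (rule theta_point[OF c i y y3 *])
    show "connected_component (- (C1 \<union> C3)) x y2"
      by (rule touch_component[OF E(1,3) _ cl(1,3) c(2) i(1) _ t(2) y(2)]) (use E i in auto)
    show "connected_component (- (C2 \<union> C3)) x y1"
      by (rule touch_component[OF E(1,3) _ cl(2,3) c(1) _ _ t(1) y(1)]) (use E i in auto)
  qed
qed

text \<open>A closed curve has only two sides. With \<open>crossing_sides\<close> this puts two sets
  that avoid the same third arc on one common side.\<close>

lemma two_sides_only:
  assumes "arc_between C a b" "arc_between D a b" "C \<inter> D = {a, b}"
    and "x \<notin> C \<union> D" "y \<notin> C \<union> D" "z \<notin> C \<union> D"
    and "\<not> connected_component (- (C \<union> D)) x z" "\<not> connected_component (- (C \<union> D)) y z"
  shows "connected_component (- (C \<union> D)) x y"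
proof -
  obtain A B where AB: "connected A" "connected B" "A \<union> B = - (C \<union> D)"
    using two_arcs_sides[OF assms(1-3)] by metis
  have *: "connected_component (- (C \<union> D)) u v" if "u \<in> A \<and> v \<in> A \<or> u \<in> B \<and> v \<in> B" for u v
    using that AB unfolding connected_component_def by blast
  show ?thesis
    using assms(4-8) * AB(3) by (metis ComplI Un_iff)
qed

section \<open>Paths and connected sets in graphs\<close>

text \<open>Reflexive also at vertices outside \<open>W\<close>, so membership of the start has to
  be demanded wherever it matters.\<close>

definition reach :: "('a \<Rightarrow> 'a \<Rightarrow> bool) \<Rightarrow> 'a set \<Rightarrow> 'a \<Rightarrow> 'a \<Rightarrow> bool" where
  "reach adj W = (\<lambda>a b. a \<in> W \<and> b \<in> W \<and> adj a b)\<^sup>*\<^sup>*"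

definition conn :: "('a \<Rightarrow> 'a \<Rightarrow> bool) \<Rightarrow> 'a set \<Rightarrow> bool" where
  "conn adj W \<longleftrightarrow> (\<forall>x\<in>W. \<forall>y\<in>W. reach adj W x y)"

definition linked :: "('a \<Rightarrow> 'a \<Rightarrow> bool) \<Rightarrow> 'a set \<Rightarrow> 'a set \<Rightarrow> bool" where
  "linked adj A B \<longleftrightarrow> (\<exists>a\<in>A. \<exists>b\<in>B. adj a b)"

definition gpath :: "('a \<Rightarrow> 'a \<Rightarrow> bool) \<Rightarrow> 'a list \<Rightarrow> bool" where
  "gpath adj xs \<longleftrightarrow> xs \<noteq> [] \<and> distinct xs \<and> successively adj xs"

lemma reach_refl [simp]: "reach adj W x x"
  by (simp add: reach_def)

lemma reach_step: "a \<in> W \<Longrightarrow> b \<in> W \<Longrightarrow> adj a b \<Longrightarrow> reach adj W a b"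
  by (simp add: reach_def r_into_rtranclp)

lemma reach_trans: "reach adj W x y \<Longrightarrow> reach adj W y z \<Longrightarrow> reach adj W x z"
  unfolding reach_def by (rule rtranclp_trans)

lemma reach_mono:
  assumes "reach adj W x y" "W \<subseteq> W'"
  shows "reach adj W' x y"
  using assms(1) unfolding reach_def
  by (rule rtranclp_mono[THEN predicate2D, rotated]) (use assms(2) in auto)

lemma reach_sym:
  assumes "symp adj" "reach adj W x y"
  shows "reach adj W y x"
  using assms(2) unfolding reach_def
proof (induction rule: rtranclp_induct)
  case (step y z)
  show ?case
    by (rule converse_rtranclp_into_rtranclp[OF _ step(3)]) (use step(2) sympD[OF assms(1)] in auto)
qed simp

lemma conn_singleton [simp]: "conn adj {x}"
  by (simp add: conn_def)

lemma conn_empty [simp]: "conn adj {}"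
  by (simp add: conn_def)

lemma conn_hub:
  assumes "symp adj" "\<And>x. x \<in> W \<Longrightarrow> reach adj W h x"
  shows "conn adj W"
  unfolding conn_def using assms reach_sym reach_trans by metis

lemma conn_Un:
  assumes "symp adj" "conn adj A" "conn adj B" "linked adj A B"
  shows "conn adj (A \<union> B)"
proof -
  obtain a b where ab: "a \<in> A" "b \<in> B" "adj a b"
    using assms(4) by (auto simp: linked_def)
  show ?thesis
  proof (rule conn_hub[OF assms(1)])
    fix x
    assume "x \<in> A \<union> B"
    moreover have "reach adj (A \<union> B) a x" if "x \<in> A"
      using assms(2) that ab unfolding conn_def by (blast intro: reach_mono)
    moreover have "reach adj (A \<union> B) a x" if "x \<in> B"
    proof (rule reach_trans)
      show "reach adj (A \<union> B) a b"
        using ab by (auto intro: reach_step)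
      show "reach adj (A \<union> B) b x"
        using assms(3) that ab unfolding conn_def by (blast intro: reach_mono)
    qed
    ultimately show "reach adj (A \<union> B) a x"
      by blast
  qed
qed

lemma conn_insert:
  assumes "symp adj" "conn adj A" "linked adj A {b}"
  shows "conn adj (insert b A)"
  using conn_Un[OF assms(1,2) conn_singleton assms(3)] by simp

lemma conn_component:
  assumes "symp adj"
  shows "conn adj {y \<in> W. reach adj W x y}"
proof (rule conn_hub[OF assms])
  fix y
  assume "y \<in> {y \<in> W. reach adj W x y}"
  then have "reach adj W x y"
    by simp
  then show "reach adj {y \<in> W. reach adj W x y} x y"
    unfolding reach_def
  proof (induction rule: rtranclp_induct)
    case (step y z)
    have z: "(\<lambda>a b. a \<in> W \<and> b \<in> W \<and> adj a b)\<^sup>*\<^sup>* x z"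
      by (rule rtranclp.rtrancl_into_rtrancl[OF step(1)]) (use step(2) in auto)
    show ?case
      by (rule rtranclp.rtrancl_into_rtrancl[OF step(3)]) (use step(1,2) z in auto)
  qed simp
qed

lemma gpath_append_iff:
  assumes "xs \<noteq> []" "ys \<noteq> []"
  shows "gpath adj (xs @ ys) \<longleftrightarrow> gpath adj xs \<and> gpath adj ys \<and> set xs \<inter> set ys = {} \<and> adj (last xs) (hd ys)"
  using assms by (auto simp: gpath_def successively_append_iff)

lemma gpath_rev: "symp adj \<Longrightarrow> gpath adj (rev xs) \<longleftrightarrow> gpath adj xs"
  unfolding gpath_def by (auto elim!: successively_mono dest: sympD)

lemma gpath_singleton [simp]: "gpath adj [x]"
  by (simp add: gpath_def)

lemma gpath_Cons: "xs \<noteq> [] \<Longrightarrow> gpath adj (x # xs) \<longleftrightarrow> x \<notin> set xs \<and> adj x (hd xs) \<and> gpath adj xs"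
  by (auto simp: gpath_def successively_Cons)

lemma gpath_prefix: "gpath adj (xs @ ys) \<Longrightarrow> xs \<noteq> [] \<Longrightarrow> gpath adj xs"
  by (auto simp: gpath_def successively_append_iff)

lemma gpath_suffix: "gpath adj (xs @ ys) \<Longrightarrow> ys \<noteq> [] \<Longrightarrow> gpath adj ys"
  by (auto simp: gpath_def successively_append_iff)

lemma reach_gpath:
  assumes "reach adj W x y" "x \<in> W"
  obtains xs where "gpath adj xs" "hd xs = x" "last xs = y" "set xs \<subseteq> W"
proof -
  have "\<exists>xs. gpath adj xs \<and> hd xs = x \<and> last xs = y \<and> set xs \<subseteq> W"
    using assms(1) unfolding reach_def
  proof (induction rule: rtranclp_induct)
    case base
    show ?case
      using assms(2) by (intro exI[of _ "[x]"]) auto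
  next
    case (step y z)
    then obtain xs where xs: "gpath adj xs" "hd xs = x" "last xs = y" "set xs \<subseteq> W"
      by blast
    have ne: "xs \<noteq> []"
      using xs by (auto simp: gpath_def)
    show ?case
    proof (cases "z \<in> set xs")
      case True
      then obtain us vs where uv: "xs = us @ z # vs"
        by (meson split_list)
      have "gpath adj (us @ [z])"
        using xs(1) uv gpath_prefix[of adj "us @ [z]" vs] by simp
      moreover have "hd (us @ [z]) = x"
        using xs(2) uv by (cases us) auto
      ultimately show ?thesis
        using xs(4) uv by (intro exI[of _ "us @ [z]"]) auto
    next
      case False
      then have "gpath adj (xs @ [z])"
        using xs step ne by (simp add: gpath_append_iff)
      then show ?thesis
        using xs step ne by (intro exI[of _ "xs @ [z]"]) auto
    qed
  qed
  then show ?thesis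
    using that by blast
qed

lemma conn_gpath:
  assumes "conn adj W" "x \<in> W" "y \<in> W"
  obtains xs where "gpath adj xs" "hd xs = x" "last xs = y" "set xs \<subseteq> W"
proof -
  have "reach adj W x y"
    using assms by (simp add: conn_def)
  then obtain xs where "gpath adj xs" "hd xs = x" "last xs = y" "set xs \<subseteq> W"
    by (rule reach_gpath[OF _ assms(2)])
  then show ?thesis
    by (rule that)
qed

lemma gpath_reach:
  assumes "gpath adj xs" "set xs \<subseteq> W" "y \<in> set xs"
  shows "reach adj W (hd xs) y"
proof -
  have "successively adj xs"
    using assms(1) by (simp add: gpath_def)
  then show ?thesis
    using assms(2,3)
  proof (induction xs)
    case (Cons x xs)
    show ?case
    proof (cases "y = x \<or> xs = []")
      case False
      with Cons.prems have 1: "y \<in> set xs" "successively adj xs" "adj x (hd xs)" "x \<in> W" "set xs \<subseteq> W"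
        by (auto simp: successively_Cons)
      have h: "hd xs \<in> W"
        using 1(5) False by (cases xs) auto
      have "reach adj W x (hd xs)"
        by (rule reach_step[of x W "hd xs" adj, OF 1(4) h 1(3)])
      moreover have "reach adj W (hd xs) y"
        by (rule Cons.IH[OF 1(2,5,1)])
      ultimately show ?thesis
        using reach_trans[of adj W x "hd xs" y] by simp
    qed (use Cons.prems in auto)
  qed simp
qed

lemma first_hit:
  assumes "conn adj W" "z \<in> W" "Q \<inter> W \<noteq> {}"
  obtains xs c where "gpath adj (xs @ [c])" "hd (xs @ [c]) = z" "c \<in> Q \<inter> W" "set xs \<subseteq> W - Q"
proof -
  obtain q where q: "q \<in> Q" "q \<in> W"
    using assms by blast
  obtain xs where xs: "gpath adj xs" "hd xs = z" "last xs = q" "set xs \<subseteq> W"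
    using conn_gpath[OF assms(1,2) q(2)] .
  have "q \<in> set xs"
    using xs by (metis gpath_def last_in_set)
  then obtain us c vs where uv: "xs = us @ c # vs" "c \<in> Q" "\<forall>u\<in>set us. u \<notin> Q"
    using split_list_first_prop[of xs "\<lambda>x. x \<in> Q"] q by blast
  show ?thesis
  proof (rule that)
    show "gpath adj (us @ [c])"
      using xs(1) uv gpath_prefix[of adj "us @ [c]" vs] by simp
    show "hd (us @ [c]) = z"
      using xs(2) uv by (cases us) auto
  qed (use xs uv in auto)
qed

text \<open>Take a path from \<open>x\<close> to \<open>y\<close> and follow a path from
  \<open>z\<close> up to its first vertex \<open>c\<close> on it. The centre \<open>c\<close> may be
  one of the three vertices, in which case a leg is empty.\<close>

lemma tripod:
  assumes "symp adj" "conn adj W" "x \<in> W" "y \<in> W" "z \<in> W"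
  obtains c xs ys zs where "gpath adj (c # xs)" "gpath adj (c # ys)" "gpath adj (c # zs)"
    "last (c # xs) = x" "last (c # ys) = y" "last (c # zs) = z"
    "c \<in> W" "set xs \<subseteq> W" "set ys \<subseteq> W" "set zs \<subseteq> W"
    "set xs \<inter> set ys = {}" "set xs \<inter> set zs = {}" "set ys \<inter> set zs = {}"
proof -
  obtain ps where ps: "gpath adj ps" "hd ps = x" "last ps = y" "set ps \<subseteq> W"
    using conn_gpath[OF assms(2-4)] .
  have "set ps \<inter> W \<noteq> {}"
    using ps(1,4) by (auto simp: gpath_def Int_absorb2)
  then obtain qs c where q: "gpath adj (qs @ [c])" "hd (qs @ [c]) = z" "c \<in> set ps \<inter> W" "set qs \<subseteq> W - set ps"
    using first_hit[OF assms(2,5)] by metis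
  obtain us vs where uv: "ps = us @ c # vs"
    using q(3) by (metis IntD1 split_list)
  have 1: "gpath adj (c # rev us)"
    using ps(1) uv gpath_prefix[of adj "us @ [c]" vs] gpath_rev[OF assms(1), of "us @ [c]"] by simp
  have 2: "gpath adj (c # vs)"
    using ps(1) uv gpath_suffix[of adj us "c # vs"] by simp
  have 3: "gpath adj (c # rev qs)"
    using q(1) gpath_rev[OF assms(1), of "qs @ [c]"] by simp
  have d: "distinct ps"
    using ps by (simp add: gpath_def)
  show ?thesis
  proof (rule that[OF 1 2 3])
    show "last (c # rev us) = x"
      using ps(2) uv by (cases us) auto
    show "last (c # vs) = y"
      using ps(3) uv by (cases vs) auto
    show "last (c # rev qs) = z"
      using q(2) by (cases qs) auto
    show "c \<in> W"
      using q by blast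
    show "set (rev us) \<subseteq> W" "set vs \<subseteq> W" "set (rev qs) \<subseteq> W"
      "set (rev us) \<inter> set (rev qs) = {}" "set vs \<inter> set (rev qs) = {}"
      using ps(4) q(4) uv by auto
    show "set (rev us) \<inter> set vs = {}"
      using d uv by auto
  qed
qed

lemma linked_sym: "symp adj \<Longrightarrow> linked adj A B \<Longrightarrow> linked adj B A"
  unfolding linked_def by (meson sympD)

lemma theta_leg:
  assumes "symp adj" "gpath adj (c # us)" "gpath adj (d # vs)" "conn adj B" "b \<in> B" "b' \<in> B"
    and "adj (last (c # us)) b" "adj (last (d # vs)) b'"
    and d: "c \<in> A" "set us \<subseteq> A" "d \<in> A'" "set vs \<subseteq> A'" "A \<inter> A' = {}" "A \<inter> B = {}" "A' \<inter> B = {}"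
  obtains ws where "gpath adj (c # us @ ws @ rev vs @ [d])" "ws \<noteq> []" "set ws \<subseteq> B"
proof -
  obtain ws where w: "gpath adj ws" "hd ws = b" "last ws = b'" "set ws \<subseteq> B"
    using conn_gpath[OF assms(4-6)] .
  have ne: "ws \<noteq> []"
    using w by (auto simp: gpath_def)
  have dj: "set (c # us) \<inter> set (d # vs) = {}" "set (c # us) \<inter> set ws = {}" "set (d # vs) \<inter> set ws = {}"
  proof -
    have "set (c # us) \<subseteq> A" "set (d # vs) \<subseteq> A'"
      using d(1-4) by simp_all
    then show "set (c # us) \<inter> set (d # vs) = {}" "set (c # us) \<inter> set ws = {}" "set (d # vs) \<inter> set ws = {}"
      using d(5-7) w(4) by blast+
  qed
  have r: "gpath adj (rev (d # vs))"
    using assms(3) gpath_rev[OF assms(1)] by blast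
  have "adj b' (last (d # vs))"
    using assms(8) sympD[OF assms(1)] by blast
  then have 1: "gpath adj (ws @ rev (d # vs))"
    using w(1,3) r dj(3) gpath_append_iff[of ws "rev (d # vs)" adj] ne
    by (simp only: hd_rev set_rev Int_commute rev_is_Nil_conv list.simps simp_thms)
  have "gpath adj ((c # us) @ (ws @ rev (d # vs)))"
  proof (subst gpath_append_iff)
    show "gpath adj (c # us) \<and> gpath adj (ws @ rev (d # vs)) \<and>
      set (c # us) \<inter> set (ws @ rev (d # vs)) = {} \<and> adj (last (c # us)) (hd (ws @ rev (d # vs)))"
      using assms(2,7) 1 dj(1,2) w(2) ne by (simp add: Int_Un_distrib)
  qed (use ne in simp_all)
  then show ?thesis
    by (intro that[of ws]) (use ne w(4) in simp_all)
qed

text \<open>A tripod in each of the hubs \<open>A\<close> and \<open>A'\<close> supplies the two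
  branch vertices, and a path through each \<open>B\<close> set completes a leg. The three blocks of
  a leg stay separate in the conclusion because the minor arguments must know which stretch lies in
  which branch set.\<close>

lemma theta_exists:
  assumes s: "symp adj" and c: "conn adj A" "conn adj A'" "conn adj B1" "conn adj B2" "conn adj B3"
    and d: "A \<inter> A' = {}" "A \<inter> (B1 \<union> B2 \<union> B3) = {}" "A' \<inter> (B1 \<union> B2 \<union> B3) = {}"
      "B1 \<inter> B2 = {}" "B1 \<inter> B3 = {}" "B2 \<inter> B3 = {}"
    and l: "linked adj A B1" "linked adj A B2" "linked adj A B3" "linked adj A' B1" "linked adj A' B2" "linked adj A' B3"
  obtains c d u1 u2 u3 v1 v2 v3 w1 w2 w3 where
    "gpath adj (c # u1 @ w1 @ v1 @ [d])" "gpath adj (c # u2 @ w2 @ v2 @ [d])" "gpath adj (c # u3 @ w3 @ v3 @ [d])"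
    "w1 \<noteq> []" "w2 \<noteq> []" "w3 \<noteq> []" "set w1 \<subseteq> B1" "set w2 \<subseteq> B2" "set w3 \<subseteq> B3"
    "c \<in> A" "set u1 \<subseteq> A" "set u2 \<subseteq> A" "set u3 \<subseteq> A"
    "d \<in> A'" "set v1 \<subseteq> A'" "set v2 \<subseteq> A'" "set v3 \<subseteq> A'"
    "set (u1 @ w1 @ v1) \<inter> set (u2 @ w2 @ v2) = {}" "set (u1 @ w1 @ v1) \<inter> set (u3 @ w3 @ v3) = {}"
    "set (u2 @ w2 @ v2) \<inter> set (u3 @ w3 @ v3) = {}"
proof -
  obtain a1 b1 where g1: "a1 \<in> A" "b1 \<in> B1" "adj a1 b1" using l by (auto simp: linked_def)
  obtain a2 b2 where g2: "a2 \<in> A" "b2 \<in> B2" "adj a2 b2" using l by (auto simp: linked_def)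
  obtain a3 b3 where g3: "a3 \<in> A" "b3 \<in> B3" "adj a3 b3" using l by (auto simp: linked_def)
  obtain a1' b1' where h1: "a1' \<in> A'" "b1' \<in> B1" "adj a1' b1'" using l by (auto simp: linked_def)
  obtain a2' b2' where h2: "a2' \<in> A'" "b2' \<in> B2" "adj a2' b2'" using l by (auto simp: linked_def)
  obtain a3' b3' where h3: "a3' \<in> A'" "b3' \<in> B3" "adj a3' b3'" using l by (auto simp: linked_def)
  obtain c u1 u2 u3 where u: "gpath adj (c # u1)" "gpath adj (c # u2)" "gpath adj (c # u3)"
    "last (c # u1) = a1" "last (c # u2) = a2" "last (c # u3) = a3"
    "c \<in> A" "set u1 \<subseteq> A" "set u2 \<subseteq> A" "set u3 \<subseteq> A"
    "set u1 \<inter> set u2 = {}" "set u1 \<inter> set u3 = {}" "set u2 \<inter> set u3 = {}"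
    using tripod[OF s c(1) g1(1) g2(1) g3(1)] .
  obtain d v1 v2 v3 where v: "gpath adj (d # v1)" "gpath adj (d # v2)" "gpath adj (d # v3)"
    "last (d # v1) = a1'" "last (d # v2) = a2'" "last (d # v3) = a3'"
    "d \<in> A'" "set v1 \<subseteq> A'" "set v2 \<subseteq> A'" "set v3 \<subseteq> A'"
    "set v1 \<inter> set v2 = {}" "set v1 \<inter> set v3 = {}" "set v2 \<inter> set v3 = {}"
    using tripod[OF s c(2) h1(1) h2(1) h3(1)] .
  obtain w1 where w1: "gpath adj (c # u1 @ w1 @ rev v1 @ [d])" "w1 \<noteq> []" "set w1 \<subseteq> B1"
  proof (rule theta_leg[OF s u(1) v(1) c(3) g1(2) h1(2) _ _ u(7) u(8) v(7) v(8) d(1)])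
    show "adj (last (c # u1)) b1" "adj (last (d # v1)) b1'"
      unfolding u(4) v(4) using g1(3) h1(3) .
    show "A \<inter> B1 = {}" "A' \<inter> B1 = {}"
      using d(2,3) by blast+
  qed
  obtain w2 where w2: "gpath adj (c # u2 @ w2 @ rev v2 @ [d])" "w2 \<noteq> []" "set w2 \<subseteq> B2"
  proof (rule theta_leg[OF s u(2) v(2) c(4) g2(2) h2(2) _ _ u(7) u(9) v(7) v(9) d(1)])
    show "adj (last (c # u2)) b2" "adj (last (d # v2)) b2'"
      unfolding u(5) v(5) using g2(3) h2(3) .
    show "A \<inter> B2 = {}" "A' \<inter> B2 = {}"
      using d(2,3) by blast+
  qed
  obtain w3 where w3: "gpath adj (c # u3 @ w3 @ rev v3 @ [d])" "w3 \<noteq> []" "set w3 \<subseteq> B3"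
  proof (rule theta_leg[OF s u(3) v(3) c(5) g3(2) h3(2) _ _ u(7) u(10) v(7) v(10) d(1)])
    show "adj (last (c # u3)) b3" "adj (last (d # v3)) b3'"
      unfolding u(6) v(6) using g3(3) h3(3) .
    show "A \<inter> B3 = {}" "A' \<inter> B3 = {}"
      using d(2,3) by blast+
  qed
  have dj: "set (u @ w @ rev v) \<inter> set (u' @ w' @ rev v') = {}"
    if "set u \<subseteq> A" "set u' \<subseteq> A" "set v \<subseteq> A'" "set v' \<subseteq> A'" "set u \<inter> set u' = {}" "set v \<inter> set v' = {}"
      "set w \<inter> set w' = {}" "set w \<subseteq> B1 \<union> B2 \<union> B3" "set w' \<subseteq> B1 \<union> B2 \<union> B3" for u v w u' v' w'
    using that d(1-3) unfolding set_append set_rev by blast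
  have w: "set w1 \<inter> set w2 = {}" "set w1 \<inter> set w3 = {}" "set w2 \<inter> set w3 = {}"
    "set w1 \<subseteq> B1 \<union> B2 \<union> B3" "set w2 \<subseteq> B1 \<union> B2 \<union> B3" "set w3 \<subseteq> B1 \<union> B2 \<union> B3"
    using w1(3) w2(3) w3(3) d(4-6) by blast+
  have v': "set (rev v1) \<subseteq> A'" "set (rev v2) \<subseteq> A'" "set (rev v3) \<subseteq> A'"
    using v(8-10) by simp_all
  show ?thesis
    by (rule that[OF w1(1) w2(1) w3(1) w1(2) w2(2) w3(2) w1(3) w2(3) w3(3) u(7-10) v(7) v'
          dj[OF u(8,9) v(8,9) u(11) v(11) w(1,4,5)] dj[OF u(8,10) v(8,10) u(12) v(12) w(2,4,6)]
          dj[OF u(9,10) v(9,10) u(13) v(13) w(3,5,6)]])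
qed

section \<open>Drawings of graphs\<close>

lemma arc_between_closure:
  assumes "arc_between C a b"
  shows "C \<subseteq> closure (C - {a, b})"
proof -
  obtain g where g: "arc g" "pathstart g = a" "pathfinish g = b" "path_image g = C"
    using assms by (auto simp: arc_between_def)
  have cont: "continuous_on {0..1} g" and inj: "inj_on g {0..1}"
    using g(1) by (auto simp: arc_def path_def)
  have sub: "g ` {0<..<1} \<subseteq> C - {a, b}"
  proof
    fix z
    assume "z \<in> g ` {0<..<1}"
    then obtain t where t: "0 < t" "t < 1" "z = g t"
      by auto
    then have "z \<noteq> g 0" "z \<noteq> g 1"
      using inj_onD[OF inj, of t 0] inj_onD[OF inj, of t 1] by auto
    then show "z \<in> C - {a, b}"
      using t g by (auto simp: path_image_def pathstart_def pathfinish_def)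
  qed
  have "g ` closure {0<..<1} \<subseteq> closure (g ` {0<..<1})"
    by (rule image_closure_subset[OF _ closed_closure closure_subset]) (use cont in simp)
  then have "C \<subseteq> closure (g ` {0<..<1})"
    using g(4) by (auto simp: path_image_def)
  then show ?thesis
    using closure_mono[OF sub] by blast
qed

lemma arc_between_half:
  assumes "arc_between C a b"
  shows "connected (C - {b})" "b \<in> closure (C - {b})"
proof -
  have "closure (C - {a, b}) \<subseteq> closure (C - {b})"
    by (rule closure_mono) blast
  with arc_between_closure[OF assms] have cl: "C \<subseteq> closure (C - {b})"
    by (rule subset_trans)
  show "connected (C - {b})"
    by (rule connected_intermediate_closure[OF arc_between_props(4)[OF assms]])
      (use arc_between_closure[OF assms] in \<open>blast+\<close>)
  show "b \<in> closure (C - {b})"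
    using cl arc_between_props(7)[OF assms] by blast
qed

section \<open>Consecutive pairs of vertices on a path\<close>

fun edges_of :: "'a list \<Rightarrow> 'a set set" where
  "edges_of [] = {}"
| "edges_of [x] = {}"
| "edges_of (x # y # zs) = insert {x, y} (edges_of (y # zs))"

lemma edges_of_append: "edges_of (xs @ y # zs) = edges_of (xs @ [y]) \<union> edges_of (y # zs)"
proof (induction xs)
  case (Cons x xs)
  then show ?case
    by (cases xs) auto
qed simp

lemma edges_of_rev: "edges_of (rev xs) = edges_of xs"
proof (induction xs rule: edges_of.induct)
  case (3 x y zs)
  have "edges_of (rev (x # y # zs)) = edges_of (rev zs @ [y]) \<union> edges_of [y, x]"
    using edges_of_append[of "rev zs" y "[x]"] by simp
  then show ?case
    using 3 by auto
qed auto

lemma edges_of_subset: "e \<in> edges_of xs \<Longrightarrow> e \<subseteq> set xs"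
  by (induction xs rule: edges_of.induct) auto

lemma edges_of_split:
  assumes "e \<in> edges_of (xs @ z # ys)"
  shows "e \<subseteq> insert z (set xs) \<or> e \<subseteq> insert z (set ys)"
proof -
  have "e \<in> edges_of (xs @ [z]) \<union> edges_of (z # ys)"
    using assms edges_of_append[of xs z ys] by blast
  then show ?thesis
    using edges_of_subset[of e "xs @ [z]"] edges_of_subset[of e "z # ys"] by auto
qed

lemma edges_of_far:
  assumes "distinct (xs @ ws @ ys)" "ws \<noteq> []" "x \<in> set xs" "y \<in> set ys"
  shows "{x, y} \<notin> edges_of (xs @ ws @ ys)"
proof
  assume "{x, y} \<in> edges_of (xs @ ws @ ys)"
  moreover obtain z zs where "ws = z # zs"
    using assms(2) by (cases ws) auto
  ultimately show False
    using edges_of_split[of "{x, y}" xs z "zs @ ys"] assms by auto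
qed

lemma edges_of_snoc_meets: "e \<in> edges_of (xs @ [s]) \<Longrightarrow> e \<inter> set xs \<noteq> {}"
  by (induction xs rule: edges_of.induct) auto

text \<open>Every edge of the path other than one from \<open>r\<close> to \<open>s\<close> contains
  an inner vertex, and inner vertices avoid \<open>Z\<close>. This excludes edges shared by two
  paths with disjoint interiors.\<close>

lemma edges_of_tips:
  assumes "e \<in> edges_of (r # ms @ [s])" "e \<subseteq> Z" "set ms \<inter> Z = {}"
  shows "ms = [] \<and> e = {r, s}"
proof (cases ms)
  case Nil
  then show ?thesis
    using assms by auto
next
  case (Cons m ms')
  then have "e = {r, m} \<or> e \<in> edges_of (ms @ [s])"
    using assms(1) by simp
  then have "e \<inter> set ms \<noteq> {}"
    using edges_of_snoc_meets[of e ms s] Cons by auto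
  then show ?thesis
    using assms(2,3) by blast
qed

section \<open>Graph paths as arcs, connected vertex sets as connected plane sets\<close>

locale drawing =
  fixes V :: "'a set" and E :: "'a set set" and p :: "'a \<Rightarrow> complex" and \<gamma> :: "'a set \<Rightarrow> real \<Rightarrow> complex"
  assumes simple: "simple_graph V E" and drawn: "plane_drawing V E p \<gamma>"
begin

definition adj :: "'a \<Rightarrow> 'a \<Rightarrow> bool" where
  "adj x y \<longleftrightarrow> {x, y} \<in> E"

text \<open>A union of edge arcs, so a path with a single vertex has empty image; hence the length
  bounds below.\<close>

definition img :: "'a list \<Rightarrow> complex set" where
  "img xs = (\<Union>e\<in>edges_of xs. path_image (\<gamma> e))"

lemma symp_adj: "symp adj"
  by (auto simp: symp_def adj_def insert_commute)

lemma adj_V: "adj x y \<Longrightarrow> x \<in> V \<and> y \<in> V"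
  using simple by (auto simp: simple_graph_def adj_def)

lemma inj_p: "inj_on p V"
  using drawn by (simp add: plane_drawing_def)

lemma edge_arc:
  assumes "adj x y"
  shows "arc_between (path_image (\<gamma> {x, y})) (p x) (p y)"
proof -
  have e: "arc (\<gamma> {x, y})" "{pathstart (\<gamma> {x, y}), pathfinish (\<gamma> {x, y})} = {p x, p y}"
    using drawn assms by (auto simp: plane_drawing_def adj_def)
  then have "arc_between (path_image (\<gamma> {x, y})) (pathstart (\<gamma> {x, y})) (pathfinish (\<gamma> {x, y}))"
    by (auto simp: arc_between_def)
  then show ?thesis
    using e(2) arc_between_sym by (metis doubleton_eq_iff)
qed

lemma edge_vertices: "e \<in> E \<Longrightarrow> path_image (\<gamma> e) \<inter> p ` V = p ` e"
  using drawn by (auto simp: plane_drawing_def)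

lemma edge_inter: "e \<in> E \<Longrightarrow> f \<in> E \<Longrightarrow> e \<noteq> f \<Longrightarrow> path_image (\<gamma> e) \<inter> path_image (\<gamma> f) = p ` (e \<inter> f)"
  using drawn by (auto simp: plane_drawing_def)

lemma edges_of_E: "gpath adj xs \<Longrightarrow> edges_of xs \<subseteq> E"
  unfolding gpath_def
proof (induction xs rule: edges_of.induct)
  case (3 x y zs)
  then show ?case
    by (auto simp: adj_def)
qed auto

lemma gpath_V: "gpath adj xs \<Longrightarrow> 2 \<le> length xs \<Longrightarrow> set xs \<subseteq> V"
  unfolding gpath_def
proof (induction xs rule: edges_of.induct)
  case (3 x y zs)
  then show ?case
    using adj_V by (cases zs) (auto simp: successively_Cons)
qed auto

lemma img_edge_inter:
  assumes "gpath adj xs" "e \<in> E" "e \<notin> edges_of xs"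
  shows "path_image (\<gamma> e) \<inter> img xs \<subseteq> p ` (e \<inter> set xs)"
proof
  fix z
  assume "z \<in> path_image (\<gamma> e) \<inter> img xs"
  then obtain f where f: "f \<in> edges_of xs" "z \<in> path_image (\<gamma> e)" "z \<in> path_image (\<gamma> f)"
    by (auto simp: img_def)
  moreover have "e \<noteq> f" "f \<in> E"
    using f assms edges_of_E by auto
  ultimately have "z \<in> p ` (e \<inter> f)"
    using edge_inter[OF assms(2), of f] by blast
  then show "z \<in> p ` (e \<inter> set xs)"
    using edges_of_subset[OF f(1)] by blast
qed

lemma img_inter:
  assumes "gpath adj xs" "gpath adj ys" "edges_of xs \<inter> edges_of ys = {}"
  shows "img xs \<inter> img ys \<subseteq> p ` (set xs \<inter> set ys)"
proof
  fix z
  assume z: "z \<in> img xs \<inter> img ys"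
  then obtain e where e: "e \<in> edges_of xs" "z \<in> path_image (\<gamma> e)"
    by (auto simp: img_def)
  have "e \<in> E" "e \<notin> edges_of ys"
    using e assms edges_of_E by auto
  then have "z \<in> p ` (e \<inter> set ys)"
    using img_edge_inter[OF assms(2), of e] e z by blast
  then show "z \<in> p ` (set xs \<inter> set ys)"
    using edges_of_subset[OF e(1)] by blast
qed

lemma vertex_img: "gpath adj xs \<Longrightarrow> 2 \<le> length xs \<Longrightarrow> v \<in> set xs \<Longrightarrow> p v \<in> img xs"
  unfolding gpath_def
proof (induction xs rule: edges_of.induct)
  case (3 x y zs)
  have a: "adj x y"
    using 3 by simp
  note pr = arc_between_props(6,7)[OF edge_arc[OF a]]
  show ?case
  proof (cases "v \<in> {x, y}")
    case True
    then show ?thesis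
      using pr by (auto simp: img_def)
  next
    case False
    then have "p v \<in> img (y # zs)"
      using 3 by (cases zs) auto
    then show ?thesis
      by (auto simp: img_def)
  qed
qed auto

lemma img_vertex:
  assumes "gpath adj xs" "v \<in> V" "p v \<in> img xs"
  shows "v \<in> set xs"
proof -
  obtain e where e: "e \<in> edges_of xs" "p v \<in> path_image (\<gamma> e)"
    using assms(3) by (auto simp: img_def)
  then have "e \<in> E"
    using edges_of_E assms by blast
  then have "p v \<in> p ` e" "e \<subseteq> V"
    using edge_vertices e assms simple by (auto simp: simple_graph_def)
  then have "v \<in> e"
    using inj_on_image_mem_iff[OF inj_p assms(2)] by blast
  then show ?thesis
    using edges_of_subset[OF e(1)] by blast
qed

lemma img_arc: "gpath adj xs \<Longrightarrow> 2 \<le> length xs \<Longrightarrow> arc_between (img xs) (p (hd xs)) (p (last xs))"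
proof (induction xs rule: edges_of.induct)
  case (3 x y zs)
  have a: "adj x y" and g: "gpath adj (y # zs)" and x: "x \<notin> set (y # zs)"
    using 3 by (auto simp: gpath_Cons)
  show ?case
  proof (cases zs)
    case Nil
    then show ?thesis
      using edge_arc[OF a] by (simp add: img_def)
  next
    case (Cons z zs')
    then have i: "arc_between (img (y # zs)) (p y) (p (last (y # zs)))"
      using 3 g by simp
    have "{x, y} \<notin> edges_of (y # zs)"
      using x edges_of_subset by fastforce
    then have "path_image (\<gamma> {x, y}) \<inter> img (y # zs) \<subseteq> p ` ({x, y} \<inter> set (y # zs))"
      by (intro img_edge_inter[OF g]) (use a in \<open>simp add: adj_def\<close>)
    also have "\<dots> \<subseteq> {p y}"
      using x by auto
    finally show ?thesis
      using arc_between_join[OF edge_arc[OF a] i] by (simp add: img_def)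
  qed
qed (auto simp: gpath_def)

text \<open>The interiors are disjoint, so a common edge could only join \<open>c\<close> and
  \<open>d\<close>, which is impossible on a path with an inner vertex. The list \<open>q'\<close>
  may be empty: a link between two legs can be a single edge.\<close>

lemma theta_img:
  assumes "gpath adj (c # q @ [d])" "gpath adj (c # q' @ [d])" "q \<noteq> []" "set q \<inter> set q' = {}"
  shows "img (c # q @ [d]) \<inter> img (c # q' @ [d]) = {p c, p d}"
proof -
  have cd: "c \<notin> set q" "d \<notin> set q" "c \<noteq> d" "c \<notin> set q'" "d \<notin> set q'"
    using assms by (auto simp: gpath_def)
  have "edges_of (c # q @ [d]) \<inter> edges_of (c # q' @ [d]) = {}"
  proof (rule ccontr)
    assume "edges_of (c # q @ [d]) \<inter> edges_of (c # q' @ [d]) \<noteq> {}"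
    then obtain e where e: "e \<in> edges_of (c # q @ [d])" "e \<in> edges_of (c # q' @ [d])"
      by blast
    have "q = []"
      using edges_of_tips[OF e(1) edges_of_subset[OF e(2)]] assms(4) cd by auto
    then show False
      using assms(3) by simp
  qed
  then have "img (c # q @ [d]) \<inter> img (c # q' @ [d]) \<subseteq> p ` (set (c # q @ [d]) \<inter> set (c # q' @ [d]))"
    by (rule img_inter[OF assms(1,2)])
  also have "set (c # q @ [d]) \<inter> set (c # q' @ [d]) = {c, d}"
    using assms(4) cd by auto
  finally have "img (c # q @ [d]) \<inter> img (c # q' @ [d]) \<subseteq> {p c, p d}"
    by simp
  moreover have "p c \<in> img (c # q @ [d]) \<inter> img (c # q' @ [d])" "p d \<in> img (c # q @ [d]) \<inter> img (c # q' @ [d])"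
    using vertex_img[OF assms(1)] vertex_img[OF assms(2)] by simp_all
  ultimately show ?thesis
    by (intro subset_antisym) simp_all
qed

lemma theta_arc: "gpath adj (c # q @ [d]) \<Longrightarrow> arc_between (img (c # q @ [d])) (p c) (p d)"
  using img_arc[of "c # q @ [d]"] by simp

lemma theta_inner:
  assumes "gpath adj (c # q @ [d])" "v \<in> set q"
  shows "p v \<in> img (c # q @ [d]) - {p c, p d}"
proof -
  have "set (c # q @ [d]) \<subseteq> V"
    using gpath_V[OF assms(1)] by simp
  moreover have "v \<noteq> c" "v \<noteq> d"
    using assms by (auto simp: gpath_def)
  ultimately have "p v \<noteq> p c" "p v \<noteq> p d"
    using inj_p assms(2) by (auto dest: inj_onD)
  then show ?thesis
    using vertex_img[OF assms(1)] assms by auto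
qed

text \<open>The drawing of \<open>W\<close> together with its edges to \<open>Z\<close>, each
  stripped of its end in \<open>Z\<close>. For connected \<open>W\<close> it is a connected set that
  avoids every path inside \<open>Z\<close>, while its closure contains the neighbours of
  \<open>W\<close> in \<open>Z\<close>: the set \<open>E\<close> of
  \<open>theta_touch\<close>.\<close>

definition halo :: "'a set \<Rightarrow> 'a set \<Rightarrow> complex set" where
  "halo W Z = p ` W \<union> (\<Union>e\<in>{e \<in> E. e \<inter> W \<noteq> {} \<and> e \<subseteq> W \<union> Z}. path_image (\<gamma> e) - p ` Z)"

lemma halo_piece:
  assumes "x \<in> W" "adj x y" "y \<in> W \<union> Z" "W \<inter> Z = {}" "W \<subseteq> V" "Z \<subseteq> V"
  shows "connected (path_image (\<gamma> {x, y}) - p ` Z)" "path_image (\<gamma> {x, y}) - p ` Z \<subseteq> halo W Z"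
    "p x \<in> path_image (\<gamma> {x, y}) - p ` Z" "y \<in> W \<Longrightarrow> p y \<in> path_image (\<gamma> {x, y}) - p ` Z"
    "y \<in> Z \<Longrightarrow> p y \<in> closure (path_image (\<gamma> {x, y}) - p ` Z)"
proof -
  let ?D = "path_image (\<gamma> {x, y})"
  have e: "{x, y} \<in> E"
    using assms(2) by (simp add: adj_def)
  note ar = edge_arc[OF assms(2)]
  have xy: "p x \<in> ?D" "p y \<in> ?D"
    using arc_between_props(6,7)[OF ar] by auto
  have xV: "x \<in> V" "y \<in> V"
    using adj_V[OF assms(2)] by auto
  have pZ: "p v \<notin> p ` Z" if "v \<in> W" for v
    using that inj_on_image_mem_iff[OF inj_p, of v Z] assms(4-6) by blast
  show "p x \<in> ?D - p ` Z" "y \<in> W \<Longrightarrow> p y \<in> ?D - p ` Z"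
    using xy pZ assms(1) by blast+
  show "?D - p ` Z \<subseteq> halo W Z"
  proof -
    have "{x, y} \<in> {e \<in> E. e \<inter> W \<noteq> {} \<and> e \<subseteq> W \<union> Z}"
      using e assms(1,3) by auto
    then show ?thesis
      unfolding halo_def by (intro le_supI2 UN_upper)
  qed
  have DZ: "?D \<inter> p ` Z \<subseteq> {p x, p y}"
    using edge_vertices[OF e] image_mono[OF assms(6), of p] by auto
  have D: "?D - p ` Z = ?D - (?D \<inter> p ` Z)"
    by blast
  have y_Z: "?D - p ` Z = ?D - {p y}" if "y \<in> Z"
  proof -
    have "?D \<inter> p ` Z = {p y}"
    proof (intro subset_antisym subsetI)
      fix z
      assume "z \<in> ?D \<inter> p ` Z"
      then have "z \<in> {p x, p y}" "z \<in> p ` Z"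
        using DZ by (blast, blast)
      then show "z \<in> {p y}"
        using pZ[OF assms(1)] by (cases "z = p x") simp_all
    qed (use xy(2) that in simp)
    then show ?thesis
      using D by simp
  qed
  have y_W: "?D - p ` Z = ?D" if "y \<in> W"
  proof -
    have "?D \<inter> p ` Z = {}"
    proof (rule equals0I)
      fix z
      assume "z \<in> ?D \<inter> p ` Z"
      then have "z \<in> {p x, p y}" "z \<in> p ` Z"
        using DZ by (blast, blast)
      then show False
        using pZ[OF assms(1)] pZ[OF that] by (cases "z = p x") simp_all
    qed
    then show ?thesis
      using D by simp
  qed
  show "connected (?D - p ` Z)"
    using y_Z y_W arc_between_half(1)[OF ar] arc_between_props(3)[OF ar] assms(3) by (elim UnE) simp_all
  show "y \<in> Z \<Longrightarrow> p y \<in> closure (?D - p ` Z)"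
    using y_Z arc_between_half(2)[OF ar] by simp
qed

lemma halo_connected:
  assumes "conn adj W" "W \<inter> Z = {}" "W \<subseteq> V" "Z \<subseteq> V"
  shows "connected (halo W Z)"
proof (cases "W = {}")
  case True
  then show ?thesis
    by (simp add: halo_def)
next
  case False
  then obtain w0 where w0: "w0 \<in> W"
    by blast
  have inW: "connected_component (halo W Z) (p w0) (p w)" if "w \<in> W" for w
  proof -
    have "reach adj W w0 w"
      using assms(1) w0 that by (simp add: conn_def)
    then show ?thesis
      unfolding reach_def
    proof (induction rule: rtranclp_induct)
      case base
      show ?case
        using w0 by (auto simp: halo_def)
    next
      case (step y z)
      have yz: "y \<in> W" "adj y z" "z \<in> W" "z \<in> W \<union> Z"
        using step(2) by auto
      have "connected_component (halo W Z) (p y) (p z)"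
        unfolding connected_component_def
        using halo_piece(1-3)[OF yz(1,2,4) assms(2-4)] halo_piece(4)[OF yz(1,2,4) assms(2-4) yz(3)] by blast
      with step(3) show ?case
        using connected_component_trans by blast
    qed
  qed
  have "connected_component (halo W Z) (p w0) z" if z: "z \<in> halo W Z" for z
  proof (cases "z \<in> p ` W")
    case True
    then show ?thesis
      using inW by blast
  next
    case False
    then obtain e where e: "e \<in> E" "e \<inter> W \<noteq> {}" "e \<subseteq> W \<union> Z" "z \<in> path_image (\<gamma> e) - p ` Z"
      using z by (auto simp: halo_def)
    obtain x y where xy: "e = {x, y}" "x \<in> W" "y \<in> W \<union> Z"
    proof -
      have "card e = 2"
        using e simple by (simp add: simple_graph_def)
      then obtain a b where "e = {a, b}"
        by (auto simp: card_2_iff)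
      then show ?thesis
        using e that[of a b] that[of b a] by (auto simp: insert_commute)
    qed
    have a: "adj x y"
      using xy e by (simp add: adj_def)
    have "connected_component (halo W Z) (p x) z"
      unfolding connected_component_def
      using halo_piece(1-3)[OF xy(2) a xy(3) assms(2-4)] e(4)[unfolded xy(1)] by blast
    then show ?thesis
      using inW[OF xy(2)] connected_component_trans by blast
  qed
  then show ?thesis
    unfolding connected_iff_connected_component
    by (meson connected_component_sym connected_component_trans)
qed

lemma halo_disjoint:
  assumes "gpath adj xs" "2 \<le> length xs" "set xs \<subseteq> Z" "W \<inter> Z = {}" "W \<subseteq> V" "Z \<subseteq> V"
  shows "halo W Z \<inter> img xs = {}"
proof (rule ccontr)
  assume "halo W Z \<inter> img xs \<noteq> {}"
  then obtain z where z: "z \<in> halo W Z" "z \<in> img xs"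
    by blast
  show False
  proof (cases "z \<in> p ` W")
    case True
    then obtain w where "w \<in> W" "z = p w"
      by blast
    then show False
      using img_vertex[OF assms(1), of w] z assms by auto
  next
    case False
    then obtain e where e: "e \<in> E" "e \<inter> W \<noteq> {}" "z \<in> path_image (\<gamma> e) - p ` Z"
      using z by (auto simp: halo_def)
    have "e \<notin> edges_of xs"
      using edges_of_subset[of e xs] e assms by blast
    then have "z \<in> p ` (e \<inter> set xs)"
      using img_edge_inter[OF assms(1) e(1)] e z by blast
    then show False
      using e assms by blast
  qed
qed

end

section \<open>Excluded minors\<close>

lemma gpath_glue:
  assumes "gpath adj (xs @ [c])" "gpath adj (c # ys)" "set xs \<inter> set ys = {}"
  shows "gpath adj (xs @ c # ys)"
  using assms by (auto simp: gpath_def successively_append_iff)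

text \<open>Start from an edge between \<open>A\<close> and \<open>B\<close> and continue on either
  side only until \<open>Q\<close> or \<open>Q'\<close> is first met; this keeps the inner vertices
  off both sets.\<close>

lemma join_path:
  assumes "symp adj" "conn adj A" "conn adj B" "A \<inter> B = {}" "linked adj A B"
    "Q \<subseteq> A" "Q \<noteq> {}" "Q' \<subseteq> B" "Q' \<noteq> {}"
  obtains x ms y where "gpath adj (x # ms @ [y])" "x \<in> Q" "y \<in> Q'" "set ms \<subseteq> (A - Q) \<union> (B - Q')"
proof -
  obtain a b where ab: "a \<in> A" "b \<in> B" "adj a b"
    using assms(5) by (auto simp: linked_def)
  have ne: "Q \<inter> A \<noteq> {}" "Q' \<inter> B \<noteq> {}"
    using assms(6-9) by (auto simp: Int_absorb2)
  obtain xs x where xs: "gpath adj (xs @ [x])" "hd (xs @ [x]) = a" "x \<in> Q \<inter> A" "set xs \<subseteq> A - Q"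
    using first_hit[OF assms(2) ab(1) ne(1)] by metis
  obtain ys y where ys: "gpath adj (ys @ [y])" "hd (ys @ [y]) = b" "y \<in> Q' \<inter> B" "set ys \<subseteq> B - Q'"
    using first_hit[OF assms(3) ab(2) ne(2)] by metis
  have "set (xs @ [x]) \<subseteq> A" "set (ys @ [y]) \<subseteq> B"
    using xs(3,4) ys(3,4) by auto
  then have "set (rev (xs @ [x])) \<inter> set (ys @ [y]) = {}"
    using assms(4) unfolding set_rev by blast
  moreover have "gpath adj (rev (xs @ [x]))"
    using xs(1) gpath_rev[OF assms(1)] by blast
  moreover have "last (rev (xs @ [x])) = a"
    using xs(2) by (metis last_rev)
  ultimately have "gpath adj (rev (xs @ [x]) @ (ys @ [y]))"
    using gpath_append_iff[of "rev (xs @ [x])" "ys @ [y]" adj] ys(1,2) ab(3) by simp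
  then have "gpath adj (x # (rev xs @ ys) @ [y])"
    by simp
  then show ?thesis
    by (rule that) (use xs(3,4) ys(3,4) in auto)
qed

text \<open>A theta curve uses only a part \<open>Q\<close> of a branch set \<open>B\<close>, and a
  hub next to \<open>B\<close> need not be next to \<open>Q\<close>. The walk from the hub through
  \<open>B - Q\<close> up to \<open>Q\<close> stays in \<open>S\<close>, so the component of
  \<open>a\<close> in \<open>S\<close> absorbs it.\<close>

lemma grow_linked:
  assumes "symp adj" "conn adj A" "a \<in> A" "A \<subseteq> S" "conn adj B" "linked adj A B" "Q \<subseteq> B" "Q \<noteq> {}" "B - Q \<subseteq> S"
  shows "linked adj {y \<in> S. reach adj S a y} Q"
proof -
  obtain a' b where ab: "a' \<in> A" "b \<in> B" "adj a' b"
    using assms(6) by (auto simp: linked_def)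
  have a': "reach adj S a a'"
    using assms(2-4) ab(1) reach_mono unfolding conn_def by metis
  show ?thesis
  proof (cases "b \<in> Q")
    case True
    then show ?thesis
      using a' ab assms(4) unfolding linked_def by blast
  next
    case False
    have "Q \<inter> B \<noteq> {}"
      using assms(7,8) by (auto simp: Int_absorb2)
    then obtain xs z where xs: "gpath adj (xs @ [z])" "hd (xs @ [z]) = b" "z \<in> Q \<inter> B" "set xs \<subseteq> B - Q"
      using first_hit[OF assms(5) ab(2)] by metis
    have ne: "xs \<noteq> []"
      using xs(2,3) False by auto
    have g: "gpath adj xs" "adj (last xs) z"
      using xs(1) ne by (simp_all add: gpath_append_iff)
    have sub: "set xs \<subseteq> S"
      using xs(4) assms(9) by blast
    have hb: "hd xs = b"
      using xs(2) ne by simp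
    have "reach adj S b (last xs)"
      using gpath_reach[OF g(1) sub last_in_set[OF ne]] hb by simp
    moreover have "reach adj S a' b"
      by (rule reach_step) (use ab assms(4) sub hb hd_in_set[OF ne] in auto)
    ultimately have "reach adj S a (last xs)"
      using a' reach_trans by metis
    then show ?thesis
      using g(2) sub last_in_set[OF ne] xs(3) unfolding linked_def by blast
  qed
qed

section \<open>Drawn graphs have no K_{3,3} minor\<close>

context drawing
begin

lemma theta_no_touch:
  assumes g: "gpath adj (c # q1 @ [d])" "gpath adj (c # q2 @ [d])" "gpath adj (c # q3 @ [d])"
    and ne: "q1 \<noteq> []" "q2 \<noteq> []" "q3 \<noteq> []"
    and dj: "set q1 \<inter> set q2 = {}" "set q1 \<inter> set q3 = {}" "set q2 \<inter> set q3 = {}"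
    and W: "conn adj W" "W \<inter> insert c (insert d (set q1 \<union> set q2 \<union> set q3)) = {}"
    and l: "linked adj W (set q1)" "linked adj W (set q2)" "linked adj W (set q3)"
    and V: "W \<subseteq> V"
  shows False
proof -
  define Z where "Z = insert c (insert d (set q1 \<union> set q2 \<union> set q3))"
  have ZV: "Z \<subseteq> V"
    using gpath_V[OF g(1)] gpath_V[OF g(2)] gpath_V[OF g(3)] by (auto simp: Z_def)
  have WZ: "W \<inter> Z = {}"
    using W(2) by (simp add: Z_def)
  have E: "connected (halo W Z)"
    by (rule halo_connected[OF W(1) WZ V ZV])
  have t: "closure (halo W Z) \<inter> (img (c # q @ [d]) - {p c, p d}) \<noteq> {}"
    if h: "gpath adj (c # q @ [d])" "linked adj W (set q)" "set q \<subseteq> Z" for q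
  proof -
    obtain y z where yz: "y \<in> W" "z \<in> set q" "adj y z"
      using h(2) by (auto simp: linked_def)
    have z: "z \<in> W \<union> Z" "z \<in> Z"
      using yz(2) h(3) by auto
    have "p z \<in> closure (halo W Z)"
      using halo_piece(5)[OF yz(1,3) z(1) WZ V ZV z(2)] closure_mono[OF halo_piece(2)[OF yz(1,3) z(1) WZ V ZV]] by blast
    then show ?thesis
      using theta_inner[OF h(1) yz(2)] by blast
  qed
  have d: "halo W Z \<inter> img (c # q @ [d]) = {}" if "gpath adj (c # q @ [d])" "set q \<subseteq> Z" for q
    by (rule halo_disjoint[OF that(1) _ _ WZ V ZV]) (use that in \<open>auto simp: Z_def\<close>)
  have q: "set q1 \<subseteq> Z" "set q2 \<subseteq> Z" "set q3 \<subseteq> Z"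
    by (auto simp: Z_def)
  obtain w where "w \<in> W"
    using l(1) by (auto simp: linked_def)
  then have "halo W Z \<noteq> {}"
    by (auto simp: halo_def)
  moreover have "halo W Z \<inter> (img (c # q1 @ [d]) \<union> img (c # q2 @ [d]) \<union> img (c # q3 @ [d])) = {}"
    using d[OF g(1) q(1)] d[OF g(2) q(2)] d[OF g(3) q(3)] by blast
  ultimately show False
    using theta_touch[OF theta_arc[OF g(1)] theta_arc[OF g(2)] theta_arc[OF g(3)]
        theta_img[OF g(1,2) ne(1) dj(1)] theta_img[OF g(1,3) ne(1) dj(2)] theta_img[OF g(2,3) ne(2) dj(3)] E]
      t[OF g(1) l(1) q(1)] t[OF g(2) l(2) q(2)] t[OF g(3) l(3) q(3)] by blast
qed

text \<open>Branch sets are arbitrary sets, but each of their vertices is an end of some edge: of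
  the link itself or of a walk leading to it.\<close>

lemma linked_V: "linked adj A B \<Longrightarrow> conn adj A \<Longrightarrow> A \<subseteq> V"
proof
  fix x
  assume l: "linked adj A B" "conn adj A" "x \<in> A"
  then obtain a b where ab: "a \<in> A" "adj a b"
    by (auto simp: linked_def)
  then have "reach adj A x a" "a \<in> V"
    using l adj_V by (auto simp: conn_def)
  then show "x \<in> V"
    unfolding reach_def by (cases rule: converse_rtranclpE) (use adj_V in auto)
qed

text \<open>\<open>A1\<close>, \<open>A2\<close> and the \<open>B\<close> sets contain a theta
  curve. What is left of the other branch sets around \<open>A3\<close> touches all of its
  arcs.\<close>

lemma no_K33:
  assumes c: "conn adj A1" "conn adj A2" "conn adj A3" "conn adj B1" "conn adj B2" "conn adj B3"
    and d: "A1 \<inter> A2 = {}" "A1 \<inter> A3 = {}" "A2 \<inter> A3 = {}" "B1 \<inter> B2 = {}" "B1 \<inter> B3 = {}" "B2 \<inter> B3 = {}"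
      "(A1 \<union> A2 \<union> A3) \<inter> (B1 \<union> B2 \<union> B3) = {}"
    and l: "linked adj A1 B1" "linked adj A1 B2" "linked adj A1 B3" "linked adj A2 B1" "linked adj A2 B2" "linked adj A2 B3"
      "linked adj A3 B1" "linked adj A3 B2" "linked adj A3 B3"
  shows False
proof -
  have d': "A1 \<inter> (B1 \<union> B2 \<union> B3) = {}" "A2 \<inter> (B1 \<union> B2 \<union> B3) = {}" "A3 \<inter> (B1 \<union> B2 \<union> B3) = {}"
    using d(7) by blast+
  obtain c d u1 u2 u3 v1 v2 v3 w1 w2 w3 where
    g: "gpath adj (c # u1 @ w1 @ v1 @ [d])" "gpath adj (c # u2 @ w2 @ v2 @ [d])" "gpath adj (c # u3 @ w3 @ v3 @ [d])"
    and ne: "w1 \<noteq> []" "w2 \<noteq> []" "w3 \<noteq> []" and w: "set w1 \<subseteq> B1" "set w2 \<subseteq> B2" "set w3 \<subseteq> B3"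
    and u: "c \<in> A1" "set u1 \<subseteq> A1" "set u2 \<subseteq> A1" "set u3 \<subseteq> A1"
    and v: "d \<in> A2" "set v1 \<subseteq> A2" "set v2 \<subseteq> A2" "set v3 \<subseteq> A2"
    and dj: "set (u1 @ w1 @ v1) \<inter> set (u2 @ w2 @ v2) = {}" "set (u1 @ w1 @ v1) \<inter> set (u3 @ w3 @ v3) = {}"
      "set (u2 @ w2 @ v2) \<inter> set (u3 @ w3 @ v3) = {}"
    using theta_exists[OF symp_adj c(1,2,4-6) d(1) d'(1,2) d(4-6) l(1-6)] .
  define Z where "Z = insert c (insert d (set (u1 @ w1 @ v1) \<union> set (u2 @ w2 @ v2) \<union> set (u3 @ w3 @ v3)))"
  define S where "S = (A3 \<union> B1 \<union> B2 \<union> B3) - Z"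
  obtain a where a: "a \<in> A3"
    using l(7) by (auto simp: linked_def)
  define W where "W = {y \<in> S. reach adj S a y}"
  have Z: "Z \<subseteq> A1 \<union> A2 \<union> set w1 \<union> set w2 \<union> set w3"
    using u v by (auto simp: Z_def)
  have A3S: "A3 \<subseteq> S"
    using Z w d(2,3) d'(3) unfolding S_def by blast
  have BS: "B1 - set w1 \<subseteq> S" "B2 - set w2 \<subseteq> S" "B3 - set w3 \<subseteq> S"
    using Z w d(4-6) d'(1,2) unfolding S_def by blast+
  have L: "linked adj W (set w1)" "linked adj W (set w2)" "linked adj W (set w3)"
    unfolding W_def
    using grow_linked[OF symp_adj c(3) a A3S c(4) l(7) w(1) _ BS(1)]
      grow_linked[OF symp_adj c(3) a A3S c(5) l(8) w(2) _ BS(2)]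
      grow_linked[OF symp_adj c(3) a A3S c(6) l(9) w(3) _ BS(3)] ne by simp_all
  have mono: "linked adj W Q'" if "linked adj W Q" "Q \<subseteq> Q'" for Q Q'
    using that unfolding linked_def by blast
  have V: "W \<subseteq> V"
  proof -
    have "A3 \<subseteq> V" "B1 \<subseteq> V" "B2 \<subseteq> V" "B3 \<subseteq> V"
      using linked_V[OF l(7) c(3)] linked_V[OF linked_sym[OF symp_adj l(1)] c(4)]
        linked_V[OF linked_sym[OF symp_adj l(2)] c(5)] linked_V[OF linked_sym[OF symp_adj l(3)] c(6)] by auto
    then show ?thesis
      unfolding W_def S_def by blast
  qed
  show False
  proof (rule theta_no_touch[of c "u1 @ w1 @ v1" d "u2 @ w2 @ v2" "u3 @ w3 @ v3" W])
    show "conn adj W"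
      unfolding W_def by (rule conn_component[OF symp_adj])
    show "W \<inter> insert c (insert d (set (u1 @ w1 @ v1) \<union> set (u2 @ w2 @ v2) \<union> set (u3 @ w3 @ v3))) = {}"
      unfolding Z_def[symmetric] W_def S_def by blast
    show "linked adj W (set (u1 @ w1 @ v1))" "linked adj W (set (u2 @ w2 @ v2))" "linked adj W (set (u3 @ w3 @ v3))"
      by (rule mono[OF L(1)] mono[OF L(2)] mono[OF L(3)], force)+
  qed (use g ne dj V in simp_all)
qed

end

section \<open>Drawn graphs have no K5 minor\<close>

context drawing
begin

lemma connector_img:
  assumes D: "gpath adj (r # ms @ [s])" and P: "gpath adj ps" and ms: "set ms \<inter> set ps = {}" and rs: "{r, s} \<notin> edges_of ps"
  shows "img (r # ms @ [s]) \<inter> img ps \<subseteq> {p r, p s}"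
proof -
  have "edges_of (r # ms @ [s]) \<inter> edges_of ps = {}"
  proof (rule ccontr)
    assume "edges_of (r # ms @ [s]) \<inter> edges_of ps \<noteq> {}"
    then obtain e where e: "e \<in> edges_of (r # ms @ [s])" "e \<in> edges_of ps"
      by blast
    show False
      using edges_of_tips[OF e(1) edges_of_subset[OF e(2)] ms] rs e(2) by simp
  qed
  then have "img (r # ms @ [s]) \<inter> img ps \<subseteq> p ` (set (r # ms @ [s]) \<inter> set ps)"
    by (rule img_inter[OF D P])
  also have "\<dots> \<subseteq> p ` {r, s}"
    by (rule image_mono) (use ms in auto)
  finally show ?thesis
    by simp
qed

text \<open>The closed curve formed by the first two paths is cut anew at \<open>x'\<close> and
  \<open>y'\<close>, into \<open>f1\<close> through \<open>c\<close> and \<open>f2\<close> through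
  \<open>d\<close>; with the link from \<open>x'\<close> to \<open>y'\<close> this is another theta
  curve. The connector from \<open>r\<close> to \<open>s\<close> and the third path both lead from
  \<open>f1\<close> to \<open>f2\<close> and avoid the link. So both lie on the side away from the
  link, hence on the same side.\<close>

lemma crossing_paths:
  assumes g1: "gpath adj (c # q1 @ [d])" and g2: "gpath adj (c # q2 @ [d])" and g3: "gpath adj (c # q3 @ [d])"
    and q1: "q1 = a1 @ x' # b1" and q2: "q2 = a2 @ y' # b2" and ne: "q3 \<noteq> []"
    and dj: "set q1 \<inter> set q2 = {}" "set q1 \<inter> set q3 = {}" "set q2 \<inter> set q3 = {}"
    and gD: "gpath adj (r # ms @ [s])" and rs: "r \<in> insert c (set a1 \<union> set a2)" "s \<in> insert d (set b1 \<union> set b2)"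
    and ms: "set ms \<inter> insert c (insert d (set q1 \<union> set q2 \<union> set q3)) = {}"
    and rsE: "{r, s} \<notin> edges_of (c # q1 @ [d])" "{r, s} \<notin> edges_of (c # q2 @ [d])"
    and gT: "gpath adj (x' # ns @ [y'])"
    and ns: "set ns \<inter> insert c (insert d (set q1 \<union> set q2 \<union> set q3)) = {}" "set ns \<inter> set ms = {}"
    and x: "x \<in> img (r # ms @ [s]) - {p r, p s}" and y: "y \<in> img (c # q3 @ [d]) - {p c, p d}"
  shows "connected_component (- (img (c # q1 @ [d]) \<union> img (c # q2 @ [d]))) x y"
proof -
  let ?P1 = "c # q1 @ [d]" and ?P2 = "c # q2 @ [d]" and ?P3 = "c # q3 @ [d]" and ?D = "r # ms @ [s]" and ?T = "x' # ns @ [y']"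
  define f1 where "f1 = rev a1 @ c # a2"
  define f2 where "f2 = b1 @ d # rev b2"
  let ?E1 = "img (x' # f1 @ [y'])" and ?E2 = "img (x' # f2 @ [y'])"
  have dist: "distinct ?P1" "distinct ?P2" "distinct ?P3"
    using g1 g2 g3 by (simp_all add: gpath_def)
  have f1s: "set f1 = insert c (set a1 \<union> set a2)" and f2s: "set f2 = insert d (set b1 \<union> set b2)"
    by (auto simp: f1_def f2_def)
  have ge1: "gpath adj (x' # f1 @ [y'])"
  proof -
    have "gpath adj (c # a1 @ [x'])"
      using g1 gpath_prefix[of adj "c # a1 @ [x']" "b1 @ [d]"] by (simp add: q1)
    then have "gpath adj ((x' # rev a1) @ [c])"
      using gpath_rev[OF symp_adj, of "c # a1 @ [x']"] by simp
    moreover have "gpath adj (c # (a2 @ [y']))"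
      using g2 gpath_prefix[of adj "c # a2 @ [y']" "b2 @ [d]"] by (simp add: q2)
    moreover have "set (x' # rev a1) \<inter> set (a2 @ [y']) = {}"
      using dj(1) by (auto simp: q1 q2)
    ultimately have "gpath adj ((x' # rev a1) @ c # (a2 @ [y']))"
      by (rule gpath_glue)
    then show ?thesis
      by (simp add: f1_def)
  qed
  have ge2: "gpath adj (x' # f2 @ [y'])"
  proof -
    have "gpath adj ((x' # b1) @ [d])"
      using g1 gpath_suffix[of adj "c # a1" "x' # b1 @ [d]"] by (simp add: q1)
    moreover have "gpath adj (d # (rev b2 @ [y']))"
      using g2 gpath_suffix[of adj "c # a2" "y' # b2 @ [d]"] gpath_rev[OF symp_adj, of "y' # b2 @ [d]"] by (simp add: q2)
    moreover have "set (x' # b1) \<inter> set (rev b2 @ [y']) = {}"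
      using dj(1) by (auto simp: q1 q2)
    ultimately have "gpath adj ((x' # b1) @ d # (rev b2 @ [y']))"
      by (rule gpath_glue)
    then show ?thesis
      by (simp add: f2_def)
  qed
  have e1: "edges_of (x' # f1 @ [y']) = edges_of (c # a1 @ [x']) \<union> edges_of (c # a2 @ [y'])"
    using edges_of_append[of "x' # rev a1" c "a2 @ [y']"] edges_of_rev[of "c # a1 @ [x']"] by (simp add: f1_def)
  have e2: "edges_of (x' # f2 @ [y']) = edges_of (x' # b1 @ [d]) \<union> edges_of (y' # b2 @ [d])"
    using edges_of_append[of "x' # b1" d "rev b2 @ [y']"] edges_of_rev[of "y' # b2 @ [d]"] by (simp add: f2_def)
  have "edges_of ?P1 = edges_of (c # a1 @ [x']) \<union> edges_of (x' # b1 @ [d])"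
    "edges_of ?P2 = edges_of (c # a2 @ [y']) \<union> edges_of (y' # b2 @ [d])"
    using edges_of_append[of "c # a1" x' "b1 @ [d]"] edges_of_append[of "c # a2" y' "b2 @ [d]"] by (simp_all add: q1 q2)
  then have "edges_of (x' # f1 @ [y']) \<union> edges_of (x' # f2 @ [y']) = edges_of ?P1 \<union> edges_of ?P2"
    using e1 e2 by blast
  then have J: "?E1 \<union> ?E2 = img ?P1 \<union> img ?P2"
    unfolding img_def by blast
  have fq: "set f1 \<union> set f2 \<union> {x', y'} = insert c (insert d (set q1 \<union> set q2))"
    by (auto simp: f1s f2s q1 q2)
  have "set f1 \<inter> set f2 = {}"
    using dist(1,2) dj(1) by (auto simp: f1s f2s q1 q2)
  then have i12: "?E1 \<inter> ?E2 = {p x', p y'}"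
    by (intro theta_img[OF ge1 ge2]) (simp_all add: f1_def)
  have i13: "?E1 \<inter> img ?T = {p x', p y'}"
    by (rule theta_img[OF ge1 gT]) (use ns(1) fq in \<open>auto simp: f1_def\<close>)
  have i23: "?E2 \<inter> img ?T = {p x', p y'}"
    by (rule theta_img[OF ge2 gT]) (use ns(1) fq in \<open>auto simp: f2_def\<close>)
  note ar = theta_arc[OF ge1] theta_arc[OF ge2] theta_arc[OF gT]
  obtain t where t: "t \<in> img ?T - {p x', p y'}"
    using arc_between_props(5)[OF ar(3)] by blast
  have no_common: "img xs \<inter> img ys = {}" if "gpath adj xs" "gpath adj ys" "set xs \<inter> set ys = {}" for xs ys
  proof -
    have "edges_of xs \<inter> edges_of ys = {}"
    proof (rule ccontr)
      assume "edges_of xs \<inter> edges_of ys \<noteq> {}"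
      then obtain e where e: "e \<in> edges_of xs" "e \<in> edges_of ys"
        by blast
      then have "e = {}"
        using edges_of_subset[OF e(1)] edges_of_subset[OF e(2)] that(3) by blast
      moreover have "card e = 2"
        using edges_of_E[OF that(1)] e(1) simple by (auto simp: simple_graph_def)
      ultimately show False
        by simp
    qed
    from img_inter[OF that(1,2) this] show ?thesis
      using that(3) by simp
  qed
  have rsZ: "r \<in> set f1" "s \<in> set f2"
    using rs f1s f2s by auto
  have "set ?D \<inter> set ?T = {}"
  proof -
    have "r \<notin> set ?T" "s \<notin> set ?T"
      using rsZ ns(1) fq ge1 ge2 by (auto simp: gpath_def)
    moreover have "set ms \<inter> set ?T = {}"
      using ms ns(2) by (auto simp: q1 q2)
    ultimately show ?thesis
      by auto
  qed
  then have DT: "img ?D \<inter> img ?T = {}"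
    by (rule no_common[OF gD gT])
  have "set ?P3 \<inter> set ?T = {}"
    using ns(1) dj(2,3) dist(1,2) by (auto simp: q1 q2)
  then have P3T: "img ?P3 \<inter> img ?T = {}"
    by (rule no_common[OF g3 gT])
  have q1ne: "q1 \<noteq> []" and q2ne: "q2 \<noteq> []"
    by (simp_all add: q1 q2)
  have D1: "img ?D \<inter> img ?P1 \<subseteq> {p r, p s}"
    by (rule connector_img[OF gD g1 _ rsE(1)]) (use ms in auto)
  have D2: "img ?D \<inter> img ?P2 \<subseteq> {p r, p s}"
    by (rule connector_img[OF gD g2 _ rsE(2)]) (use ms in auto)
  have P31: "img ?P1 \<inter> img ?P3 = {p c, p d}" and P32: "img ?P2 \<inter> img ?P3 = {p c, p d}"
    using theta_img[OF g1 g3 q1ne dj(2)] theta_img[OF g2 g3 q2ne dj(3)] by auto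
  have in_f1: "p v \<in> ?E1 - {p x', p y'}" if "v \<in> set f1" for v
    by (rule theta_inner[OF ge1 that])
  have in_f2: "p v \<in> ?E2 - {p x', p y'}" if "v \<in> set f2" for v
    by (rule theta_inner[OF ge2 that])
  note arD = img_arc[OF gD, simplified] and ar3 = theta_arc[OF g3]
  have disjD: "(img ?D - {p r, p s}) \<inter> (?E1 \<union> ?E2 \<union> img ?T) = {}"
    unfolding J using D1 D2 DT by blast
  have disj3: "(img ?P3 - {p c, p d}) \<inter> (?E1 \<union> ?E2 \<union> img ?T) = {}"
    unfolding J using P31 P32 P3T by blast
  have clD: "p r \<in> closure (img ?D - {p r, p s})" "p s \<in> closure (img ?D - {p r, p s})"
    using arc_between_closure[OF arD] arc_between_props(6,7)[OF arD] by auto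
  have cl3: "p c \<in> closure (img ?P3 - {p c, p d})" "p d \<in> closure (img ?P3 - {p c, p d})"
    using arc_between_closure[OF ar3] arc_between_props(6,7)[OF ar3] by auto
  have "\<not> connected_component (- (?E1 \<union> ?E2)) x t"
    by (rule crossing_sides[OF ar i12 i13 i23 arc_between_props(4)[OF arD] disjD x _ _ t])
      (use clD in_f1[OF rsZ(1)] in_f2[OF rsZ(2)] in blast)+
  moreover have "\<not> connected_component (- (?E1 \<union> ?E2)) y t"
  proof (rule crossing_sides[OF ar i12 i13 i23 arc_between_props(4)[OF ar3] disj3 y _ _ t])
    have "c \<in> set f1" "d \<in> set f2"
      by (simp_all add: f1s f2s)
    then show "closure (img ?P3 - {p c, p d}) \<inter> (?E1 - {p x', p y'}) \<noteq> {}"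
      "closure (img ?P3 - {p c, p d}) \<inter> (?E2 - {p x', p y'}) \<noteq> {}"
      using cl3 in_f1[of c] in_f2[of d] by blast+
  qed
  moreover have "t \<notin> ?E1 \<union> ?E2"
    using t i13 i23 by blast
  ultimately show ?thesis
    unfolding J[symmetric]
    by (intro two_sides_only[OF ar(1,2) i12, of x y t]) (use x y disjD disj3 in blast)+
qed

text \<open>A connector that ends on the third path touches it directly, off the other two.
  Otherwise its ends lie on the first two paths, on different sides of the cuts at \<open>x'\<close>
  and \<open>y'\<close>, since the \<open>w\<close> blocks lie between the \<open>u\<close> and the
  \<open>v\<close> blocks.\<close>

lemma crossing_or_touch:
  assumes g1: "gpath adj (c # q1 @ [d])" and g2: "gpath adj (c # q2 @ [d])" and g3: "gpath adj (c # q3 @ [d])"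
    and q1: "q1 = u1 @ w1 @ v1" and q2: "q2 = u2 @ w2 @ v2" and q3: "q3 = u3 @ w3 @ v3" and ne: "w3 \<noteq> []"
    and dj: "set q1 \<inter> set q2 = {}" "set q1 \<inter> set q3 = {}" "set q2 \<inter> set q3 = {}"
    and gD: "gpath adj (r # ms @ [s])" and rs: "r \<in> insert c (set u1 \<union> set u2 \<union> set u3)" "s \<in> insert d (set v1 \<union> set v2 \<union> set v3)"
    and ms: "set ms \<inter> insert c (insert d (set q1 \<union> set q2 \<union> set q3)) = {}"
    and rsE: "{r, s} \<notin> edges_of (c # q1 @ [d])" "{r, s} \<notin> edges_of (c # q2 @ [d])"
    and gT: "gpath adj (x' # ns @ [y'])" "x' \<in> set w1" "y' \<in> set w2"
    and ns: "set ns \<inter> insert c (insert d (set q1 \<union> set q2 \<union> set q3)) = {}" "set ns \<inter> set ms = {}"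
    and x: "x \<in> img (r # ms @ [s]) - {p r, p s}" and y: "y \<in> img (c # q3 @ [d]) - {p c, p d}"
    and xP: "(img (r # ms @ [s]) - {p r, p s}) \<inter> (img (c # q1 @ [d]) \<union> img (c # q2 @ [d])) = {}"
  shows "connected_component (- (img (c # q1 @ [d]) \<union> img (c # q2 @ [d]))) x y"
proof (cases "r \<in> set q3 \<or> s \<in> set q3")
  case True
  note arD = img_arc[OF gD, simplified]
  have q1ne: "q1 \<noteq> []" and q2ne: "q2 \<noteq> []"
    using gT(2,3) by (auto simp: q1 q2)
  have "\<exists>v\<in>set q3. p v \<in> closure (img (r # ms @ [s]) - {p r, p s})"
    using True arc_between_closure[OF arD] arc_between_props(6,7)[OF arD] by auto
  then have cl: "closure (img (r # ms @ [s]) - {p r, p s}) \<inter> (img (c # q3 @ [d]) - {p c, p d}) \<noteq> {}"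
    using theta_inner[OF g3] by blast
  show ?thesis
    by (rule touch_component[OF arc_between_props(4)[OF arD] x xP arc_between_props(2)[OF theta_arc[OF g1]]
          arc_between_props(2)[OF theta_arc[OF g2]] theta_arc[OF g3] theta_img[OF g1 g3 q1ne dj(2)]
          theta_img[OF g2 g3 q2ne dj(3)] cl y])
next
  case False
  obtain a1 b1 where 1: "w1 = a1 @ x' # b1"
    using gT(2) by (meson split_list)
  obtain a2 b2 where 2: "w2 = a2 @ y' # b2"
    using gT(3) by (meson split_list)
  have r': "r \<in> insert c (set (u1 @ a1) \<union> set (u2 @ a2))" and s': "s \<in> insert d (set (b1 @ v1) \<union> set (b2 @ v2))"
    using rs False by (auto simp: q3)
  show ?thesis
    by (rule crossing_paths[OF g1 g2 g3 _ _ _ dj gD r' s' ms rsE gT(1) ns x y]) (simp_all add: q1 q2 q3 1 2 ne)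
qed

text \<open>For any two arcs of the theta curve, the link between their middle blocks forces the
  connector of the two hubs onto the side of the third arc. Having this for all three choices
  contradicts \<open>theta_point\<close>.\<close>

lemma no_K5:
  assumes c: "conn adj A1" "conn adj A2" "conn adj B1" "conn adj B2" "conn adj B3"
    and d: "A1 \<inter> A2 = {}" "B1 \<inter> B2 = {}" "B1 \<inter> B3 = {}" "B2 \<inter> B3 = {}" "(A1 \<union> A2) \<inter> (B1 \<union> B2 \<union> B3) = {}"
    and l: "linked adj A1 B1" "linked adj A1 B2" "linked adj A1 B3" "linked adj A2 B1" "linked adj A2 B2" "linked adj A2 B3"
    and l': "linked adj A1 A2" "linked adj B1 B2" "linked adj B1 B3" "linked adj B2 B3"
  shows False
proof -
  have d': "A1 \<inter> (B1 \<union> B2 \<union> B3) = {}" "A2 \<inter> (B1 \<union> B2 \<union> B3) = {}"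
    using d(5) by blast+
  obtain c d u1 u2 u3 v1 v2 v3 w1 w2 w3 where
    g: "gpath adj (c # u1 @ w1 @ v1 @ [d])" "gpath adj (c # u2 @ w2 @ v2 @ [d])" "gpath adj (c # u3 @ w3 @ v3 @ [d])"
    and ne: "w1 \<noteq> []" "w2 \<noteq> []" "w3 \<noteq> []" and w: "set w1 \<subseteq> B1" "set w2 \<subseteq> B2" "set w3 \<subseteq> B3"
    and u: "c \<in> A1" "set u1 \<subseteq> A1" "set u2 \<subseteq> A1" "set u3 \<subseteq> A1"
    and v: "d \<in> A2" "set v1 \<subseteq> A2" "set v2 \<subseteq> A2" "set v3 \<subseteq> A2"
    and dj: "set (u1 @ w1 @ v1) \<inter> set (u2 @ w2 @ v2) = {}" "set (u1 @ w1 @ v1) \<inter> set (u3 @ w3 @ v3) = {}"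
      "set (u2 @ w2 @ v2) \<inter> set (u3 @ w3 @ v3) = {}"
    using theta_exists[OF symp_adj c d(1) d' d(2-4) l] .
  define q1 q2 q3 where q: "q1 = u1 @ w1 @ v1" "q2 = u2 @ w2 @ v2" "q3 = u3 @ w3 @ v3"
  have gq: "gpath adj (c # q1 @ [d])" "gpath adj (c # q2 @ [d])" "gpath adj (c # q3 @ [d])"
    using g by (simp_all add: q)
  have q12: "set q1 \<inter> set q2 = {}" and q13: "set q1 \<inter> set q3 = {}" and q23: "set q2 \<inter> set q3 = {}"
    using dj by (simp_all only: q)
  define Z where "Z = insert c (insert d (set q1 \<union> set q2 \<union> set q3))"
  define Q where "Q = insert c (set u1 \<union> set u2 \<union> set u3)"
  define Q' where "Q' = insert d (set v1 \<union> set v2 \<union> set v3)"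
  have QA: "Q \<subseteq> A1" "Q \<noteq> {}" "Q' \<subseteq> A2" "Q' \<noteq> {}"
    using u v by (auto simp: Q_def Q'_def)
  have Z: "Z = Q \<union> Q' \<union> set w1 \<union> set w2 \<union> set w3"
    by (auto simp: Z_def Q_def Q'_def q)
  obtain r ms s where D: "gpath adj (r # ms @ [s])" "r \<in> Q" "s \<in> Q'" "set ms \<subseteq> (A1 - Q) \<union> (A2 - Q')"
    using join_path[OF symp_adj c(1,2) d(1) l'(1) QA] .
  have msZ: "set ms \<inter> Z = {}"
    using D(4) QA(1,3) w d(1) d' unfolding Z by blast
  \<comment> \<open>The connector may be a single edge. It is no edge of the theta curve, because on
    each leg the nonempty block \<open>ww\<close> lies between the two hubs.\<close>
  have rsE: "{r, s} \<notin> edges_of (c # u @ ww @ vv @ [d])"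
    if G: "gpath adj (c # u @ ww @ vv @ [d])" "ww \<noteq> []" "set ww \<subseteq> B1 \<union> B2 \<union> B3" "set u \<subseteq> A1" "set vv \<subseteq> A2" for u ww vv
  proof
    assume e: "{r, s} \<in> edges_of (c # u @ ww @ vv @ [d])"
    have rsA: "r \<in> A1" "s \<in> A2"
      using D(2,3) QA by auto
    have "r \<in> set (c # u @ ww @ vv @ [d])" "s \<in> set (c # u @ ww @ vv @ [d])"
      using edges_of_subset[OF e] by simp_all
    then have "r \<in> set (c # u)" "s \<in> set (vv @ [d])"
      using G(3-5) rsA u(1) v(1) d(1) d' by auto
    then show False
      using edges_of_far[of "c # u" ww "vv @ [d]" r s] G(1,2) e by (simp add: gpath_def)
  qed
  have E: "{r, s} \<notin> edges_of (c # q1 @ [d])" "{r, s} \<notin> edges_of (c # q2 @ [d])" "{r, s} \<notin> edges_of (c # q3 @ [d])"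
    using rsE[OF g(1) ne(1) _ u(2) v(2)] rsE[OF g(2) ne(2) _ u(3) v(3)] rsE[OF g(3) ne(3) _ u(4) v(4)] w
    by (auto simp: q)
  have DP: "(img (r # ms @ [s]) - {p r, p s}) \<inter> img (c # q @ [d]) = {}"
    if G: "gpath adj (c # q @ [d])" "set q \<subseteq> Z" "{r, s} \<notin> edges_of (c # q @ [d])" for q
  proof -
    have sZ: "set ms \<inter> set (c # q @ [d]) = {}"
      using msZ G(2) by (auto simp: Z_def)
    show ?thesis
      using connector_img[OF D(1) G(1) sZ G(3)] by blast
  qed
  have qZ: "set q1 \<subseteq> Z" "set q2 \<subseteq> Z" "set q3 \<subseteq> Z"
    by (auto simp: Z_def)
  note P = DP[OF gq(1) qZ(1) E(1)] DP[OF gq(2) qZ(2) E(2)] DP[OF gq(3) qZ(3) E(3)]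
  have wne: "set w1 \<noteq> {}" "set w2 \<noteq> {}" "set w3 \<noteq> {}"
    using ne by simp_all
  obtain x12 n12 y12 where T12: "gpath adj (x12 # n12 @ [y12])" "x12 \<in> set w1" "y12 \<in> set w2" "set n12 \<subseteq> (B1 - set w1) \<union> (B2 - set w2)"
    using join_path[OF symp_adj c(3,4) d(2) l'(2) w(1) wne(1) w(2) wne(2)] .
  obtain x13 n13 y13 where T13: "gpath adj (x13 # n13 @ [y13])" "x13 \<in> set w1" "y13 \<in> set w3" "set n13 \<subseteq> (B1 - set w1) \<union> (B3 - set w3)"
    using join_path[OF symp_adj c(3,5) d(3) l'(3) w(1) wne(1) w(3) wne(3)] .
  obtain x23 n23 y23 where T23: "gpath adj (x23 # n23 @ [y23])" "x23 \<in> set w2" "y23 \<in> set w3" "set n23 \<subseteq> (B2 - set w2) \<union> (B3 - set w3)"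
    using join_path[OF symp_adj c(4,5) d(4) l'(4) w(2) wne(2) w(3) wne(3)] .
  have nZ: "set n12 \<inter> Z = {}" "set n13 \<inter> Z = {}" "set n23 \<inter> Z = {}"
    using T12(4) T13(4) T23(4) QA(1,3) w d(2-4) d' unfolding Z by blast+
  have nms: "set n12 \<inter> set ms = {}" "set n13 \<inter> set ms = {}" "set n23 \<inter> set ms = {}"
    using T12(4) T13(4) T23(4) D(4) d' by blast+
  obtain x where x: "x \<in> img (r # ms @ [s]) - {p r, p s}"
    using arc_between_props(5)[OF img_arc[OF D(1), simplified]] by blast
  note ar = theta_arc[OF gq(1)] theta_arc[OF gq(2)] theta_arc[OF gq(3)]
  obtain y1 y2 y3 where y: "y1 \<in> img (c # q1 @ [d]) - {p c, p d}" "y2 \<in> img (c # q2 @ [d]) - {p c, p d}" "y3 \<in> img (c # q3 @ [d]) - {p c, p d}"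
    using arc_between_props(5)[OF ar(1)] arc_between_props(5)[OF ar(2)] arc_between_props(5)[OF ar(3)] by blast
  have qne: "q1 \<noteq> []" "q2 \<noteq> []" "q3 \<noteq> []"
    using ne by (simp_all add: q)
  have Z': "Z = insert c (insert d (set q1 \<union> set q3 \<union> set q2))" "Z = insert c (insert d (set q2 \<union> set q3 \<union> set q1))"
    by (auto simp: Z_def)
  have q32: "set q3 \<inter> set q2 = {}" and q21: "set q2 \<inter> set q1 = {}" and q31: "set q3 \<inter> set q1 = {}"
    using q12 q13 q23 by blast+
  have rQ: "r \<in> insert c (set u1 \<union> set u2 \<union> set u3)" "r \<in> insert c (set u1 \<union> set u3 \<union> set u2)" "r \<in> insert c (set u2 \<union> set u3 \<union> set u1)"
    and sQ: "s \<in> insert d (set v1 \<union> set v2 \<union> set v3)" "s \<in> insert d (set v1 \<union> set v3 \<union> set v2)" "s \<in> insert d (set v2 \<union> set v3 \<union> set v1)"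
    using D(2,3) by (auto simp: Q_def Q'_def)
  show False
  proof (rule theta_point[OF ar theta_img[OF gq(1,2) qne(1) q12] theta_img[OF gq(1,3) qne(1) q13] theta_img[OF gq(2,3) qne(2) q23] y, of x])
    show "connected_component (- (img (c # q1 @ [d]) \<union> img (c # q2 @ [d]))) x y3"
      by (rule crossing_or_touch[OF gq(1,2,3) q ne(3) q12 q13 q23 D(1) rQ(1) sQ(1) msZ[unfolded Z_def] E(1,2) T12(1-3)
            nZ(1)[unfolded Z_def] nms(1) x y(3)]) (use P in blast)
    show "connected_component (- (img (c # q1 @ [d]) \<union> img (c # q3 @ [d]))) x y2"
      by (rule crossing_or_touch[OF gq(1,3,2) q(1,3,2) ne(2) q13 q12 q32 D(1) rQ(2) sQ(2) msZ[unfolded Z'(1)] E(1,3) T13(1-3)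
            nZ(2)[unfolded Z'(1)] nms(2) x y(2)]) (use P in blast)
    show "connected_component (- (img (c # q2 @ [d]) \<union> img (c # q3 @ [d]))) x y1"
      by (rule crossing_or_touch[OF gq(2,3,1) q(2,3,1) ne(1) q23 q21 q31 D(1) rQ(3) sQ(3) msZ[unfolded Z'(2)] E(2,3) T23(1-3)
            nZ(3)[unfolded Z'(2)] nms(3) x y(1)]) (use P in blast)
  qed
qed

end

section \<open>The inductive statement\<close>

lemma reach_exit:
  assumes "reach adj W x y" "x \<in> A" "y \<notin> A"
  obtains a b where "a \<in> A" "b \<in> W" "b \<notin> A" "adj a b" "a \<in> W"
proof -
  have "y \<in> A \<or> (\<exists>a\<in>A. \<exists>b\<in>W - A. adj a b \<and> a \<in> W)"
    using assms(1) unfolding reach_def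
    by (induction rule: rtranclp_induct) (use assms(2) in auto)
  then show ?thesis
    using assms(3) that by blast
qed

lemma conn_segment:
  assumes "symp adj" "\<And>i. a \<le> i \<Longrightarrow> i < b \<Longrightarrow> adj (w i) (w (Suc i))"
  shows "conn adj (w ` {a..b::nat})"
proof (rule conn_hub[OF assms(1), of _ "w a"])
  have *: "a \<le> i \<Longrightarrow> i \<le> b \<Longrightarrow> reach adj (w ` {a..b}) (w a) (w i)" for i
  proof (induction i rule: dec_induct)
    case (step n)
    have "reach adj (w ` {a..b}) (w n) (w (Suc n))"
      by (rule reach_step) (use step assms(2)[of n] in auto)
    then show ?case
      using step reach_trans[of adj "w ` {a..b}" "w a" "w n" "w (Suc n)"] by simp
  qed simp
  show "\<And>x. x \<in> w ` {a..b} \<Longrightarrow> reach adj (w ` {a..b}) (w a) x"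
    using * by auto
qed

text \<open>The case \<open>x = y = z\<close> of \<open>tri\<close> excludes loops. In
  \<open>K5\<close> the sets \<open>A1\<close>, \<open>A2\<close> are the hubs of a theta curve and
  the \<open>B\<close> sets its legs, as in \<open>no_K5\<close>.\<close>

locale planar_like =
  fixes adj :: "'a \<Rightarrow> 'a \<Rightarrow> bool" and X :: "'a set"
  assumes sym: "symp adj"
    and tri: "\<not> (adj x y \<and> adj y z \<and> adj x z)"
    and indep: "x \<in> X \<Longrightarrow> y \<in> X \<Longrightarrow> \<not> adj x y"
    and K33: "\<lbrakk>conn adj A1; conn adj A2; conn adj A3; conn adj B1; conn adj B2; conn adj B3;
      A1 \<inter> A2 = {}; A1 \<inter> A3 = {}; A2 \<inter> A3 = {}; B1 \<inter> B2 = {}; B1 \<inter> B3 = {}; B2 \<inter> B3 = {};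
      (A1 \<union> A2 \<union> A3) \<inter> (B1 \<union> B2 \<union> B3) = {};
      linked adj A1 B1; linked adj A1 B2; linked adj A1 B3; linked adj A2 B1; linked adj A2 B2; linked adj A2 B3;
      linked adj A3 B1; linked adj A3 B2; linked adj A3 B3\<rbrakk> \<Longrightarrow> False"
    and K5: "\<lbrakk>conn adj A1; conn adj A2; conn adj B1; conn adj B2; conn adj B3;
      A1 \<inter> A2 = {}; B1 \<inter> B2 = {}; B1 \<inter> B3 = {}; B2 \<inter> B3 = {}; (A1 \<union> A2) \<inter> (B1 \<union> B2 \<union> B3) = {};
      linked adj A1 B1; linked adj A1 B2; linked adj A1 B3; linked adj A2 B1; linked adj A2 B2; linked adj A2 B3;
      linked adj A1 A2; linked adj B1 B2; linked adj B1 B3; linked adj B2 B3\<rbrakk> \<Longrightarrow> False"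
begin

lemma adj_sym: "adj x y \<Longrightarrow> adj y x"
  using sym by (rule sympD)

lemma adj_irrefl: "\<not> adj x x"
  using tri[of x x x] by blast

definition nb :: "'a set \<Rightarrow> 'a set \<Rightarrow> 'a set" where
  "nb R U = {v \<in> U. \<exists>r\<in>R. adj v r}"

text \<open>The values are 4 and 3 in the interior, 3 and 2 on the boundary, so the subtraction
  never truncates.\<close>

definition need :: "'a set \<Rightarrow> 'a \<Rightarrow> nat" where
  "need B v = 4 - (if v \<in> X then 1 else 0) - (if v \<in> B then 1 else 0)"

definition col :: "'a set \<Rightarrow> ('a \<Rightarrow> int set) \<Rightarrow> ('a \<Rightarrow> int) \<Rightarrow> bool" where
  "col U L \<phi> \<longleftrightarrow> (\<forall>v\<in>U. \<phi> v \<in> L v) \<and> (\<forall>x\<in>U. \<forall>y\<in>U. adj x y \<longrightarrow> \<phi> x \<noteq> \<phi> y)"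

text \<open>Precolouring is encoded by one-element lists: shrinking a list precolours a vertex, and
  a colouring needs no separate extension condition.\<close>

definition precol :: "('a \<Rightarrow> int set) \<Rightarrow> 'a set \<Rightarrow> bool" where
  "precol L P \<longleftrightarrow> card P \<le> 2 \<and> (\<forall>p\<in>P. \<exists>c. L p = {c}) \<and> (\<forall>p\<in>P. \<forall>q\<in>P. p \<noteq> q \<longrightarrow> adj p q \<and> L p \<noteq> L q)"

text \<open>\<open>R\<close> plays the role of the outer face: it is a connected piece of the graph that has already
  been coloured and removed, and \<open>nb R U\<close> are the vertices on the boundary, which may have lost one colour.\<close>

definition inst :: "'a set \<Rightarrow> 'a set \<Rightarrow> ('a \<Rightarrow> int set) \<Rightarrow> 'a set \<Rightarrow> bool" where
  "inst R U L P \<longleftrightarrow> finite U \<and> R \<inter> U = {} \<and> conn adj R \<and> P \<subseteq> nb R U \<and> precol L P \<and>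
     (\<forall>v\<in>U - P. need (nb R U) v \<le> card (L v))"

definition solvable_below :: "nat \<Rightarrow> bool" where
  "solvable_below N \<longleftrightarrow> (\<forall>R U L P. card U < N \<longrightarrow> inst R U L P \<longrightarrow> (\<exists>\<phi>. col U L \<phi>))"

lemma need_cong: "(v \<in> B \<longleftrightarrow> v \<in> B') \<Longrightarrow> need B v = need B' v"
  by (simp add: need_def)

lemma precol_empty [simp]: "precol L {}"
  by (simp add: precol_def)

lemma precol_pair: "L p = {c} \<Longrightarrow> L q = {d} \<Longrightarrow> c \<noteq> d \<Longrightarrow> adj p q \<Longrightarrow> precol L {p, q}"
  using card_insert_le_m1[of 2 "{q}" p] by (auto simp: precol_def adj_sym)

lemma precol_single: "L p = {c} \<Longrightarrow> precol L {p}"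
  by (simp add: precol_def)

lemma col_glue:
  assumes "col A L \<phi>" "col B L \<psi>" "A \<inter> B = {}" "\<And>x y. x \<in> A \<Longrightarrow> y \<in> B \<Longrightarrow> adj x y \<Longrightarrow> \<phi> x \<noteq> \<psi> y"
  shows "col (A \<union> B) L (\<lambda>x. if x \<in> A then \<phi> x else \<psi> x)"
  unfolding col_def
proof (intro conjI ballI impI)
  fix x y
  assume xy: "x \<in> A \<union> B" "y \<in> A \<union> B" "adj x y"
  then consider "x \<in> A" "y \<in> A" | "x \<in> A" "y \<in> B" "y \<notin> A" | "x \<in> B" "x \<notin> A" "y \<in> A" | "x \<in> B" "x \<notin> A" "y \<in> B" "y \<notin> A"
    using assms(3) by blast
  then show "(if x \<in> A then \<phi> x else \<psi> x) \<noteq> (if y \<in> A then \<phi> y else \<psi> y)"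
    by cases (use assms(1,2) assms(4)[of x y] assms(4)[of y x] xy(3) adj_sym[OF xy(3)] in \<open>auto simp: col_def\<close>)
qed (use assms(1,2) in \<open>auto simp: col_def\<close>)

text \<open>\<open>S\<close> moves from \<open>U\<close> to \<open>R\<close>. An interior neighbour
  of \<open>S\<close> loses one colour but becomes a boundary vertex, which lowers its
  \<open>need\<close> by one as well; an old boundary vertex has no such credit and must lose
  nothing. A vertex of \<open>P\<close> may start in the interior if a neighbour in \<open>S\<close>
  brings it to the boundary.\<close>

lemma delete:
  assumes IH: "solvable_below N" and N: "card U \<le> N"
    and U: "finite U" "R \<inter> U = {}" "conn adj R"
    and S: "S \<subseteq> nb R U" "S \<noteq> {}" and \<phi>: "\<And>s. s \<in> S \<Longrightarrow> \<phi> s \<in> L s" "\<And>s t. s \<in> S \<Longrightarrow> t \<in> S \<Longrightarrow> adj s t \<Longrightarrow> \<phi> s \<noteq> \<phi> t"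
    and P: "P \<subseteq> U - S" "\<And>q. q \<in> P \<Longrightarrow> q \<in> nb R U \<or> (\<exists>s\<in>S. adj q s)" "precol L P"
      "\<And>q s. q \<in> P \<Longrightarrow> s \<in> S \<Longrightarrow> adj q s \<Longrightarrow> \<phi> s \<notin> L q"
    and L: "\<And>w. w \<in> U - S - P \<Longrightarrow> need (nb R U) w \<le> card (L w)"
    and outer: "\<And>w s. w \<in> U - S - P \<Longrightarrow> w \<in> nb R U \<Longrightarrow> s \<in> S \<Longrightarrow> adj w s \<Longrightarrow> \<phi> s \<notin> L w"
    and inner: "\<And>w s t. w \<in> U - S - P \<Longrightarrow> w \<notin> nb R U \<Longrightarrow> s \<in> S \<Longrightarrow> t \<in> S \<Longrightarrow> adj w s \<Longrightarrow> adj w t \<Longrightarrow> \<phi> s = \<phi> t"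
  shows "\<exists>\<psi>. col U L \<psi> \<and> (\<forall>s\<in>S. \<psi> s = \<phi> s)"
proof -
  define L' where "L' = (\<lambda>w. L w - \<phi> ` {s \<in> S. adj w s})"
  have L'P: "L' q = L q" if "q \<in> P" for q
    using P(4)[OF that] by (auto simp: L'_def)
  have SU: "S \<subseteq> U"
    using S by (auto simp: nb_def)
  have nb': "nb (R \<union> S) (U - S) = {w \<in> U - S. w \<in> nb R U \<or> (\<exists>s\<in>S. adj w s)}"
    by (auto simp: nb_def)
  have cR: "conn adj (R \<union> S)"
  proof -
    obtain s0 where "s0 \<in> S"
      using S by blast
    then obtain r0 where r0: "r0 \<in> R"
      using S by (auto simp: nb_def)
    have R: "reach adj (R \<union> S) r0 x" if "x \<in> R" for x
      using U(3) r0 that reach_mono[of adj R r0 x "R \<union> S"] by (simp add: conn_def)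
    show ?thesis
    proof (rule conn_hub[OF sym, of _ r0])
      fix x
      assume x: "x \<in> R \<union> S"
      show "reach adj (R \<union> S) r0 x"
      proof (cases "x \<in> R")
        case False
        then have xS: "x \<in> S"
          using x by blast
        then obtain r where r: "r \<in> R" "adj x r"
          using S by (auto simp: nb_def)
        have "reach adj (R \<union> S) r x"
          by (rule reach_step) (use r xS adj_sym in auto)
        with R[OF r(1)] show ?thesis
          by (rule reach_trans)
      qed (rule R)
    qed
  qed
  have need': "need (nb (R \<union> S) (U - S)) w \<le> card (L' w)" if w: "w \<in> U - S - P" for w
  proof (cases "w \<in> nb R U")
    case True
    then have "L' w = L w"
      using outer[OF w True] by (auto simp: L'_def)
    moreover have "need (nb (R \<union> S) (U - S)) w = need (nb R U) w"
      by (rule need_cong) (use True w nb' in auto)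
    ultimately show ?thesis
      using L[OF w] by simp
  next
    case False
    show ?thesis
    proof (cases "\<exists>s\<in>S. adj w s")
      case True
      then obtain s where s: "s \<in> S" "adj w s"
        by blast
      have "\<phi> ` {s \<in> S. adj w s} = {\<phi> s}"
      proof (intro subset_antisym subsetI)
        fix y
        assume "y \<in> \<phi> ` {s \<in> S. adj w s}"
        then obtain t where "t \<in> S" "adj w t" "y = \<phi> t"
          by blast
        then show "y \<in> {\<phi> s}"
          using inner[OF w False, of t s] s by simp
      qed (use s in simp)
      then have "L' w = L w - {\<phi> s}"
        by (simp add: L'_def)
      then have "card (L w) - 1 \<le> card (L' w)"
        by (simp add: card_Diff_singleton_if)
      moreover have "need (nb (R \<union> S) (U - S)) w = need (nb R U) w - 1"
        using False w s nb' by (auto simp: need_def)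
      ultimately show ?thesis
        using L[OF w] by linarith
    next
      case no: False
      then have "L' w = L w"
        by (auto simp: L'_def)
      moreover have "need (nb (R \<union> S) (U - S)) w = need (nb R U) w"
        by (rule need_cong) (use False no w nb' in auto)
      ultimately show ?thesis
        using L[OF w] by simp
    qed
  qed
  have "inst (R \<union> S) (U - S) L' P"
    unfolding inst_def
  proof (intro conjI ballI)
    show "P \<subseteq> nb (R \<union> S) (U - S)"
      using P(1,2) nb' by auto
    show "precol L' P"
      using P(3) L'P by (simp add: precol_def)
  qed (use U cR need' in auto)
  moreover have "card (U - S) < card U"
    by (rule psubset_card_mono[OF U(1)]) (use SU S(2) in auto)
  then have "card (U - S) < N"
    using N by simp
  ultimately obtain \<psi> where \<psi>: "col (U - S) L' \<psi>"
    using IH unfolding solvable_below_def by blast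
  have "col S L \<phi>"
    using \<phi> by (simp add: col_def)
  moreover have "col (U - S) L \<psi>"
    using \<psi> by (auto simp: col_def L'_def)
  moreover have "\<phi> s \<noteq> \<psi> w" if "s \<in> S" "w \<in> U - S" "adj s w" for s w
  proof -
    have "\<psi> w \<in> L' w"
      using \<psi> that by (simp add: col_def)
    moreover have "\<phi> s \<in> \<phi> ` {s \<in> S. adj w s}"
      using that(1) adj_sym[OF that(3)] by blast
    ultimately show ?thesis
      by (auto simp: L'_def)
  qed
  ultimately have "col (S \<union> (U - S)) L (\<lambda>w. if w \<in> S then \<phi> w else \<psi> w)"
    by (intro col_glue) auto
  moreover have "S \<union> (U - S) = U"
    using SU by blast
  ultimately show ?thesis
    by (intro exI[of _ "\<lambda>w. if w \<in> S then \<phi> w else \<psi> w"]) simp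
qed

end

section \<open>Separations and boundary degrees in a minimal counterexample\<close>

locale min_inst = planar_like adj X
  for adj :: "'a \<Rightarrow> 'a \<Rightarrow> bool" and X :: "'a set" +
  fixes R U :: "'a set" and L :: "'a \<Rightarrow> int set" and p1 p2 :: 'a and c1 c2 :: int
  assumes IH: "solvable_below (card U)"
    and fin: "finite U" and RU: "R \<inter> U = {}" and cR: "conn adj R"
    and pO: "p1 \<in> nb R U" "p2 \<in> nb R U" and pp: "adj p1 p2" and Lp: "L p1 = {c1}" "L p2 = {c2}" and c12: "c1 \<noteq> c2"
    and size: "\<And>v. v \<in> U - {p1, p2} \<Longrightarrow> card (L v) = need (nb R U) v"
    and unsolved: "\<not> col U L \<phi>"
begin

abbreviation Bd where "Bd \<equiv> nb R U"

lemma O_U: "x \<in> Bd \<Longrightarrow> x \<in> U"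
  by (simp add: nb_def)

lemma pU: "p1 \<in> U" "p2 \<in> U"
  using pO O_U by auto

text \<open>Dropping \<open>D\<close> does not change \<open>R\<close>, so the other vertices keep
  their boundary status and minimality colours them. If that colouring extended from
  \<open>Z\<close> into \<open>D\<close>, all of \<open>U\<close> would be coloured.\<close>

lemma cut:
  assumes D: "D \<subseteq> U" "D \<noteq> {}" "p1 \<notin> D" "p2 \<notin> D" and Z: "Z \<subseteq> U - D"
    and cutoff: "\<forall>d\<in>D. \<forall>w\<in>U - D. adj d w \<longrightarrow> w \<in> Z"
  shows "\<exists>\<phi>. col (U - D) L \<phi> \<and> (\<forall>\<psi>. col (Z \<union> D) L \<psi> \<longrightarrow> (\<exists>z\<in>Z. \<psi> z \<noteq> \<phi> z))"
proof -
  have nbD: "w \<in> nb R (U - D) \<longleftrightarrow> w \<in> Bd" if "w \<in> U - D" for w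
    using that by (auto simp: nb_def)
  have "inst R (U - D) L {p1, p2}"
    unfolding inst_def
  proof (intro conjI ballI)
    show "{p1, p2} \<subseteq> nb R (U - D)"
      using pO D(3,4) by (auto simp: nb_def)
    show "precol L {p1, p2}"
      by (rule precol_pair[OF Lp c12 pp])
    fix w
    assume w: "w \<in> U - D - {p1, p2}"
    then have "need (nb R (U - D)) w = need Bd w"
      by (intro need_cong nbD) auto
    then show "need (nb R (U - D)) w \<le> card (L w)"
      using size[of w] w by simp
  qed (use fin RU cR in auto)
  moreover have "card (U - D) < card U"
    by (rule psubset_card_mono[OF fin]) (use D in auto)
  ultimately obtain \<phi> where \<phi>: "col (U - D) L \<phi>"
    using IH unfolding solvable_below_def by blast
  show ?thesis
  proof (intro exI[of _ \<phi>] conjI allI impI \<phi>, rule ccontr)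
    fix \<psi>
    assume \<psi>: "col (Z \<union> D) L \<psi>" and "\<not> (\<exists>z\<in>Z. \<psi> z \<noteq> \<phi> z)"
    then have eq: "\<psi> z = \<phi> z" if "z \<in> Z" for z
      using that by blast
    have "col D L \<psi>"
      using \<psi> by (simp add: col_def)
    moreover have "\<psi> x \<noteq> \<phi> y" if "x \<in> D" "y \<in> U - D" "adj x y" for x y
    proof -
      have "y \<in> Z"
        using cutoff that by blast
      moreover from this have "\<psi> x \<noteq> \<psi> y"
        using \<psi> that(1,3) by (simp add: col_def)
      ultimately show ?thesis
        using eq[of y] by simp
    qed
    ultimately have "col (D \<union> (U - D)) L (\<lambda>w. if w \<in> D then \<psi> w else \<phi> w)"
      using \<phi> by (intro col_glue) auto
    moreover have "D \<union> (U - D) = U"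
      using D(1) by blast
    ultimately show False
      using unsolved by simp
  qed
qed

lemma cut_component:
  assumes D: "D = {y \<in> U - Z. reach adj (U - Z) x y}"
  shows "\<forall>d\<in>D. \<forall>w\<in>U - D. adj d w \<longrightarrow> w \<in> Z"
proof (intro ballI impI, rule ccontr)
  fix d w
  assume dw: "d \<in> D" "w \<in> U - D" "adj d w" "w \<notin> Z"
  then have "reach adj (U - Z) d w"
    by (intro reach_step) (use D in auto)
  then have "reach adj (U - Z) x w"
    using D dw(1) reach_trans[of adj "U - Z" x d w] by simp
  then show False
    using D dw by auto
qed

text \<open>If \<open>x\<close> and \<open>y\<close> separate, some part \<open>D\<close> is cut off
  from both \<open>p1\<close> and \<open>p2\<close>. Minimality colours everything outside
  \<open>D\<close>, and then \<open>D\<close> itself with \<open>x\<close>, \<open>y\<close> in the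
  role of the precoloured edge.\<close>

lemma chord:
  assumes xy: "x \<in> Bd" "y \<in> Bd" "adj x y"
  shows "conn adj (U - {x, y})"
proof (rule ccontr)
  let ?W = "U - {x, y}"
  assume "\<not> conn adj ?W"
  then obtain a b where ab: "a \<in> ?W" "b \<in> ?W" "\<not> reach adj ?W a b"
    by (auto simp: conn_def)
  \<comment> \<open>As \<open>p1\<close> and \<open>p2\<close> are adjacent, at most one component
    of \<open>?W\<close> contains any of them; \<open>s\<close> is taken from another one. The
    vertex \<open>t\<close> outside the component of \<open>s\<close> witnesses that
    \<open>{x, y} \<union> D\<close> is smaller than \<open>U\<close>.\<close>
  obtain s t where st: "s \<in> ?W" "t \<in> ?W" "\<not> reach adj ?W s t" "\<not> reach adj ?W s p1 \<or> p1 \<in> {x, y}"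
    "\<not> reach adj ?W s p2 \<or> p2 \<in> {x, y}"
  proof (cases "(reach adj ?W a p1 \<and> p1 \<notin> {x, y}) \<or> (reach adj ?W a p2 \<and> p2 \<notin> {x, y})")
    case False
    then show ?thesis
      using that[of a b] ab by blast
  next
    case True
    have p12: "reach adj ?W p1 p2" if "p1 \<notin> {x, y}" "p2 \<notin> {x, y}"
      by (rule reach_step) (use that pU pp in auto)
    have "\<not> reach adj ?W b q" if "reach adj ?W a q" for q
      using that ab(3) reach_trans[of adj ?W a q b] reach_sym[OF sym, of ?W b q] by blast
    moreover have "reach adj ?W a p1" if "p1 \<notin> {x, y}"
      using True that p12 reach_sym[OF sym, of ?W p1 p2] reach_trans[of adj ?W a p2 p1] by blast
    moreover have "reach adj ?W a p2" if "p2 \<notin> {x, y}"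
      using True that p12 reach_trans[of adj ?W a p1 p2] by blast
    moreover have "\<not> reach adj ?W b a"
      using ab(3) reach_sym[OF sym, of ?W b a] by blast
    ultimately show ?thesis
      using that[of b a] ab by blast
  qed
  define D where "D = {w \<in> ?W. reach adj ?W s w}"
  have D: "D \<subseteq> U" "D \<noteq> {}" "p1 \<notin> D" "p2 \<notin> D" "t \<notin> D"
    using st by (auto simp: D_def)
  have Z: "{x, y} \<subseteq> U - D"
    using xy O_U by (auto simp: D_def)
  obtain \<phi> where \<phi>: "col (U - D) L \<phi>" "\<And>\<psi>. col ({x, y} \<union> D) L \<psi> \<Longrightarrow> \<exists>z\<in>{x, y}. \<psi> z \<noteq> \<phi> z"
    using cut[OF D(1-4) Z cut_component[OF D_def]] by blast
  define L' where "L' = (\<lambda>w. if w \<in> {x, y} then {\<phi> w} else L w)"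
  have "inst R ({x, y} \<union> D) L' {x, y}"
    unfolding inst_def
  proof (intro conjI ballI)
    show "{x, y} \<subseteq> nb R ({x, y} \<union> D)"
      using xy by (auto simp: nb_def)
    have "\<phi> x \<noteq> \<phi> y"
      using \<phi>(1) xy Z by (auto simp: col_def)
    then show "precol L' {x, y}"
      by (intro precol_pair[of L' x "\<phi> x" y "\<phi> y"]) (auto simp: L'_def xy)
    fix w
    assume w: "w \<in> {x, y} \<union> D - {x, y}"
    then have wU: "w \<in> U - {p1, p2}" "w \<notin> {x, y}"
      using D by auto
    have "need (nb R ({x, y} \<union> D)) w = need Bd w"
      by (rule need_cong) (use w wU in \<open>auto simp: nb_def\<close>)
    then show "need (nb R ({x, y} \<union> D)) w \<le> card (L' w)"
      using size[OF wU(1)] wU(2) by (simp add: L'_def)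
  next
    show "finite ({x, y} \<union> D)"
      using fin D(1) finite_subset by auto
    show "R \<inter> ({x, y} \<union> D) = {}"
      using RU D(1) Z by blast
  qed (rule cR)
  moreover have "card ({x, y} \<union> D) < card U"
    by (rule psubset_card_mono[OF fin]) (use D(1,5) Z st in auto)
  ultimately obtain \<psi> where \<psi>: "col ({x, y} \<union> D) L' \<psi>"
    using IH unfolding solvable_below_def by blast
  have \<psi>Z: "\<psi> z = \<phi> z" if "z \<in> {x, y}" for z
    using \<psi> that by (auto simp: col_def L'_def)
  have "\<phi> z \<in> L z" if "z \<in> {x, y}" for z
    using \<phi>(1) that Z by (auto simp: col_def)
  then have "\<psi> w \<in> L w" if "w \<in> {x, y} \<union> D" for w
    using \<psi> that \<psi>Z[of w] by (cases "w \<in> {x, y}") (auto simp: col_def L'_def)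
  then have "col ({x, y} \<union> D) L \<psi>"
    using \<psi> by (simp add: col_def)
  from \<phi>(2)[OF this] show False
    using \<psi>Z by blast
qed

lemma RO_linked: "x \<in> Bd \<Longrightarrow> x \<in> B \<Longrightarrow> linked adj R B"
  by (auto simp: nb_def linked_def dest: adj_sym)

lemma linkedI: "adj a b \<Longrightarrow> a \<in> A \<Longrightarrow> b \<in> B \<Longrightarrow> linked adj A B"
  by (auto simp: linked_def)

text \<open>If one component of \<open>U - {v, x, y, z}\<close> is attached to \<open>x\<close>,
  \<open>y\<close> and \<open>z\<close>, then with \<open>R\<close> and \<open>v\<close> it gives
  K_{3,3}. Otherwise, any two of \<open>x\<close>, \<open>y\<close>, \<open>z\<close> are
  nonadjacent (no triangles) and remain connected when \<open>v\<close> and the third are removed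
  (\<open>chord\<close>), so they have a component of their own. The three components, merged with
  \<open>x\<close>, \<open>y\<close>, \<open>z\<close>, give K5 with \<open>R\<close> and
  \<open>v\<close>.\<close>

lemma degree_two:
  assumes v: "v \<in> Bd" and xyz: "x \<in> Bd" "y \<in> Bd" "z \<in> Bd" and a: "adj v x" "adj v y" "adj v z"
    and ne: "x \<noteq> y" "x \<noteq> z" "y \<noteq> z"
  shows False
proof -
  let ?M = "U - {v, x, y, z}"
  define K where "K = (\<lambda>w. {q \<in> ?M. reach adj ?M w q})"
  have vne: "v \<noteq> x" "v \<noteq> y" "v \<noteq> z"
    using a adj_irrefl by auto
  have nadj: "\<not> adj x y" "\<not> adj x z" "\<not> adj y z"
    using a tri[of v x y] tri[of v x z] tri[of v y z] by blast+
  have Kconn: "conn adj (K w)" for w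
    unfolding K_def by (rule conn_component[OF sym])
  have Ksub: "K w \<subseteq> ?M" for w
    by (auto simp: K_def)
  have key: "\<exists>w\<in>?M. linked adj (K w) {p} \<and> linked adj (K w) {q}"
    if "o' \<in> {x, y, z}" "p \<in> {x, y, z}" "q \<in> {x, y, z}" "p \<noteq> q" "p \<noteq> o'" "q \<noteq> o'" "\<not> adj p q" for o' p q
  proof -
    have o': "o' \<in> Bd" "adj v o'"
      using that(1) xyz a by auto
    have pq: "p \<in> U - {v, o'}" "q \<in> U - {v, o'}"
      using that xyz O_U vne by auto
    have "reach adj (U - {v, o'}) p q"
      using chord[OF v o'] pq by (simp add: conn_def)
    \<comment> \<open>\<open>p\<close> with all components attached to it: a path from \<open>p\<close> to \<open>q\<close> can leave \<open>C\<close> only into \<open>q\<close>\<close>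
    define C where "C = {r \<in> U - {v, o', p}. \<exists>s. adj p s \<and> s \<in> ?M \<and> r \<in> K s} \<union> {p}"
    have "q \<notin> C"
      using that(3,4) Ksub by (auto simp: C_def)
    moreover have "p \<in> C"
      by (simp add: C_def)
    ultimately obtain e f where ef: "e \<in> C" "f \<in> U - {v, o'}" "f \<notin> C" "adj e f"
      using reach_exit[OF \<open>reach adj (U - {v, o'}) p q\<close>, of C] by metis
    have fq: "f = q"
    proof (rule ccontr)
      assume "f \<noteq> q"
      have fp: "f \<noteq> p"
        using ef(3) by (auto simp: C_def)
      have "{x, y, z} = {o', p, q}"
        using that(1-6) ne by auto
      then have fM: "f \<in> ?M"
        using ef(2) fp \<open>f \<noteq> q\<close> by auto
      show False
      proof (cases "e = p")
        case True
        have "f \<in> K f"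
          using fM by (simp add: K_def)
        then show False
          using True ef fM fp by (auto simp: C_def)
      next
        case False
        then obtain s where s: "adj p s" "s \<in> ?M" "e \<in> K s"
          using ef(1) by (auto simp: C_def)
        have "reach adj ?M e f"
          by (rule reach_step) (use s(3) Ksub fM ef(4) in auto)
        then have "f \<in> K s"
          using s(3) fM reach_trans[of adj ?M s e f] by (simp add: K_def)
        then show False
          using ef(2,3) s fp by (auto simp: C_def)
      qed
    qed
    then have "e \<noteq> p"
      using ef(4) that(7) by auto
    then obtain s where s: "adj p s" "s \<in> ?M" "e \<in> K s"
      using ef(1) by (auto simp: C_def)
    have "s \<in> K s"
      using s(2) by (simp add: K_def)
    then show ?thesis
      using s ef(4) fq adj_sym unfolding linked_def by blast
  qed
  obtain t1 where t1: "t1 \<in> ?M" "linked adj (K t1) {x}" "linked adj (K t1) {y}"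
    using key[of z x y] ne nadj by blast
  obtain t2 where t2: "t2 \<in> ?M" "linked adj (K t2) {x}" "linked adj (K t2) {z}"
    using key[of y x z] ne nadj by blast
  obtain t3 where t3: "t3 \<in> ?M" "linked adj (K t3) {y}" "linked adj (K t3) {z}"
    using key[of x y z] ne nadj by blast
  have RM: "R \<inter> U = {}"
    by (rule RU)
  have inU: "v \<in> U" "x \<in> U" "y \<in> U" "z \<in> U"
    using v xyz O_U by auto
  have notR: "v \<notin> R" "x \<notin> R" "y \<notin> R" "z \<notin> R" "R \<inter> K w = {}" for w
    using RU inU Ksub[of w] by auto
  have tripod_false: False if "linked adj (K w) {x}" "linked adj (K w) {y}" "linked adj (K w) {z}" for w
  proof (rule K33[of R "{v}" "K w" "{x}" "{y}" "{z}"])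
    show "R \<inter> {v} = {}" "R \<inter> K w = {}" "{v} \<inter> K w = {}" "{x} \<inter> {y} = {}" "{x} \<inter> {z} = {}" "{y} \<inter> {z} = {}"
      "(R \<union> {v} \<union> K w) \<inter> ({x} \<union> {y} \<union> {z}) = {}"
      using Ksub[of w] notR ne vne by auto
    show "linked adj R {x}" "linked adj R {y}" "linked adj R {z}"
      using RO_linked xyz by auto
    show "linked adj {v} {x}" "linked adj {v} {y}" "linked adj {v} {z}"
      using a by (auto simp: linked_def)
  qed (use that cR Kconn in simp_all)
  have share: "linked adj (K w) B" if h: "K w \<inter> K w' \<noteq> {}" "linked adj (K w') B" for w w' B
  proof -
    obtain q where q: "reach adj ?M w q" "reach adj ?M w' q"
      using h(1) by (auto simp: K_def)
    have "reach adj ?M w w'"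
      using reach_trans[OF q(1) reach_sym[OF sym q(2)]] .
    then have "K w' \<subseteq> K w"
      using reach_trans[of adj ?M w w'] by (auto simp: K_def)
    then show ?thesis
      using h(2) unfolding linked_def by blast
  qed
  \<comment> \<open>A component serving two of the pairs would be attached to all three of
    \<open>x\<close>, \<open>y\<close>, \<open>z\<close>.\<close>
  have d: "K t1 \<inter> K t2 = {}" "K t1 \<inter> K t3 = {}" "K t2 \<inter> K t3 = {}"
    using share[of t1 t2 "{z}"] share[of t1 t3 "{z}"] share[of t2 t3 "{y}"] t1 t2 t3
      tripod_false[of t1] tripod_false[of t2] by metis+
  have mono: "linked adj A' B'" if "linked adj A B" "A \<subseteq> A'" "B \<subseteq> B'" for A B A' B'
    using that unfolding linked_def by blast
  show False
  proof (rule K5[of R "{v}" "insert x (K t1)" "insert y (K t3)" "insert z (K t2)"])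
    show "conn adj (insert x (K t1))" "conn adj (insert y (K t3))" "conn adj (insert z (K t2))"
      using conn_insert[OF sym Kconn] t1 t2 t3 by blast+
    show "insert x (K t1) \<inter> insert y (K t3) = {}" "insert x (K t1) \<inter> insert z (K t2) = {}" "insert y (K t3) \<inter> insert z (K t2) = {}"
      using d ne Ksub by blast+
    show "R \<inter> {v} = {}" "(R \<union> {v}) \<inter> (insert x (K t1) \<union> insert y (K t3) \<union> insert z (K t2)) = {}"
      using notR vne Ksub by blast+
    show "linked adj (insert x (K t1)) (insert y (K t3))"
      by (rule mono[OF t1(3)]) auto
    show "linked adj (insert x (K t1)) (insert z (K t2))"
      by (rule mono[OF linked_sym[OF sym t2(2)]]) auto
    show "linked adj (insert y (K t3)) (insert z (K t2))"
      by (rule mono[OF t3(3)]) auto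
    show "linked adj R (insert x (K t1))" "linked adj R (insert y (K t3))" "linked adj R (insert z (K t2))" "linked adj R {v}"
      using RO_linked xyz v by auto
    show "linked adj {v} (insert x (K t1))" "linked adj {v} (insert y (K t3))" "linked adj {v} (insert z (K t2))"
      using a by (auto simp: linked_def)
  qed (use cR in auto)
qed

end

section \<open>Separators formed by two boundary vertices and a common interior neighbour\<close>

context min_inst
begin

text \<open>\<open>M\<close> is the part around \<open>w 0\<close> off the three vertices and off
  the path between \<open>w 1\<close> and \<open>w n\<close>. If the claim fails, \<open>M\<close>
  has a neighbour on that path. A neighbour beyond \<open>w 2\<close> splits the path into two
  branch sets and yields K_{3,3}. If \<open>w 2\<close> is the only one, \<open>M\<close> must still
  have \<open>u\<close> or \<open>w n\<close> as a neighbour, since the edge from \<open>w 1\<close>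
  to \<open>w 2\<close> does not separate, and this yields K5.\<close>

lemma sep:
  fixes w :: "nat \<Rightarrow> 'a"
  assumes n: "3 \<le> n" and wB: "\<And>i. i \<le> n \<Longrightarrow> w i \<in> Bd" and inj: "inj_on w {..n}"
    and step: "\<And>i. i < n \<Longrightarrow> adj (w i) (w (Suc i))"
    and u: "u \<in> U" "u \<notin> Bd" "adj u (w 1)" "adj u (w n)"
  shows "\<not> reach adj (U - {w 1, u, w n}) (w 0) (w 2)"
proof
  let ?W = "U - {w 1, u, w n}"
  assume reach: "reach adj ?W (w 0) (w 2)"
  have neq: "w i = w k \<longleftrightarrow> i = k" if "i \<le> n" "k \<le> n" for i k
    using inj_on_eq_iff[OF inj] that by simp
  have wU: "w i \<in> U" "w i \<noteq> u" if "i \<le> n" for i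
    using wB[OF that] O_U u(2) by auto
  have wR: "w i \<notin> R" if "i \<le> n" for i
    using wU(1)[OF that] RU by blast
  have uR: "u \<notin> R"
    using u(1) RU by blast
  define Arc where "Arc = w ` {2..n - 1}"
  have ArcU: "Arc \<subseteq> U"
    using wU n by (auto simp: Arc_def)
  define Y where "Y = ?W - Arc"
  define M where "M = {y \<in> Y. reach adj Y (w 0) y}"
  have notArc: "w i \<notin> Arc" if "i \<le> n" "i < 2 \<or> i = n" for i
    using that n by (auto simp: Arc_def neq)
  have w0Y: "w 0 \<in> Y"
    using wU[of 0] neq[of 0 1] neq[of 0 n] n notArc[of 0] by (auto simp: Y_def)
  then have w0M: "w 0 \<in> M"
    by (simp add: M_def)
  have MY: "M \<subseteq> Y"
    by (auto simp: M_def)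
  have Mclosed: "b \<in> M" if "a \<in> M" "b \<in> Y" "adj a b" for a b
  proof -
    have "reach adj Y a b"
      by (rule reach_step) (use that MY in auto)
    then show ?thesis
      using that reach_trans[of adj Y "w 0" a b] by (simp add: M_def)
  qed
  have Mconn: "conn adj M"
    unfolding M_def by (rule conn_component[OF sym])
  have seg: "conn adj (w ` {i..k})" if "k \<le> n" for i k
    by (rule conn_segment[OF sym]) (use that step in auto)
  have MU: "M \<inter> R = {}" "w 1 \<notin> M" "u \<notin> M" "w n \<notin> M" "M \<inter> Arc = {}"
    using MY RU by (auto simp: Y_def)
  have wn: "w 1 \<notin> R" "w n \<notin> R" "w 1 \<noteq> w n" "w n \<noteq> u" "w 1 \<noteq> u" "w 1 \<notin> Arc" "w n \<notin> Arc"
    using wR[of 1] wR[of n] neq[of 1 n] wU(2)[of n] wU(2)[of 1] notArc[of 1] notArc[of n] n by simp_all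
  have uArc: "u \<notin> Arc" "R \<inter> Arc = {}"
  proof -
    have "u \<noteq> w i" if "i \<le> n - 1" for i
    proof -
      have "i \<le> n"
        using that by arith
      then show ?thesis
        using wU(2)[of i] by simp
    qed
    then show "u \<notin> Arc"
      unfolding Arc_def by (metis atLeastAtMost_iff imageE)
    show "R \<inter> Arc = {}"
      using ArcU RU by blast
  qed
  have w2: "w 2 \<in> Arc"
    using n by (auto simp: Arc_def)
  have "w 2 \<notin> M"
    using w2 MU(5) by blast
  obtain a b where ab: "a \<in> M" "b \<in> ?W" "b \<notin> M" "adj a b"
    using reach_exit[OF reach w0M \<open>w 2 \<notin> M\<close>] by metis
  have "b \<in> Arc"
    using Mclosed[OF ab(1) _ ab(4)] ab(2,3) by (auto simp: Y_def)
  then obtain j where j: "2 \<le> j" "j \<le> n - 1" "b = w j"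
    by (auto simp: Arc_def)
  show False
  proof (cases "\<exists>a\<in>M. \<exists>j. 3 \<le> j \<and> j \<le> n - 1 \<and> adj a (w j)")
    case True
    then obtain a j where aj: "a \<in> M" "3 \<le> j" "j \<le> n - 1" "adj a (w j)"
      by blast
    define A where "A = w ` {j..n - 1}"
    define B where "B = w ` {2..j - 1}"
    have AB: "A \<subseteq> Arc" "B \<subseteq> Arc"
      using aj(2,3) by (auto simp: A_def B_def Arc_def)
    have dAB: "A \<inter> B = {}"
      using aj(2,3) n by (auto simp: A_def B_def neq)
    have nn: "adj (w (n - 1)) (w n)" "adj (w (j - 1)) (w j)" "adj (w 1) (w 2)" "adj (w 0) (w 1)"
      using step[of "n - 1"] step[of "j - 1"] step[of 1] step[of 0] aj n by (simp_all add: numeral_2_eq_2)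
    have inAB: "w j \<in> A" "w (n - 1) \<in> A" "w (j - 1) \<in> B" "w 2 \<in> B"
      using aj(2,3) by (auto simp: A_def B_def)
    show False
    proof (rule K33[of R "insert u {w 1}" A B "{w n}" M])
      show "conn adj (insert u {w 1})"
        by (rule conn_insert[OF sym conn_singleton linkedI[OF adj_sym[OF u(3)]]]) auto
      show "conn adj A" "conn adj B"
        unfolding A_def B_def using aj n by (auto intro!: seg)
      show "R \<inter> insert u {w 1} = {}" "R \<inter> A = {}" "insert u {w 1} \<inter> A = {}"
        using wn uR uArc AB(1) by blast+
      show "B \<inter> {w n} = {}" "B \<inter> M = {}" "{w n} \<inter> M = {}"
        using AB(2) wn MU by blast+
      show "(R \<union> insert u {w 1} \<union> A) \<inter> (B \<union> {w n} \<union> M) = {}"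
        using dAB MU wn uR uArc AB by blast
      show "linked adj R B" "linked adj R {w n}" "linked adj R M"
        using RO_linked wB[of 2] wB[of n] wB[of 0] n inAB w0M by auto
      show "linked adj (insert u {w 1}) B" "linked adj (insert u {w 1}) {w n}" "linked adj (insert u {w 1}) M"
        using nn u inAB w0M adj_sym unfolding linked_def by blast+
      show "linked adj A B" "linked adj A {w n}" "linked adj A M"
        using nn inAB aj adj_sym unfolding linked_def by blast+
    qed (use cR Mconn in auto)
  next
    case False
    have jeq: "j = 2"
    proof (rule ccontr)
      assume "j \<noteq> 2"
      then have "3 \<le> j"
        using j(1) by simp
      then show False
        using False ab(1,4) j(2,3) by blast
    qed
    have "conn adj (U - {w 1, w 2})"
      using chord[of "w 1" "w 2"] wB[of 1] wB[of 2] step[of 1] n by (simp add: numeral_2_eq_2)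
    moreover have "w 0 \<in> U - {w 1, w 2}" "w n \<in> U - {w 1, w 2}"
      using wU neq n by auto
    ultimately have r: "reach adj (U - {w 1, w 2}) (w 0) (w n)"
      by (simp add: conn_def)
    obtain e f where ef: "e \<in> M" "f \<in> U - {w 1, w 2}" "f \<notin> M" "adj e f"
      using reach_exit[OF r w0M MU(4)] by metis
    have "f \<notin> Y"
      using Mclosed[OF ef(1) _ ef(4)] ef(3) by blast
    moreover have "f \<notin> Arc"
    proof
      assume "f \<in> Arc"
      then obtain i where i: "2 \<le> i" "i \<le> n - 1" "f = w i"
        by (auto simp: Arc_def)
      then have "i \<noteq> 2"
        using ef(2) by auto
      then have "3 \<le> i"
        using i(1) by simp
      then show False
        using False ef(1,4) i by blast
    qed
    ultimately have f: "f \<in> {u, w n}"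
      using ef(2) by (auto simp: Y_def)
    have Arcs: "w (n - 1) \<in> Arc" "adj (w (n - 1)) (w n)" "adj (w 1) (w 2)" "adj (w 0) (w 1)"
      using step[of "n - 1"] step[of 1] step[of 0] n by (auto simp: Arc_def numeral_2_eq_2)
    show False
    proof (rule K5[of R "{w 1}" Arc "insert u {w n}" M])
      show "conn adj Arc"
        unfolding Arc_def by (rule seg) simp
      show "conn adj (insert u {w n})"
        by (rule conn_insert[OF sym conn_singleton linkedI[OF adj_sym[OF u(4)]]]) auto
      show "Arc \<inter> insert u {w n} = {}" "Arc \<inter> M = {}" "insert u {w n} \<inter> M = {}" "R \<inter> {w 1} = {}"
        using MU wn uArc by blast+
      show "(R \<union> {w 1}) \<inter> (Arc \<union> insert u {w n} \<union> M) = {}"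
        using MU uR wn uArc by blast
      show "linked adj R Arc" "linked adj R (insert u {w n})" "linked adj R M" "linked adj R {w 1}"
        using RO_linked wB[of 2] wB[of n] wB[of 0] wB[of 1] n w2 w0M by auto
      show "linked adj {w 1} Arc" "linked adj {w 1} (insert u {w n})" "linked adj {w 1} M"
        using Arcs w2 u w0M adj_sym unfolding linked_def by blast+
      show "linked adj Arc (insert u {w n})" "linked adj Arc M" "linked adj (insert u {w n}) M"
        using Arcs ab(1,4) j(3) jeq w2 ef(1,4) f adj_sym unfolding linked_def by blast+
    qed (use cR Mconn in auto)
  qed
qed

text \<open>Inside the part cut off by \<open>w 0\<close>, \<open>u\<close>, \<open>w n\<close>, the
  coloured vertex \<open>w 0\<close> is deleted along with \<open>w 1\<close> up to
  \<open>w j\<close>. This brings \<open>u\<close> to the boundary and leaves \<open>u\<close>,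
  \<open>w n\<close> as the precoloured edge; a solution would extend \<open>\<phi>\<close>, against
  \<open>nonext\<close>.\<close>

lemma region_delete:
  fixes w :: "nat \<Rightarrow> 'a" and \<kappa> :: "nat \<Rightarrow> int"
  assumes D: "D \<subseteq> U" "p1 \<notin> D" "p2 \<notin> D" and Z: "{w 0, u, w n} \<subseteq> U - D"
    and \<phi>: "col (U - D) L \<phi>" and nonext: "\<And>\<psi>. col ({w 0, u, w n} \<union> D) L \<psi> \<Longrightarrow> \<exists>z\<in>{w 0, u, w n}. \<psi> z \<noteq> \<phi> z"
    and wB: "\<And>i. i \<le> n \<Longrightarrow> w i \<in> Bd" and inj: "inj_on w {..n}" and step: "\<And>i. i < n \<Longrightarrow> adj (w i) (w (Suc i))"
    and wD: "\<And>i. 0 < i \<Longrightarrow> i < n \<Longrightarrow> w i \<in> D"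
    and nbrs: "\<And>i x. i < n \<Longrightarrow> x \<in> D \<Longrightarrow> x \<in> Bd \<Longrightarrow> adj (w i) x \<Longrightarrow> x = w (Suc i) \<or> 0 < i \<and> x = w (i - 1)"
    and chordless: "\<And>i k. i \<le> n \<Longrightarrow> k \<le> n \<Longrightarrow> adj (w i) (w k) \<Longrightarrow> k = Suc i \<or> i = Suc k"
    and u: "u \<notin> Bd" "adj u (w 0)" "adj u (w n)"
    and j: "j < n" and \<kappa>0: "\<kappa> 0 = \<phi> (w 0)" and \<kappa>L: "\<And>i. 0 < i \<Longrightarrow> i \<le> j \<Longrightarrow> \<kappa> i \<in> L (w i)"
    and \<kappa>s: "\<And>i. i < j \<Longrightarrow> \<kappa> i \<noteq> \<kappa> (Suc i)"
    and stop: "if Suc j < n then \<kappa> j \<notin> L (w (Suc j)) else \<kappa> j \<noteq> \<phi> (w n)"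
    and harmless: "\<And>x i k. x \<in> U - Bd \<Longrightarrow> i \<le> j \<Longrightarrow> k \<le> j \<Longrightarrow> adj x (w i) \<Longrightarrow> adj x (w k) \<Longrightarrow> \<kappa> i = \<kappa> k"
    and uok: "\<And>i. 0 < i \<Longrightarrow> i \<le> j \<Longrightarrow> adj u (w i) \<Longrightarrow> \<kappa> i \<noteq> \<phi> u"
  shows False
proof -
  let ?Z = "{w 0, u, w n}"
  let ?U = "?Z \<union> D"
  define S where "S = w ` {..j}"
  define f where "f = (\<lambda>x. \<kappa> (inv_into {..n} w x))"
  define L' where "L' = (\<lambda>x. if x \<in> ?Z then {\<phi> x} else L x)"
  have neq: "w i = w k \<longleftrightarrow> i = k" if "i \<le> n" "k \<le> n" for i k
    using inj_on_eq_iff[OF inj] that by simp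
  have f: "f (w i) = \<kappa> i" if "i \<le> n" for i
    using inv_into_f_f[OF inj] that by (simp add: f_def)
  have wu: "w i \<noteq> u" if "i \<le> n" for i
    using wB[OF that] u(1) by auto
  have UU: "?U \<subseteq> U"
    using D Z by blast
  have nbU: "nb R ?U = Bd \<inter> ?U"
    using UU by (auto simp: nb_def)
  have L'D: "L' x = L x" if "x \<in> D" for x
    using that Z by (auto simp: L'_def)
  have wnS: "w n \<notin> S" "u \<notin> S"
  proof -
    have "w i \<noteq> w n \<and> w i \<noteq> u" if "i \<le> j" for i
      using neq[of i n] wu[of i] that j by simp
    then show "w n \<notin> S" "u \<notin> S"
      unfolding S_def by (metis atMost_iff imageE)+
  qed
  have \<phi>ne: "\<phi> x \<noteq> \<phi> y" if "x \<in> ?Z" "y \<in> ?Z" "adj x y" for x y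
    using \<phi> Z that by (auto simp: col_def)
  have card: "card ?U \<le> card U"
    by (rule card_mono[OF fin UU])
  have "\<exists>\<psi>. col ?U L' \<psi> \<and> (\<forall>s\<in>S. \<psi> s = f s)"
  proof (rule delete[OF IH card _ _ cR])
    show "finite ?U" "R \<inter> ?U = {}"
      using finite_subset[OF UU fin] UU RU by blast+
    show "S \<subseteq> nb R ?U" "S \<noteq> {}"
    proof -
      have "w i \<in> ?U" if "i \<le> j" for i
        using wD[of i] j that by (cases "i = 0") auto
      then show "S \<subseteq> nb R ?U"
        using nbU wB j by (auto simp: S_def)
    qed (auto simp: S_def)
    show "f s \<in> L' s" if s: "s \<in> S" for s
    proof -
      obtain i where i: "i \<le> j" "s = w i"
        using s by (auto simp: S_def)
      show ?thesis
      proof (cases "i = 0")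
        case True
        then show ?thesis
          using i f[of 0] \<kappa>0 by (simp add: L'_def)
      next
        case False
        then show ?thesis
          using i f[of i] \<kappa>L[of i] L'D[OF wD[of i]] j by simp
      qed
    qed
    show "f s \<noteq> f t" if s: "s \<in> S" "t \<in> S" "adj s t" for s t
    proof -
      obtain i k where ik: "i \<le> j" "s = w i" "k \<le> j" "t = w k"
        using s by (auto simp: S_def)
      then have "k = Suc i \<or> i = Suc k"
        using chordless[of i k] s(3) j by simp
      then show ?thesis
        using ik f[of i] f[of k] j \<kappa>s[of i] \<kappa>s[of k] by auto
    qed
    show "{u, w n} \<subseteq> ?U - S"
      using wnS by auto
    show "q \<in> nb R ?U \<or> (\<exists>s\<in>S. adj q s)" if "q \<in> {u, w n}" for q
      using that nbU wB[of n] u(2) by (auto simp: S_def)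
    show "precol L' {u, w n}"
      by (rule precol_pair[of L' u "\<phi> u" "w n" "\<phi> (w n)"]) (use \<phi>ne[of u "w n"] u in \<open>auto simp: L'_def\<close>)
    show "f s \<notin> L' q" if q: "q \<in> {u, w n}" "s \<in> S" "adj q s" for q s
    proof -
      obtain i where i: "i \<le> j" "s = w i"
        using q by (auto simp: S_def)
      have "f s \<noteq> \<phi> q"
      proof (cases "q = u")
        case True
        then show ?thesis
          using q(3) i uok[of i] f[of i] j \<kappa>0 \<phi>ne[of u "w 0"] by (cases "i = 0") auto
      next
        case False
        then have q: "q = w n" "adj (w n) (w i)"
          using q i by auto
        then have "n = Suc i"
          using chordless[of n i] i j by auto
        moreover from this have "i = j"
          using i(1) j by simp
        ultimately show ?thesis
          using stop q(1) i f[of i] by simp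
      qed
      then show ?thesis
        using q(1) by (auto simp: L'_def)
    qed
    fix x
    assume x: "x \<in> ?U - S - {u, w n}"
    have "w 0 \<in> S"
      by (auto simp: S_def)
    then have xD: "x \<in> D"
      using x by auto
    have "need (nb R ?U) x = need Bd x"
      by (rule need_cong) (use xD nbU in auto)
    moreover have "x \<in> U - {p1, p2}"
      using xD D by auto
    ultimately show "need (nb R ?U) x \<le> card (L' x)"
      using size[of x] L'D[OF xD] by simp
    show "f s \<notin> L' x" if s: "x \<in> nb R ?U" "s \<in> S" "adj x s" for s
    proof -
      obtain i where i: "i \<le> j" "s = w i"
        using s by (auto simp: S_def)
      have "x \<notin> S"
        using x by blast
      then have ne: "x \<noteq> w (i - 1)"
        using i by (auto simp: S_def)
      have "x = w (Suc i)"
        using nbrs[of i x] xD s nbU i j adj_sym ne by auto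
      then have "\<not> Suc i \<le> j"
        using \<open>x \<notin> S\<close> by (auto simp: S_def)
      then have "i = j"
        using i(1) by simp
      moreover from this have "Suc j \<noteq> n"
        using x \<open>x = w (Suc i)\<close> by auto
      ultimately have "i = j" "Suc j < n"
        using j by simp_all
      then show ?thesis
        using stop \<open>x = w (Suc i)\<close> f[of j] j i L'D[OF xD] by simp
    qed
    show "f s = f t" if s: "x \<notin> nb R ?U" "s \<in> S" "t \<in> S" "adj x s" "adj x t" for s t
    proof -
      obtain i k where ik: "i \<le> j" "s = w i" "k \<le> j" "t = w k"
        using s by (auto simp: S_def)
      have "x \<in> U - Bd"
        using s(1) nbU xD D by auto
      then have "\<kappa> i = \<kappa> k"
        using harmless[of x i k] ik s by simp
      then show ?thesis
        using ik f j by simp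
    qed
  qed
  then obtain \<psi> where \<psi>: "col ?U L' \<psi>"
    by blast
  have \<psi>Z: "\<psi> z = \<phi> z" if "z \<in> ?Z" for z
    using \<psi> that by (auto simp: col_def L'_def)
  have "\<phi> z \<in> L z" if "z \<in> ?Z" for z
    using \<phi> that Z by (auto simp: col_def)
  then have "\<psi> x \<in> L x" if "x \<in> ?U" for x
    using \<psi> that \<psi>Z[of x] L'D[of x] by (cases "x \<in> ?Z") (auto simp: col_def)
  then have "col ?U L \<psi>"
    using \<psi> by (simp add: col_def)
  from nonext[OF this] show False
    using \<psi>Z by blast
qed

end

section \<open>Boundary paths\<close>

text \<open>\<open>vnbrs\<close> lets \<open>p1\<close> be adjacent to \<open>v m\<close>, so the
  boundary path may close up to a cycle. \<open>c2L\<close> is a normalisation: the colour of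
  \<open>p2\<close> is always one that \<open>v 1\<close> loses.\<close>

locale opath = min_inst adj X R U L p1 p2 c1 c2
  for adj :: "'a \<Rightarrow> 'a \<Rightarrow> bool" and X R U L p1 p2 c1 c2 +
  fixes v :: "nat \<Rightarrow> 'a" and m :: nat
  assumes v0: "v 0 = p2" and m1: "1 \<le> m" and vB: "\<And>i. i \<le> m \<Longrightarrow> v i \<in> nb R U" and vp: "\<And>i. i \<le> m \<Longrightarrow> v i \<noteq> p1"
    and vinj: "inj_on v {..m}" and vstep: "\<And>i. i < m \<Longrightarrow> adj (v i) (v (Suc i))"
    and vnbrs: "\<And>i x. i \<le> m \<Longrightarrow> x \<in> nb R U \<Longrightarrow> adj (v i) x \<Longrightarrow>
      (i = 0 \<or> i = m) \<and> x = p1 \<or> 0 < i \<and> x = v (i - 1) \<or> i < m \<and> x = v (Suc i)"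
    and c2L: "c2 \<in> L (v 1)"
begin

lemma veq: "i \<le> m \<Longrightarrow> k \<le> m \<Longrightarrow> v i = v k \<longleftrightarrow> i = k"
  using inj_on_eq_iff[OF vinj] by simp

lemma vU: "i \<le> m \<Longrightarrow> v i \<in> U"
  using vB O_U by blast

lemma vadj: "i \<le> m \<Longrightarrow> k \<le> m \<Longrightarrow> adj (v i) (v k) \<Longrightarrow> k = Suc i \<or> i = Suc k"
  using vnbrs[of i "v k"] vB[of k] vp[of k] veq[of k "i - 1"] veq[of k "Suc i"] by auto

definition pair :: "nat \<Rightarrow> nat \<Rightarrow> bool" where
  "pair i k \<longleftrightarrow> (\<exists>x\<in>U - Bd. adj x (v i) \<and> adj x (v k))"

lemma pair_sym: "pair i k \<Longrightarrow> pair k i"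
  by (auto simp: pair_def)

lemma pair_far: "pair i k \<Longrightarrow> i < k \<Longrightarrow> k \<le> m \<Longrightarrow> Suc i < k"
proof (rule ccontr)
  assume *: "pair i k" "i < k" "k \<le> m" "\<not> Suc i < k"
  then have "k = Suc i"
    by simp
  then have "adj (v i) (v k)"
    using vstep[of i] *(2,3) by simp
  then show False
    using *(1) tri by (auto simp: pair_def)
qed

text \<open>\<open>p2\<close> stays and sees only \<open>v 1\<close>, whence the single condition
  \<open>\<kappa> 1 \<noteq> c2\<close>. At the far end \<open>stop\<close> protects the next
  boundary vertex, or \<open>p1\<close> if the path is exhausted.\<close>

lemma prefix_delete:
  fixes \<kappa> :: "nat \<Rightarrow> int"
  assumes j: "1 \<le> j" "j \<le> m" and \<kappa>L: "\<And>i. 1 \<le> i \<Longrightarrow> i \<le> j \<Longrightarrow> \<kappa> i \<in> L (v i)" and \<kappa>1: "\<kappa> 1 \<noteq> c2"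
    and \<kappa>s: "\<And>i. 1 \<le> i \<Longrightarrow> i < j \<Longrightarrow> \<kappa> i \<noteq> \<kappa> (Suc i)"
    and stop: "if j < m then \<kappa> j \<notin> L (v (Suc j)) else adj (v m) p1 \<longrightarrow> \<kappa> m \<noteq> c1"
    and harmless: "\<And>i k. 1 \<le> i \<Longrightarrow> i < k \<Longrightarrow> k \<le> j \<Longrightarrow> pair i k \<Longrightarrow> \<kappa> i = \<kappa> k"
  shows False
proof -
  define S where "S = v ` {1..j}"
  define f where "f = (\<lambda>x. \<kappa> (inv_into {..m} v x))"
  have f: "f (v i) = \<kappa> i" if "i \<le> m" for i
    unfolding f_def by (rule arg_cong[OF inv_into_f_f[OF vinj]]) (use that in simp)
  have S: "\<exists>i. 1 \<le> i \<and> i \<le> j \<and> s = v i \<and> i \<le> m" if "s \<in> S" for s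
  proof -
    from that obtain i where "i \<in> {1..j}" "s = v i"
      unfolding S_def by blast
    then show ?thesis
      using j(2) by (intro exI[of _ i]) simp
  qed
  have SI: "v i \<in> S" if "1 \<le> i" "i \<le> j" for i
    using that by (auto simp: S_def)
  have pS: "p1 \<notin> S" "p2 \<notin> S"
  proof -
    show "p1 \<notin> S"
      using S[of p1] vp by blast
    show "p2 \<notin> S"
    proof
      assume "p2 \<in> S"
      then obtain i where "1 \<le> i" "v 0 = v i" "i \<le> m"
        using S[of p2] v0 by auto
      then show False
        using veq[of 0 i] by simp
    qed
  qed
  have "\<exists>\<psi>. col U L \<psi> \<and> (\<forall>s\<in>S. \<psi> s = f s)"
  proof (rule delete[OF IH order.refl fin RU cR])
    show "S \<subseteq> Bd" "S \<noteq> {}"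
      using S vB SI[of 1] j by blast+
    show "f s \<in> L s" if s: "s \<in> S" for s
      using S[OF s] f \<kappa>L by auto
    show "f s \<noteq> f t" if s: "s \<in> S" "t \<in> S" "adj s t" for s t
    proof -
      obtain i k where ik: "1 \<le> i" "i \<le> j" "s = v i" "i \<le> m" "1 \<le> k" "k \<le> j" "t = v k" "k \<le> m"
        using S[OF s(1)] S[OF s(2)] by blast
      then have "k = Suc i \<or> i = Suc k"
        using vadj[of i k] s(3) by simp
      then show ?thesis
        using ik f[of i] f[of k] \<kappa>s[of i] \<kappa>s[of k] by auto
    qed
    show "{p1, p2} \<subseteq> U - S"
      using pU pS by auto
    show "q \<in> Bd \<or> (\<exists>s\<in>S. adj q s)" if "q \<in> {p1, p2}" for q
      using that pO by auto
    show "precol L {p1, p2}"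
      by (rule precol_pair[OF Lp c12 pp])
    show "f s \<notin> L q" if q: "q \<in> {p1, p2}" "s \<in> S" "adj q s" for q s
    proof -
      obtain i where i: "1 \<le> i" "i \<le> j" "s = v i" "i \<le> m"
        using S[OF q(2)] by blast
      show ?thesis
      proof (cases "q = p1")
        case True
        have "i - 1 \<le> m"
          using i(4) by arith
        then have "v (i - 1) \<noteq> p1" "i < m \<Longrightarrow> v (Suc i) \<noteq> p1"
          using vp[of "i - 1"] vp[of "Suc i"] by simp_all
        moreover have "adj (v i) p1"
          using q(3) i(3) True adj_sym by simp
        ultimately have "i = m"
          using vnbrs[of i p1] i(1,4) pO(1) by auto
        then show ?thesis
          using stop i j True q(3) adj_sym f[of m] Lp by auto
      next
        case False
        then have "adj (v 0) (v i)"
          using q i v0 by simp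
        then have "i = 1"
          using vadj[of 0 i] i by simp
        then show ?thesis
          using \<kappa>1 False q f[of 1] i Lp by auto
      qed
    qed
    fix x
    assume x: "x \<in> U - S - {p1, p2}"
    show "need Bd x \<le> card (L x)"
      using size[of x] x by simp
    show "f s \<notin> L x" if s: "x \<in> Bd" "s \<in> S" "adj x s" for s
    proof -
      obtain i where i: "1 \<le> i" "i \<le> j" "s = v i" "i \<le> m"
        using S[OF s(2)] by blast
      have "x \<noteq> v (i - 1)"
      proof (cases "i = 1")
        case False
        then have "1 \<le> i - 1" "i - 1 \<le> j"
          using i by arith+
        then show ?thesis
          using SI x by blast
      qed (use x v0 in auto)
      then have xi: "x = v (Suc i)" "i < m"
        using vnbrs[of i x] i s adj_sym x by auto
      have "i = j"
        using SI[of "Suc i"] xi x i by (cases "Suc i \<le> j") auto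
      then show ?thesis
        using stop xi i f[of i] by simp
    qed
    show "f s = f t" if s: "x \<notin> Bd" "s \<in> S" "t \<in> S" "adj x s" "adj x t" for s t
    proof -
      obtain i k where ik: "1 \<le> i" "i \<le> j" "s = v i" "i \<le> m" "1 \<le> k" "k \<le> j" "t = v k" "k \<le> m"
        using S[OF s(2)] S[OF s(3)] by blast
      have "x \<in> U - Bd" "adj x (v i)" "adj x (v k)"
        using s(1,4,5) x ik(3,7) by simp_all
      then have "pair i k"
        unfolding pair_def by blast
      have "\<kappa> i = \<kappa> k"
      proof (cases i k rule: linorder_cases)
        case less
        then show ?thesis
          using harmless[of i k] ik \<open>pair i k\<close> by simp
      next
        case greater
        then have "\<kappa> k = \<kappa> i"
          using harmless[of k i] ik pair_sym[OF \<open>pair i k\<close>] by simp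
        then show ?thesis
          by simp
      qed simp
      then show ?thesis
        using ik f by simp
    qed
  qed
  then show False
    using unsolved by blast
qed

text \<open>\<open>D\<close> is enclosed by \<open>u\<close> and the path from \<open>v a\<close> to
  \<open>v b\<close>, and \<open>\<phi>\<close> colours the rest but does not extend into
  \<open>D\<close>. With \<open>v (a - 1)\<close> and \<open>v (Suc b)\<close> outside, the only
  boundary neighbour of \<open>v a\<close> or \<open>v b\<close> in \<open>D\<close> is the next
  path vertex.\<close>

definition region :: "nat \<Rightarrow> nat \<Rightarrow> 'a \<Rightarrow> 'a set \<Rightarrow> ('a \<Rightarrow> int) \<Rightarrow> bool" where
  "region a b u D \<phi> \<longleftrightarrow> 1 \<le> a \<and> Suc a < b \<and> b \<le> m \<and> u \<in> U - Bd \<and> adj u (v a) \<and> adj u (v b) \<and>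
     D \<subseteq> U \<and> {v a, u, v b} \<subseteq> U - D \<and> p1 \<notin> D \<and> p2 \<notin> D \<and> (\<forall>i. a < i \<longrightarrow> i < b \<longrightarrow> v i \<in> D) \<and>
     v (a - 1) \<notin> D \<and> (b < m \<longrightarrow> v (Suc b) \<notin> D) \<and> col (U - D) L \<phi> \<and>
     (\<forall>\<psi>. col ({v a, u, v b} \<union> D) L \<psi> \<longrightarrow> (\<exists>z\<in>{v a, u, v b}. \<psi> z \<noteq> \<phi> z))"

text \<open>\<open>sep\<close> applies at \<open>v a\<close>, and at \<open>v b\<close> with the
  path reversed. The precoloured vertices stay outside because \<open>p2\<close> is joined to
  \<open>v (a - 1)\<close> along the path and \<open>p1\<close> is adjacent to
  \<open>p2\<close>.\<close>

lemma region_exists: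
  assumes ab: "1 \<le> a" "a < b" "b \<le> m" and u: "u \<in> U - Bd" "adj u (v a)" "adj u (v b)"
  obtains D \<phi> where "region a b u D \<phi>"
proof -
  have ab2: "Suc a < b"
    using pair_far[of a b] ab u by (auto simp: pair_def)
  let ?Z = "{v a, u, v b}"
  define D where "D = {y \<in> U - ?Z. reach adj (U - ?Z) (v (Suc a)) y}"
  have vu: "v i \<noteq> u" if "i \<le> m" for i
    using vB[OF that] u(1) by auto
  have vZ: "v i \<in> U - ?Z" if "i \<le> m" "i \<noteq> a" "i \<noteq> b" for i
    using that vU vu veq ab by auto
  have run: "reach adj (U - ?Z) (v i) (v k)" if "i \<le> k" "k \<le> m" "\<And>l. i \<le> l \<Longrightarrow> l \<le> k \<Longrightarrow> l \<noteq> a \<and> l \<noteq> b" for i k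
  proof -
    have "conn adj (v ` {i..k})"
      by (rule conn_segment[OF sym]) (use that(2) vstep in auto)
    then have "reach adj (v ` {i..k}) (v i) (v k)"
      using that(1) by (simp add: conn_def)
    moreover have "v ` {i..k} \<subseteq> U - ?Z"
    proof (rule image_subsetI)
      fix l
      assume "l \<in> {i..k}"
      then show "v l \<in> U - ?Z"
        using vZ[of l] that(2) that(3)[of l] by simp
    qed
    ultimately show ?thesis
      by (rule reach_mono)
  qed
  have inD: "v i \<in> D" if "a < i" "i < b" for i
    using run[of "Suc a" i] vZ[of i] that ab by (simp add: D_def)
  have left: "v (a - 1) \<notin> D"
  proof -
    \<comment> \<open>The shift by one makes \<open>v a\<close> the vertex \<open>w 1\<close>. Since
      \<open>1 \<le> a\<close>, the index \<open>a - 1\<close> is genuine; \<open>w 0\<close> may be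
      \<open>p2\<close>.\<close>
    define w where "w = (\<lambda>i. v (a - 1 + i))"
    have "\<not> reach adj (U - {w 1, u, w (b - a + 1)}) (w 0) (w 2)"
    proof (rule sep)
      show "inj_on w {..b - a + 1}"
        using ab veq by (auto simp: inj_on_def w_def)
      show "adj (w i) (w (Suc i))" if "i < b - a + 1" for i
        using vstep[of "a - 1 + i"] that ab by (simp add: w_def)
    qed (use ab ab2 u vB in \<open>auto simp: w_def\<close>)
    moreover have "w 1 = v a" "w (b - a + 1) = v b" "w 0 = v (a - 1)" "w 2 = v (Suc a)"
      using ab by (simp_all add: w_def)
    ultimately have "\<not> reach adj (U - ?Z) (v (a - 1)) (v (Suc a))"
      by simp
    then show ?thesis
      using reach_sym[OF sym, of "U - ?Z" "v (Suc a)" "v (a - 1)"] by (auto simp: D_def)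
  qed
  have right: "v (Suc b) \<notin> D" if "b < m"
  proof -
    define w where "w = (\<lambda>i. v (Suc b - i))"
    have "\<not> reach adj (U - {w 1, u, w (b - a + 1)}) (w 0) (w 2)"
    proof (rule sep)
      show "inj_on w {..b - a + 1}"
        using ab that veq by (auto simp: inj_on_def w_def)
      show "adj (w i) (w (Suc i))" if "i < b - a + 1" for i
      proof -
        have "adj (v (b - i)) (v (Suc (b - i)))"
          using vstep[of "b - i"] \<open>b < m\<close> by simp
        moreover have "Suc (b - i) = Suc b - i"
          using that by simp
        ultimately show ?thesis
          by (simp add: w_def adj_sym)
      qed
    qed (use ab ab2 u vB that in \<open>auto simp: w_def\<close>)
    moreover have "w 1 = v b" "w (b - a + 1) = v a" "w 0 = v (Suc b)" "w 2 = v (b - 1)"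
      using ab by (simp_all add: w_def)
    moreover have "{v b, u, v a} = ?Z"
      by auto
    ultimately have "\<not> reach adj (U - ?Z) (v (Suc b)) (v (b - 1))"
      by simp
    moreover have "reach adj (U - ?Z) (v (Suc a)) (v (b - 1))"
      by (rule run) (use ab ab2 in auto)
    ultimately have "\<not> reach adj (U - ?Z) (v (Suc a)) (v (Suc b))"
      using reach_sym[OF sym, of "U - ?Z" "v (Suc a)" "v (Suc b)"] reach_trans[of adj "U - ?Z" "v (Suc b)" "v (Suc a)" "v (b - 1)"]
      by blast
    then show ?thesis
      by (simp add: D_def)
  qed
  have p: "p2 \<notin> D" "p1 \<notin> D"
  proof -
    have "reach adj (U - ?Z) (v 0) (v (a - 1))"
      by (rule run) (use ab in arith)+
    then have to0: "reach adj (U - ?Z) p2 (v (a - 1))"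
      using v0 by simp
    show p2: "p2 \<notin> D"
    proof
      assume "p2 \<in> D"
      then have "reach adj (U - ?Z) (v (Suc a)) (v (a - 1))"
        using to0 reach_trans[of adj "U - ?Z" "v (Suc a)" p2 "v (a - 1)"] by (simp add: D_def)
      then show False
        using left vZ[of "a - 1"] ab by (simp add: D_def)
    qed
    show "p1 \<notin> D"
    proof
      assume "p1 \<in> D"
      moreover have "p2 \<in> U - ?Z"
        using vZ[of 0] ab v0 by simp
      moreover have "reach adj (U - ?Z) p1 p2"
        by (rule reach_step) (use calculation pp in \<open>auto simp: D_def\<close>)
      ultimately have "p2 \<in> D"
        using reach_trans[of adj "U - ?Z" "v (Suc a)" p1 p2] by (simp add: D_def)
      then show False
        using p2 by simp
    qed
  qed
  have "v (Suc a) \<in> D"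
    by (rule inD) (use ab2 in auto)
  then have D: "D \<subseteq> U" "D \<noteq> {}" "?Z \<subseteq> U - D"
    using vU[of a] vU[of b] ab u by (auto simp: D_def)
  obtain \<phi> where "col (U - D) L \<phi>" "\<forall>\<psi>. col (?Z \<union> D) L \<psi> \<longrightarrow> (\<exists>z\<in>?Z. \<psi> z \<noteq> \<phi> z)"
    using cut[OF D(1,2) p(2,1) D(3) cut_component[OF D_def]] by blast
  then have "region a b u D \<phi>"
    unfolding region_def using ab ab2 u D p inD left right by blast
  then show ?thesis
    by (rule that)
qed

text \<open>Deleting from \<open>v a\<close> keeps \<open>u\<close>, \<open>v b\<close> as the
  precoloured edge; \<open>region_right\<close> is the mirror image. Which one applies depends on
  the end from which a stopping colour can be reached.\<close>

lemma region_left: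
  fixes \<kappa> :: "nat \<Rightarrow> int"
  assumes r: "region a b u D \<phi>" and j: "a \<le> j" "j < b" and \<kappa>a: "\<kappa> a = \<phi> (v a)"
    and \<kappa>L: "\<And>i. a < i \<Longrightarrow> i \<le> j \<Longrightarrow> \<kappa> i \<in> L (v i)" and \<kappa>s: "\<And>i. a \<le> i \<Longrightarrow> i < j \<Longrightarrow> \<kappa> i \<noteq> \<kappa> (Suc i)"
    and stop: "if Suc j < b then \<kappa> j \<notin> L (v (Suc j)) else \<kappa> j \<noteq> \<phi> (v b)"
    and harmless: "\<And>i k. a \<le> i \<Longrightarrow> i < k \<Longrightarrow> k \<le> j \<Longrightarrow> pair i k \<Longrightarrow> \<kappa> i = \<kappa> k"
    and uok: "\<And>i. a < i \<Longrightarrow> i \<le> j \<Longrightarrow> adj u (v i) \<Longrightarrow> \<kappa> i \<noteq> \<phi> u"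
  shows False
proof -
  note r' = r[unfolded region_def]
  have ord: "1 \<le> a" "Suc a < b" "b \<le> m" and inD: "\<And>i. a < i \<Longrightarrow> i < b \<Longrightarrow> v i \<in> D"
    and out: "p1 \<notin> D" "v (a - 1) \<notin> D" "b < m \<Longrightarrow> v (Suc b) \<notin> D"
    using r' by blast+
  define w where "w = (\<lambda>i. v (a + i))"
  have ends: "w 0 = v a" "w (b - a) = v b"
    using ord by (simp_all add: w_def)
  show False
  proof (rule region_delete[where D = D and \<phi> = \<phi> and w = w and u = u and n = "b - a" and \<kappa> = "\<lambda>i. \<kappa> (a + i)" and j = "j - a"])
    show "D \<subseteq> U" "p1 \<notin> D" "p2 \<notin> D" "{w 0, u, w (b - a)} \<subseteq> U - D" "col (U - D) L \<phi>"
      "u \<notin> Bd" "adj u (w 0)" "adj u (w (b - a))"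
      using r' unfolding ends by blast+
    show "\<exists>z\<in>{w 0, u, w (b - a)}. \<psi> z \<noteq> \<phi> z" if "col ({w 0, u, w (b - a)} \<union> D) L \<psi>" for \<psi>
      using r' that unfolding ends by blast
    show "w i \<in> Bd" if "i \<le> b - a" for i
      using vB[of "a + i"] that ord by (simp add: w_def)
    show "inj_on w {..b - a}"
      using ord veq by (auto simp: inj_on_def w_def)
    show "adj (w i) (w (Suc i))" if "i < b - a" for i
      using vstep[of "a + i"] that ord by (simp add: w_def)
    show "w i \<in> D" if "0 < i" "i < b - a" for i
      using inD that ord by (simp add: w_def)
    show "x = w (Suc i) \<or> 0 < i \<and> x = w (i - 1)" if i: "i < b - a" "x \<in> D" "x \<in> Bd" "adj (w i) x" for i x
    proof -
      have "x \<noteq> p1" "x \<noteq> v (a - 1)"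
        using i(2) out by auto
      then show ?thesis
        using vnbrs[of "a + i" x] i ord by (cases "i = 0") (auto simp: w_def)
    qed
    show "k = Suc i \<or> i = Suc k" if "i \<le> b - a" "k \<le> b - a" "adj (w i) (w k)" for i k
      using vadj[of "a + i" "a + k"] that ord by (simp add: w_def)
    show "j - a < b - a" "\<kappa> (a + 0) = \<phi> (w 0)"
      using j \<kappa>a by (simp_all add: ends)
    show "\<kappa> (a + i) \<in> L (w i)" if "0 < i" "i \<le> j - a" for i
      using \<kappa>L[of "a + i"] that j by (simp add: w_def)
    show "\<kappa> (a + i) \<noteq> \<kappa> (a + Suc i)" if "i < j - a" for i
      using \<kappa>s[of "a + i"] that j by simp
    have *: "Suc (j - a) < b - a \<longleftrightarrow> Suc j < b" "a + (j - a) = j" "a + Suc (j - a) = Suc j"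
      using j by auto
    show "if Suc (j - a) < b - a then \<kappa> (a + (j - a)) \<notin> L (w (Suc (j - a))) else \<kappa> (a + (j - a)) \<noteq> \<phi> (w (b - a))"
      using stop unfolding ends unfolding w_def * .
    show "\<kappa> (a + i) = \<kappa> (a + k)" if x: "x \<in> U - Bd" "i \<le> j - a" "k \<le> j - a" "adj x (w i)" "adj x (w k)" for x i k
    proof -
      have "pair (a + i) (a + k)"
        unfolding pair_def using x(1,4,5) unfolding w_def by blast
      show ?thesis
      proof (cases i k rule: linorder_cases)
        case less
        then show ?thesis
          using harmless[of "a + i" "a + k"] x(3) j \<open>pair (a + i) (a + k)\<close> by simp
      next
        case greater
        then have "\<kappa> (a + k) = \<kappa> (a + i)"
          using harmless[of "a + k" "a + i"] x(2) j pair_sym[OF \<open>pair (a + i) (a + k)\<close>] by simp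
        then show ?thesis
          by simp
      qed simp
    qed
    show "\<kappa> (a + i) \<noteq> \<phi> u" if "0 < i" "i \<le> j - a" "adj u (w i)" for i
      using uok[of "a + i"] that j by (simp add: w_def)
  qed
qed

lemma region_right:
  fixes \<kappa> :: "nat \<Rightarrow> int"
  assumes r: "region a b u D \<phi>" and j: "a < j" "j \<le> b" and \<kappa>b: "\<kappa> b = \<phi> (v b)"
    and \<kappa>L: "\<And>i. j \<le> i \<Longrightarrow> i < b \<Longrightarrow> \<kappa> i \<in> L (v i)" and \<kappa>s: "\<And>i. j \<le> i \<Longrightarrow> i < b \<Longrightarrow> \<kappa> i \<noteq> \<kappa> (Suc i)"
    and stop: "if Suc a < j then \<kappa> j \<notin> L (v (j - 1)) else \<kappa> j \<noteq> \<phi> (v a)"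
    and harmless: "\<And>i k. j \<le> i \<Longrightarrow> i < k \<Longrightarrow> k \<le> b \<Longrightarrow> pair i k \<Longrightarrow> \<kappa> i = \<kappa> k"
    and uok: "\<And>i. j \<le> i \<Longrightarrow> i < b \<Longrightarrow> adj u (v i) \<Longrightarrow> \<kappa> i \<noteq> \<phi> u"
  shows False
proof -
  note r' = r[unfolded region_def]
  have ord: "1 \<le> a" "Suc a < b" "b \<le> m" and inD: "\<And>i. a < i \<Longrightarrow> i < b \<Longrightarrow> v i \<in> D"
    and out: "p1 \<notin> D" "v (a - 1) \<notin> D" "b < m \<Longrightarrow> v (Suc b) \<notin> D"
    using r' by blast+
  define w where "w = (\<lambda>i. v (b - i))"
  have ends: "w 0 = v b" "w (b - a) = v a"
    using ord by (simp_all add: w_def)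
  have Z: "{v b, u, v a} = {v a, u, v b}"
    by auto
  show False
  proof (rule region_delete[where D = D and \<phi> = \<phi> and w = w and u = u and n = "b - a" and \<kappa> = "\<lambda>i. \<kappa> (b - i)" and j = "b - j"])
    show "D \<subseteq> U" "p1 \<notin> D" "p2 \<notin> D" "{w 0, u, w (b - a)} \<subseteq> U - D" "col (U - D) L \<phi>"
      "u \<notin> Bd" "adj u (w 0)" "adj u (w (b - a))"
      using r' unfolding ends by blast+
    show "\<exists>z\<in>{w 0, u, w (b - a)}. \<psi> z \<noteq> \<phi> z" if "col ({w 0, u, w (b - a)} \<union> D) L \<psi>" for \<psi>
      using r' that unfolding ends Z by blast
    show "w i \<in> Bd" if "i \<le> b - a" for i
      using vB[of "b - i"] that ord by (simp add: w_def)
    show "inj_on w {..b - a}"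
      using ord veq by (auto simp: inj_on_def w_def)
    show "adj (w i) (w (Suc i))" if "i < b - a" for i
    proof -
      have "Suc (b - Suc i) = b - i"
        using that by simp
      then show ?thesis
        using vstep[of "b - Suc i"] that ord by (simp add: w_def adj_sym)
    qed
    show "w i \<in> D" if "0 < i" "i < b - a" for i
      using inD that ord by (simp add: w_def)
    show "x = w (Suc i) \<or> 0 < i \<and> x = w (i - 1)" if i: "i < b - a" "x \<in> D" "x \<in> Bd" "adj (w i) x" for i x
    proof -
      have "x \<noteq> p1" "b < m \<Longrightarrow> x \<noteq> v (Suc b)"
        using i(2) out by auto
      moreover have "b - i - 1 = b - Suc i" "0 < i \<Longrightarrow> Suc (b - i) = b - (i - 1)" "i = 0 \<or> b - i < m"
        using i(1) ord by auto
      ultimately show ?thesis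
        using vnbrs[of "b - i" x] i ord by (cases "i = 0") (auto simp: w_def)
    qed
    show "k = Suc i \<or> i = Suc k" if "i \<le> b - a" "k \<le> b - a" "adj (w i) (w k)" for i k
    proof -
      have "b - k = Suc (b - i) \<or> b - i = Suc (b - k)"
        using vadj[of "b - i" "b - k"] that(3) ord(3) by (simp add: w_def)
      then show ?thesis
        using that(1,2) ord by arith
    qed
    show "b - j < b - a" "\<kappa> (b - 0) = \<phi> (w 0)"
      using j \<kappa>b by (simp_all add: ends)
    show "\<kappa> (b - i) \<in> L (w i)" if "0 < i" "i \<le> b - j" for i
      using \<kappa>L[of "b - i"] that j by (simp add: w_def)
    show "\<kappa> (b - i) \<noteq> \<kappa> (b - Suc i)" if "i < b - j" for i
    proof -
      have "Suc (b - Suc i) = b - i" "j \<le> b - Suc i" "b - Suc i < b"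
        using that j by arith+
      then show ?thesis
        using \<kappa>s[of "b - Suc i"] by auto
    qed
    have *: "Suc (b - j) < b - a \<longleftrightarrow> Suc a < j" "b - (b - j) = j" "b - Suc (b - j) = j - 1"
      using j by auto
    show "if Suc (b - j) < b - a then \<kappa> (b - (b - j)) \<notin> L (w (Suc (b - j))) else \<kappa> (b - (b - j)) \<noteq> \<phi> (w (b - a))"
      using stop unfolding ends unfolding w_def * .
    show "\<kappa> (b - i) = \<kappa> (b - k)" if x: "x \<in> U - Bd" "i \<le> b - j" "k \<le> b - j" "adj x (w i)" "adj x (w k)" for x i k
    proof -
      have "pair (b - i) (b - k)"
        unfolding pair_def using x(1,4,5) unfolding w_def by blast
      show ?thesis
      proof (cases i k rule: linorder_cases)
        case greater
        then have "b - i < b - k" "j \<le> b - i"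
          using x(2) j by arith+
        then show ?thesis
          using harmless[of "b - i" "b - k"] \<open>pair (b - i) (b - k)\<close> by simp
      next
        case less
        then have "b - k < b - i" "j \<le> b - k"
          using x(3) j by arith+
        then have "\<kappa> (b - k) = \<kappa> (b - i)"
          using harmless[of "b - k" "b - i"] pair_sym[OF \<open>pair (b - i) (b - k)\<close>] by simp
        then show ?thesis
          by simp
      qed simp
    qed
    show "\<kappa> (b - i) \<noteq> \<phi> u" if "0 < i" "i \<le> b - j" "adj u (w i)" for i
      using uok[of "b - i"] that j by (simp add: w_def)
  qed
qed

end

section \<open>Chains and runs\<close>

lemma card_pick: "2 \<le> card (T :: 'b set) \<Longrightarrow> \<exists>y\<in>T. y \<noteq> x"
proof (rule ccontr)
  assume "2 \<le> card T" "\<not> (\<exists>y\<in>T. y \<noteq> x)"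
  then have "T \<subseteq> {x}" "2 \<le> card T"
    by blast+
  then show False
    using card_mono[of "{x}" T] by simp
qed

lemma card_pick2: "3 \<le> card (T :: 'b set) \<Longrightarrow> \<exists>y\<in>T. y \<noteq> x \<and> y \<noteq> z"
proof (rule ccontr)
  assume "3 \<le> card T" "\<not> (\<exists>y\<in>T. y \<noteq> x \<and> y \<noteq> z)"
  then have "T \<subseteq> {x, z}" "3 \<le> card T"
    by blast+
  then show False
    using card_mono[of "{x, z}" T] by (cases "x = z") simp_all
qed

lemma card_lt_diff: "card A < card (T :: 'b set) \<Longrightarrow> finite A \<Longrightarrow> \<exists>y\<in>T. y \<notin> A"
  using card_mono[of A T] by (meson not_le subsetI)

context opath
begin

lemma v_adj_p1: "\<not> adj (v 1) p1"
  using vstep[of 0] m1 v0 pp tri[of p1 p2 "v 1"] adj_sym by auto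

lemma size_v: "1 \<le> i \<Longrightarrow> i \<le> m \<Longrightarrow> card (L (v i)) = (if v i \<in> X then 2 else 3)"
proof -
  assume i: "1 \<le> i" "i \<le> m"
  have "v i \<noteq> p1" "v i \<noteq> p2"
    using vp i veq[of i 0] v0 by auto
  then show ?thesis
    using size[of "v i"] vU[OF i(2)] vB[OF i(2)] by (simp add: need_def)
qed

lemma fin_v: "1 \<le> i \<Longrightarrow> i \<le> m \<Longrightarrow> finite (L (v i))"
  using size_v[of i] by (metis card.infinite numeral_eq_iff zero_neq_numeral)

lemma X_alt: "i < m \<Longrightarrow> v i \<in> X \<Longrightarrow> v (Suc i) \<notin> X"
  using vstep indep by blast

text \<open>The chain starts at \<open>v s\<close>, the first boundary vertex after \<open>p2\<close> that is not in \<open>X\<close>; its predecessor has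
  the forced colour \<open>q\<close>, so the two colours \<open>A\<close> remain for it.\<close>

definition s :: nat where
  "s = (if v 1 \<in> X then 2 else 1)"

definition q :: int where
  "q = (if v 1 \<in> X then (SOME c. c \<in> L (v 1) \<and> c \<noteq> c2) else c2)"

definition A :: "int set" where
  "A = L (v s) - {q}"

text \<open>\<open>v 1\<close> has two colours, one of them \<open>c2\<close>, so \<open>q\<close>
  is forced. If \<open>m = 1\<close> or \<open>q\<close> were missing from the list of
  \<open>v 2\<close>, deleting \<open>v 1\<close> alone would succeed.\<close>

lemma v1X:
  assumes "v 1 \<in> X"
  shows "L (v 1) = {q, c2}" "q \<noteq> c2" "2 \<le> m" "q \<in> L (v 2)"
proof -
  have c: "card (L (v 1)) = 2"
    using size_v[of 1] m1 assms by simp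
  then have "\<exists>c. c \<in> L (v 1) \<and> c \<noteq> c2"
    using card_pick[of "L (v 1)" c2] by auto
  then have q: "q \<in> L (v 1)" "q \<noteq> c2"
    using someI_ex[of "\<lambda>c. c \<in> L (v 1) \<and> c \<noteq> c2"] assms by (simp_all add: q_def)
  then show "q \<noteq> c2"
    by simp
  have "{q, c2} \<subseteq> L (v 1)" "finite (L (v 1))"
    using q c2L fin_v[of 1] m1 by auto
  then show "L (v 1) = {q, c2}"
    using card_subset_eq[of "L (v 1)" "{q, c2}"] c q(2) by simp
  have "1 < m \<and> q \<in> L (v (Suc 1))"
  proof (rule ccontr)
    assume *: "\<not> (1 < m \<and> q \<in> L (v (Suc 1)))"
    show False
      by (rule prefix_delete[of 1 "\<lambda>_. q"]) (use m1 q * v_adj_p1 in auto)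
  qed
  then show "2 \<le> m" "q \<in> L (v 2)"
    by (simp_all add: numeral_2_eq_2)
qed

lemma s_le: "1 \<le> s" "s \<le> 2" "s \<le> m"
  using v1X(3) m1 by (simp_all add: s_def)

lemma s_notX: "v s \<notin> X"
  using X_alt[of 1] v1X(3) by (auto simp: s_def numeral_2_eq_2)

lemma q_in: "q \<in> L (v s)"
  using v1X(4) c2L by (auto simp: s_def q_def)

lemma card_A: "card A = 2" "q \<notin> A" "A \<subseteq> L (v s)" "finite A"
proof -
  have "card (L (v s)) = 3" "finite (L (v s))"
    using size_v[OF s_le(1,3)] s_notX fin_v[OF s_le(1,3)] by simp_all
  then show "card A = 2" "q \<notin> A" "A \<subseteq> L (v s)" "finite A"
    using q_in by (auto simp: A_def)
qed

definition oth :: "int \<Rightarrow> int" where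
  "oth c = (SOME x. x \<in> A \<and> x \<noteq> c)"

lemma oth: "oth c \<in> A" "oth c \<noteq> c"
proof -
  have "\<exists>x. x \<in> A \<and> x \<noteq> c"
    using card_pick[of A c] card_A(1) by auto
  then show "oth c \<in> A" "oth c \<noteq> c"
    using someI_ex[of "\<lambda>x. x \<in> A \<and> x \<noteq> c"] by (simp_all add: oth_def)
qed

lemma oth_oth: "c \<in> A \<Longrightarrow> oth (oth c) = c"
proof (rule ccontr)
  assume c: "c \<in> A" "oth (oth c) \<noteq> c"
  then have "card {c, oth c, oth (oth c)} = 3" "{c, oth c, oth (oth c)} \<subseteq> A"
    using oth[of c] oth[of "oth c"] by auto
  then show False
    using card_mono[OF card_A(4), of "{c, oth c, oth (oth c)}"] card_A(1) by simp
qed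


definition chain :: "nat \<Rightarrow> bool" where
  "chain i \<longleftrightarrow> (\<forall>k. s \<le> k \<longrightarrow> k \<le> i \<longrightarrow>
     (even (k - s) \<longrightarrow> v k \<notin> X \<and> A \<subseteq> L (v k)) \<and> (odd (k - s) \<longrightarrow> v k \<in> X \<and> L (v k) = A))"

text \<open>\<open>c\<close> is the colour at \<open>v s\<close>. Among the positive indices only 1
  can lie below \<open>s\<close>, and its colour \<open>q\<close> is forced.\<close>

definition alt :: "int \<Rightarrow> nat \<Rightarrow> int" where
  "alt c k = (if k < s then q else if even (k - s) then c else oth c)"

lemma chain_s: "chain s"
  using s_notX card_A(3) by (auto simp: chain_def dest: le_antisym)

lemma chain_even: "chain e \<Longrightarrow> s \<le> k \<Longrightarrow> k \<le> e \<Longrightarrow> even (k - s) \<Longrightarrow> v k \<notin> X \<and> A \<subseteq> L (v k)"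
  by (simp add: chain_def)

lemma chain_odd: "chain e \<Longrightarrow> s \<le> k \<Longrightarrow> k \<le> e \<Longrightarrow> odd (k - s) \<Longrightarrow> v k \<in> X \<and> L (v k) = A"
  by (simp add: chain_def)

lemma alt_A: "c \<in> A \<Longrightarrow> s \<le> k \<Longrightarrow> alt c k \<in> A"
  using oth by (simp add: alt_def)

lemma before_s: "1 \<le> k \<Longrightarrow> k < s \<Longrightarrow> k = 1 \<and> s = 2 \<and> v 1 \<in> X"
  by (auto simp: s_def split: if_splits)

lemma alt_L:
  assumes "chain e" "c \<in> A" "1 \<le> k" "k \<le> e"
  shows "alt c k \<in> L (v k)"
proof (cases "k < s")
  case True
  then show ?thesis
    using before_s[OF assms(3)] v1X(1) by (auto simp: alt_def)
next
  case False
  then show ?thesis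
    using alt_A[OF assms(2), of k] chain_even[OF assms(1), of k] chain_odd[OF assms(1), of k] assms(4) by auto
qed

lemma alt_proper:
  assumes "c \<in> A" "1 \<le> k"
  shows "alt c k \<noteq> alt c (Suc k)"
proof (cases "k < s")
  case True
  then have "alt c k = q" "alt c (Suc k) \<in> A"
    using before_s[OF assms(2)] alt_A[OF assms(1), of "Suc k"] by (auto simp: alt_def)
  then show ?thesis
    using card_A(2) by auto
next
  case False
  then have "even (Suc k - s) \<longleftrightarrow> odd (k - s)"
    by (simp add: Suc_diff_le)
  then show ?thesis
    using False oth(2)[of c] by (auto simp: alt_def)
qed

lemma alt_1: "c \<in> A \<Longrightarrow> alt c 1 \<noteq> c2"
proof (cases "v 1 \<in> X")
  case True
  then show ?thesis
    using v1X(2) by (simp add: alt_def s_def)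
next
  case False
  then have "s = 1" "q = c2"
    by (simp_all add: s_def q_def)
  then show "c \<in> A \<Longrightarrow> ?thesis"
    using alt_A[of c 1] card_A(2) by auto
qed

lemma alt_same: "s \<le> i \<Longrightarrow> i \<le> k \<Longrightarrow> even (k - i) \<Longrightarrow> alt c i = alt c k"
proof -
  assume *: "s \<le> i" "i \<le> k" "even (k - i)"
  then have "k - s = (k - i) + (i - s)"
    by simp
  then have "even (k - s) \<longleftrightarrow> even (i - s)"
    using *(3) by simp
  then show ?thesis
    using * by (simp add: alt_def)
qed

lemma outside_A: "1 \<le> k \<Longrightarrow> k \<le> m \<Longrightarrow> v k \<notin> X \<Longrightarrow> \<exists>c\<in>L (v k). c \<notin> A"
  using card_lt_diff[of A "L (v k)"] size_v[of k] card_A(1,4) by simp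

lemma region_colours:
  assumes "region a b u D \<phi>"
  shows "\<phi> (v a) \<in> L (v a)" "\<phi> (v b) \<in> L (v b)"
  using assms by (auto simp: region_def col_def)

text \<open>\<open>p2\<close> lies outside \<open>D\<close>, so \<open>\<phi>\<close> gives it
  \<open>c2\<close> and leaves only \<open>q\<close> for its neighbour \<open>v 1\<close>.\<close>

lemma region_v1:
  assumes "region 1 b u D \<phi>" "v 1 \<in> X"
  shows "\<phi> (v 1) = q"
proof -
  have "v 1 \<in> U - D" "p2 \<in> U - D" "col (U - D) L \<phi>"
    using assms(1) pU by (auto simp: region_def)
  moreover have "adj (v 1) p2"
    using vstep[of 0] v0 m1 adj_sym by auto
  ultimately have "\<phi> (v 1) \<in> L (v 1)" "\<phi> (v 1) \<noteq> \<phi> p2" "\<phi> p2 \<in> L p2"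
    by (auto simp: col_def)
  then show ?thesis
    using v1X(1)[OF assms(2)] Lp by auto
qed

lemma not_pair_Suc: "Suc i \<le> m \<Longrightarrow> \<not> pair i (Suc i)"
  using pair_far[of i "Suc i"] by auto

text \<open>If an interior vertex sees both colours of the chain, one of its two neighbours on the chain is in \<open>X\<close>;
  the chain vertex next to that one gets its third colour, which is in no list of a chain vertex in \<open>X\<close>.\<close>

lemma chain_pairs:
  assumes e: "chain e" "e \<le> m" and ik: "s \<le> i" "i < k" "k \<le> e" and pr: "pair i k"
  shows "even (k - i)"
proof (rule ccontr)
  assume odd: "odd (k - i)"
  obtain u where u: "u \<in> U - Bd" "adj u (v i)" "adj u (v k)"
    using pr by (auto simp: pair_def)
  have km: "k \<le> m" "1 \<le> i"
    using ik e s_le by auto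
  obtain D \<phi> where r: "region i k u D \<phi>"
    using region_exists[OF km(2) ik(2) km(1) u] .
  have far: "Suc i < k"
    using pair_far[OF pr ik(2) km(1)] .
  \<comment> \<open>By parity the distance is at least 3, so two steps inward from either end is
    still strictly inside the region.\<close>
  have far2: "Suc (Suc i) < k"
  proof (rule ccontr)
    assume "\<not> Suc (Suc i) < k"
    then have "k = Suc (Suc i)"
      using far by simp
    then show False
      using odd by simp
  qed
  have ks: "k - s = (k - i) + (i - s)"
    using ik by simp
  have kpar: "odd (k - s) \<longleftrightarrow> even (i - s)"
    unfolding ks using odd by (simp only: even_add) blast
  have uadj: "\<not> adj u (v l)" if "l \<le> m" "Suc l = k \<or> l = Suc i" for l
  proof
    assume "adj u (v l)"
    then have "pair l k" "pair i l"
      unfolding pair_def using u by blast+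
    then show False
      using that not_pair_Suc[of l] not_pair_Suc[of i] km(1) by auto
  qed
  show False
  proof (cases "even (i - s)")
    case True
    \<comment> \<open>Here \<open>v k\<close> is in \<open>X\<close> and has a colour of
      \<open>A\<close>, so the colour \<open>g\<close> outside \<open>A\<close> is allowed at
      \<open>v (k - 1)\<close>. The deletion can stop there, since the list of
      \<open>v (k - 2)\<close> is \<open>A\<close>.\<close>
    have kX: "L (v k) = A"
      using chain_odd[OF e(1), of k] ik kpar True by simp
    have par: "even (k - 1 - s)" "odd (k - 2 - s)"
    proof -
      have "k - s = Suc (k - 1 - s)" "k - 1 - s = Suc (k - 2 - s)"
        using far2 ik by arith+
      moreover have "odd (k - s)"
        using kpar True by simp
      ultimately show "even (k - 1 - s)" "odd (k - 2 - s)"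
        by (simp_all only: even_Suc not_not simp_thms)
    qed
    have bds: "s \<le> k - 1" "k - 1 \<le> e" "s \<le> k - 2" "k - 2 \<le> e" "1 \<le> k - 1" "k - 1 \<le> m" "Suc (k - 1) = k" "k - 1 - 1 = k - 2"
      using far2 ik km by arith+
    obtain g where g: "g \<in> L (v (k - 1))" "g \<notin> A"
      using outside_A[OF bds(5,6)] chain_even[OF e(1) bds(1,2) par(1)] by blast
    define \<kappa> where "\<kappa> = (\<lambda>l. if l = k then \<phi> (v k) else g)"
    show False
    proof (rule region_right[OF r, of "k - 1" \<kappa>])
      show "i < k - 1" "k - 1 \<le> k"
        using far by arith+
      show "\<kappa> k = \<phi> (v k)"
        by (simp add: \<kappa>_def)
      show "\<kappa> l \<in> L (v l)" "\<kappa> l \<noteq> \<kappa> (Suc l)" if "k - 1 \<le> l" "l < k" for l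
      proof -
        have l: "l = k - 1" "l \<noteq> k" "Suc l = k"
          using that by arith+
        then show "\<kappa> l \<in> L (v l)" "\<kappa> l \<noteq> \<kappa> (Suc l)"
          using g region_colours(2)[OF r] kX by (auto simp: \<kappa>_def)
      qed
      have "L (v (k - 1 - 1)) = A"
        using chain_odd[OF e(1) bds(3,4) par(2)] bds(8) by simp
      moreover have "Suc i < k - 1" "\<kappa> (k - 1) = g"
        using far2 by (auto simp: \<kappa>_def)
      ultimately show "if Suc i < k - 1 then \<kappa> (k - 1) \<notin> L (v (k - 1 - 1)) else \<kappa> (k - 1) \<noteq> \<phi> (v i)"
        using g by simp
      show "\<kappa> l = \<kappa> l'" if "k - 1 \<le> l" "l < l'" "l' \<le> k" "pair l l'" for l l'
      proof -
        have "l' = Suc l" "Suc l \<le> m"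
          using that km by arith+
        then show ?thesis
          using not_pair_Suc that(4) by blast
      qed
      show "\<kappa> l \<noteq> \<phi> u" if "k - 1 \<le> l" "l < k" "adj u (v l)" for l
      proof -
        have "l \<le> m" "Suc l = k"
          using that km by arith+
        then show ?thesis
          using uadj that(3) by blast
      qed
    qed
  next
    case False
    \<comment> \<open>The mirror image: now \<open>v i\<close> is in \<open>X\<close>, and
      \<open>g\<close> goes to \<open>v (Suc i)\<close>.\<close>
    have iX: "L (v i) = A"
      using chain_odd[OF e(1), of i] ik False by simp
    have par: "even (Suc i - s)" "odd (Suc (Suc i) - s)"
      using False ik by (simp_all add: Suc_diff_le)
    have bds: "s \<le> Suc i" "Suc i \<le> e" "s \<le> Suc (Suc i)" "Suc (Suc i) \<le> e" "1 \<le> Suc i" "Suc i \<le> m"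
      using far2 ik km by arith+
    obtain g where g: "g \<in> L (v (Suc i))" "g \<notin> A"
      using outside_A[OF bds(5,6)] chain_even[OF e(1) bds(1,2) par(1)] by blast
    define \<kappa> where "\<kappa> = (\<lambda>l. if l = i then \<phi> (v i) else g)"
    show False
    proof (rule region_left[OF r, of "Suc i" \<kappa>])
      show "i \<le> Suc i" "Suc i < k"
        using far by arith+
      show "\<kappa> i = \<phi> (v i)"
        by (simp add: \<kappa>_def)
      show "\<kappa> l \<in> L (v l)" if "i < l" "l \<le> Suc i" for l
      proof -
        have "l = Suc i"
          using that by arith
        then show ?thesis
          using g by (simp add: \<kappa>_def)
      qed
      show "\<kappa> l \<noteq> \<kappa> (Suc l)" if "i \<le> l" "l < Suc i" for l
      proof -
        have "l = i"
          using that by arith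
        then show ?thesis
          using g region_colours(1)[OF r] iX by (auto simp: \<kappa>_def)
      qed
      have "L (v (Suc (Suc i))) = A"
        using chain_odd[OF e(1) bds(3,4) par(2)] by simp
      then show "if Suc (Suc i) < k then \<kappa> (Suc i) \<notin> L (v (Suc (Suc i))) else \<kappa> (Suc i) \<noteq> \<phi> (v k)"
        using g far2 by (simp add: \<kappa>_def)
      show "\<kappa> l = \<kappa> l'" if "i \<le> l" "l < l'" "l' \<le> Suc i" "pair l l'" for l l'
      proof -
        have "l' = Suc l" "Suc l \<le> m"
          using that bds by arith+
        then show ?thesis
          using not_pair_Suc that(4) by blast
      qed
      show "\<kappa> l \<noteq> \<phi> u" if "i < l" "l \<le> Suc i" "adj u (v l)" for l
      proof -
        have "l \<le> m" "l = Suc i"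
          using that bds by arith+
        then show ?thesis
          using uadj that(3) by blast
      qed
    qed
  qed
qed

end

text \<open>The chain ends at \<open>e\<close> and the run at \<open>f\<close>. Their maximality is only used through \<open>stop\<close>: with a
  suitable colour on \<open>v f\<close>, deleting the boundary up to \<open>v f\<close> does no harm to the next boundary vertex.\<close>

locale sweep = opath +
  fixes e f :: nat
  assumes chain: "chain e" and se: "s \<le> e" and ef: "e \<le> f" and fm: "f \<le> m"
    and run: "\<And>k. e < k \<Longrightarrow> k \<le> f \<Longrightarrow> v k \<notin> X" and run0: "e < f \<Longrightarrow> v e \<notin> X"
    and stop: "\<exists>y\<in>(if f = e then A else L (v f)). if f < m then y \<notin> L (v (Suc f)) else adj (v m) p1 \<longrightarrow> y \<noteq> c1"
begin

text \<open>On the chain only \<open>A\<close> is used, to keep the colours alternating; on the run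
  every colour of the list is.\<close>

definition T :: "nat \<Rightarrow> int set" where
  "T k = (if k \<le> e then A else L (v k))"

lemma card_T: "s \<le> k \<Longrightarrow> k \<le> f \<Longrightarrow> 2 \<le> card (T k)"
  using card_A(1) size_v[of k] run[of k] fm s_le(1) by (auto simp: T_def)

text \<open>Colours are chosen backwards from \<open>y\<close>. On the run the predecessor takes any
  different element of \<open>T\<close>, which has at least two; once the chain is reached, one
  colour determines the alternating colouring.\<close>

lemma pattern:
  assumes "s \<le> j" "j \<le> f" "y \<in> T j"
  shows "\<exists>\<kappa> c. c \<in> A \<and> \<kappa> j = y \<and> (\<forall>k. 1 \<le> k \<longrightarrow> k \<le> j \<longrightarrow> \<kappa> k \<in> L (v k)) \<and> \<kappa> 1 \<noteq> c2 \<and>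
    (\<forall>k. 1 \<le> k \<longrightarrow> k < j \<longrightarrow> \<kappa> k \<noteq> \<kappa> (Suc k)) \<and> (\<forall>k. 1 \<le> k \<longrightarrow> k \<le> j \<longrightarrow> k \<le> e \<longrightarrow> \<kappa> k = alt c k)"
  using assms
proof (induction j arbitrary: y)
  case 0
  then show ?case
    using s_le by simp
next
  case (Suc j)
  show ?case
  proof (cases "Suc j \<le> e")
    case True
    define c where "c = (if even (Suc j - s) then y else oth y)"
    have y: "y \<in> A"
      using Suc.prems True by (simp add: T_def)
    then have "c \<in> A" "alt c (Suc j) = y"
      using oth oth_oth Suc.prems(1) by (auto simp: c_def alt_def)
    then show ?thesis
      using alt_L[OF chain, of c] alt_1[of c] alt_proper[of c] True
      by (intro exI[of _ "alt c"] exI[of _ c]) auto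
  next
    case False
    then have j: "e \<le> j" "s \<le> j" "j \<le> f"
      using se Suc.prems by auto
    obtain y' where y': "y' \<in> T j" "y' \<noteq> y"
      using card_pick[OF card_T[OF j(2,3)], of y] by blast
    obtain \<kappa> c where k: "c \<in> A" "\<kappa> j = y'" "\<And>k. 1 \<le> k \<Longrightarrow> k \<le> j \<Longrightarrow> \<kappa> k \<in> L (v k)" "\<kappa> 1 \<noteq> c2"
      "\<And>k. 1 \<le> k \<Longrightarrow> k < j \<Longrightarrow> \<kappa> k \<noteq> \<kappa> (Suc k)" "\<And>k. 1 \<le> k \<Longrightarrow> k \<le> j \<Longrightarrow> k \<le> e \<Longrightarrow> \<kappa> k = alt c k"
      using Suc.IH[OF j(2,3) y'(1)] by blast
    have j1: "1 \<le> j"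
      using j s_le by simp
    show ?thesis
    proof (intro exI[of _ "\<kappa>(Suc j := y)"] exI[of _ c] conjI allI impI)
      show "(\<kappa>(Suc j := y)) 1 \<noteq> c2"
        using k(4) j1 by simp
      fix l :: nat
      assume l: "1 \<le> l"
      show "l \<le> Suc j \<Longrightarrow> (\<kappa>(Suc j := y)) l \<in> L (v l)"
        using k(3)[of l] l Suc.prems(3) False by (cases "l = Suc j") (auto simp: T_def)
      show "l < Suc j \<Longrightarrow> (\<kappa>(Suc j := y)) l \<noteq> (\<kappa>(Suc j := y)) (Suc l)"
        using k(2) k(5)[of l] l y'(2) by (cases "l = j") auto
      show "l \<le> Suc j \<Longrightarrow> l \<le> e \<Longrightarrow> (\<kappa>(Suc j := y)) l = alt c l"
        using k(6)[of l] l False by auto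
    qed (use k(1) in auto)
  qed
qed

text \<open>A run vertex has three colours, so going backwards it can avoid both the colour of its
  successor and \<open>x\<close>, the latter in case \<open>v a\<close> comes next.\<close>

lemma run_path:
  assumes "e \<le> a" "a < j" "j \<le> f" "y \<in> L (v j)" "j = Suc a \<longrightarrow> y \<noteq> x"
  shows "\<exists>\<kappa>. \<kappa> a = x \<and> \<kappa> j = y \<and> (\<forall>k. a < k \<longrightarrow> k \<le> j \<longrightarrow> \<kappa> k \<in> L (v k)) \<and>
    (\<forall>k. a \<le> k \<longrightarrow> k < j \<longrightarrow> \<kappa> k \<noteq> \<kappa> (Suc k))"
  using assms(2-5)
proof (induction j arbitrary: y)
  case (Suc j)
  show ?case
  proof (cases "j = a")
    case True
    then show ?thesis
      using Suc.prems by (intro exI[of _ "(\<lambda>_. x)(Suc a := y)"]) (auto simp: less_Suc_eq_le le_Suc_eq)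
  next
    case False
    then have j: "a < j" "j \<le> f"
      using Suc.prems by auto
    have "card (L (v j)) = 3"
      using size_v[of j] run[of j] j assms(1) fm by auto
    then obtain y' where y': "y' \<in> L (v j)" "y' \<noteq> y" "y' \<noteq> x"
      using card_pick2[of "L (v j)" y x] by auto
    obtain \<kappa> where k: "\<kappa> a = x" "\<kappa> j = y'" "\<And>k. a < k \<Longrightarrow> k \<le> j \<Longrightarrow> \<kappa> k \<in> L (v k)"
      "\<And>k. a \<le> k \<Longrightarrow> k < j \<Longrightarrow> \<kappa> k \<noteq> \<kappa> (Suc k)"
      using Suc.IH[OF j y'(1)] y'(3) by blast
    show ?thesis
    proof (intro exI[of _ "\<kappa>(Suc j := y)"] conjI allI impI)
      fix l :: nat
      show "a < l \<Longrightarrow> l \<le> Suc j \<Longrightarrow> (\<kappa>(Suc j := y)) l \<in> L (v l)"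
        using k(3)[of l] Suc.prems(3) by (cases "l = Suc j") auto
      show "a \<le> l \<Longrightarrow> l < Suc j \<Longrightarrow> (\<kappa>(Suc j := y)) l \<noteq> (\<kappa>(Suc j := y)) (Suc l)"
        using k(2) k(4)[of l] y'(2) by (cases "l = j") auto
    qed (use k j in auto)
  qed
qed simp

text \<open>The pairs about which \<open>chain_pairs\<close> says nothing: the lower end precedes
  the chain or the upper end is beyond it.\<close>

definition bad :: "nat \<Rightarrow> nat \<Rightarrow> bool" where
  "bad i k \<longleftrightarrow> 1 \<le> i \<and> i < k \<and> k \<le> f \<and> pair i k \<and> \<not> (s \<le> i \<and> k \<le> e)"

lemma not_bad_alt: "1 \<le> i \<Longrightarrow> i < k \<Longrightarrow> k \<le> f \<Longrightarrow> pair i k \<Longrightarrow> \<not> bad i k \<Longrightarrow> s \<le> i \<and> k \<le> e \<and> alt c i = alt c k"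
  using chain_pairs[OF chain, of i k] alt_same[of i k c] ef fm by (auto simp: bad_def)

text \<open>Without bad pairs, every common interior neighbour sees one colour of the
  \<open>pattern\<close>, and \<open>stop\<close> lets the whole prefix up to \<open>v f\<close> be
  deleted.\<close>

lemma some_bad: "\<exists>i k. bad i k"
proof (rule ccontr)
  assume nb: "\<not> (\<exists>i k. bad i k)"
  obtain y where y: "y \<in> T f" "if f < m then y \<notin> L (v (Suc f)) else adj (v m) p1 \<longrightarrow> y \<noteq> c1"
    using stop ef by (auto simp: T_def split: if_splits)
  obtain \<kappa> c where k: "c \<in> A" "\<kappa> f = y" "\<And>k. 1 \<le> k \<Longrightarrow> k \<le> f \<Longrightarrow> \<kappa> k \<in> L (v k)" "\<kappa> 1 \<noteq> c2"
    "\<And>k. 1 \<le> k \<Longrightarrow> k < f \<Longrightarrow> \<kappa> k \<noteq> \<kappa> (Suc k)" "\<And>k. 1 \<le> k \<Longrightarrow> k \<le> f \<Longrightarrow> k \<le> e \<Longrightarrow> \<kappa> k = alt c k"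
    using pattern[OF order_trans[OF se ef] order.refl y(1)] by blast
  have f1: "1 \<le> f"
    using s_le se ef by simp
  show False
  proof (rule prefix_delete[OF f1 fm k(3) k(4) k(5)])
    show "if f < m then \<kappa> f \<notin> L (v (Suc f)) else adj (v m) p1 \<longrightarrow> \<kappa> m \<noteq> c1"
      using y(2) k(2) fm by auto
    show "\<kappa> i = \<kappa> l" if "1 \<le> i" "i < l" "l \<le> f" "pair i l" for i l
    proof -
      have "s \<le> i \<and> l \<le> e \<and> alt c i = alt c l"
        using not_bad_alt[OF that] nb by blast
      then show ?thesis
        using k(6)[of i] k(6)[of l] that by simp
    qed
  qed auto
qed

text \<open>Minimality of \<open>b\<close> makes all pairs below \<open>b\<close> harmless, and
  maximality of \<open>a\<close> keeps \<open>u\<close> from seeing run or chain vertices between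
  \<open>v a\<close> and a \<open>v b\<close> on the run. What remains is to find, in the region of
  this pair, an end from which a deletion can stop.\<close>

lemma bad_False:
  assumes ab: "bad a b" and minb: "\<And>i k. k < b \<Longrightarrow> \<not> bad i k" and maxa: "\<And>i. a < i \<Longrightarrow> \<not> bad i b"
  shows False
proof -
  obtain u where u: "u \<in> U - Bd" "adj u (v a)" "adj u (v b)"
    using ab by (auto simp: bad_def pair_def)
  have a1: "1 \<le> a" and a_b: "a < b" and bf: "b \<le> f" and bm: "b \<le> m" and pr: "pair a b" and nse: "\<not> (s \<le> a \<and> b \<le> e)"
    using ab fm by (auto simp: bad_def)
  obtain D \<phi> where r: "region a b u D \<phi>"
    using region_exists[OF a1 a_b bm u] .
  have far: "Suc a < b"
    using pair_far[OF pr a_b bm] .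
  have good: "s \<le> i \<and> k \<le> e \<and> alt c i = alt c k" if "1 \<le> i" "i < k" "k < b" "pair i k" for i k c
    using not_bad_alt[of i k c] that minb[of k i] bf by simp
  have upair: "pair i b" if "adj u (v i)" for i
    using that u by (auto simp: pair_def)
  have upair': "pair a i" if "adj u (v i)" for i
    using that u by (auto simp: pair_def)
  have uadj: "b \<le> e \<and> s \<le> i" if "adj u (v i)" "a < i" "i < b" for i
    using maxa[OF that(2)] upair[OF that(1)] that a1 bf by (auto simp: bad_def)
  show False
  proof (cases "a < s")
    case True
    \<comment> \<open>The lower end is \<open>v 1\<close> in \<open>X\<close>, where
      \<open>\<phi>\<close> must use \<open>q\<close> just as every \<open>pattern\<close> does. So
      the whole stretch is deleted, with \<open>y\<close> chosen to differ from the colour of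
      \<open>v b\<close>.\<close>
    then have a: "a = 1" "s = 2" "v 1 \<in> X"
      using before_s[OF a1] by auto
    have sb: "s \<le> b - 1" "b - 1 \<le> f" "Suc (b - 1) = b" "b - 1 < b" "a \<le> b - 1"
      using far a bf by arith+
    obtain y where y: "y \<in> T (b - 1)" "y \<noteq> \<phi> (v b)"
      using card_pick[OF card_T[OF sb(1,2)], of "\<phi> (v b)"] by blast
    obtain \<kappa> c where k: "c \<in> A" "\<kappa> (b - 1) = y" "\<And>k. 1 \<le> k \<Longrightarrow> k \<le> b - 1 \<Longrightarrow> \<kappa> k \<in> L (v k)" "\<kappa> 1 \<noteq> c2"
      "\<And>k. 1 \<le> k \<Longrightarrow> k < b - 1 \<Longrightarrow> \<kappa> k \<noteq> \<kappa> (Suc k)" "\<And>k. 1 \<le> k \<Longrightarrow> k \<le> b - 1 \<Longrightarrow> k \<le> e \<Longrightarrow> \<kappa> k = alt c k"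
      using pattern[OF sb(1,2) y(1)] by blast
    show False
    proof (rule region_left[OF r, of "b - 1" \<kappa>])
      have "\<kappa> 1 = q"
        using k(6)[of 1] a se far by (simp add: alt_def)
      then show "\<kappa> a = \<phi> (v a)"
        using region_v1[of b u D \<phi>] r a by simp
      show "if Suc (b - 1) < b then \<kappa> (b - 1) \<notin> L (v (Suc (b - 1))) else \<kappa> (b - 1) \<noteq> \<phi> (v b)"
        using sb(3) k(2) y(2) by simp
      show "\<kappa> i = \<kappa> l" if "a \<le> i" "i < l" "l \<le> b - 1" "pair i l" for i l
      proof -
        have "s \<le> i \<and> l \<le> e \<and> alt c i = alt c l"
          by (rule good) (use that a1 sb in auto)
        then show ?thesis
          using k(6)[of i] k(6)[of l] that a1 by simp
      qed
      show "\<kappa> i \<noteq> \<phi> u" if "a < i" "i \<le> b - 1" "adj u (v i)" for i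
        using minb[of i a] upair'[OF that(3)] that sb bf a a1 by (auto simp: bad_def)
    qed (use k sb a1 in auto)
  next
    case False
    then have sa: "s \<le> a" and be: "e < b"
      using nse by auto
    have eX: "v e \<notin> X"
      using run0 be bf by simp
    have no_u: "\<not> adj u (v i)" if "a < i" "i < b" for i
      using uadj[OF _ that] be by auto
    show False
    proof (cases "e \<le> a")
      case True
      \<comment> \<open>No vertex strictly between is on the chain: three colours at
        \<open>v (b - 1)\<close> suffice to avoid the colours of both \<open>v a\<close> and
        \<open>v b\<close>.\<close>
      have j: "a < b - 1" "b - 1 \<le> f" "Suc (b - 1) = b" "b - 1 < b" "e < b - 1" "1 \<le> b - 1" "b - 1 \<le> m"
        using far bf bm True by arith+
      have "card (L (v (b - 1))) = 3"
        using size_v[OF j(6,7)] run[OF j(5,2)] by simp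
      then obtain y where y: "y \<in> L (v (b - 1))" "y \<noteq> \<phi> (v b)" "y \<noteq> \<phi> (v a)"
        using card_pick2[of "L (v (b - 1))" "\<phi> (v b)" "\<phi> (v a)"] by auto
      obtain \<kappa> where k: "\<kappa> a = \<phi> (v a)" "\<kappa> (b - 1) = y" "\<And>k. a < k \<Longrightarrow> k \<le> b - 1 \<Longrightarrow> \<kappa> k \<in> L (v k)"
        "\<And>k. a \<le> k \<Longrightarrow> k < b - 1 \<Longrightarrow> \<kappa> k \<noteq> \<kappa> (Suc k)"
        using run_path[OF True j(1,2) y(1), of "\<phi> (v a)"] y(3) by blast
      show False
      proof (rule region_left[OF r, of "b - 1" \<kappa>])
        show "if Suc (b - 1) < b then \<kappa> (b - 1) \<notin> L (v (Suc (b - 1))) else \<kappa> (b - 1) \<noteq> \<phi> (v b)"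
          using j(3) k(2) y(2) by simp
        show "\<kappa> i = \<kappa> l" if "a \<le> i" "i < l" "l \<le> b - 1" "pair i l" for i l
        proof -
          have "1 \<le> i" "l < b"
            using that a1 j by auto
          then have "l \<le> e"
            using good[of i l] that by blast
          then show ?thesis
            using that True by simp
        qed
        show "\<kappa> i \<noteq> \<phi> u" if "a < i" "i \<le> b - 1" "adj u (v i)" for i
          using no_u[of i] that j by auto
      qed (use k j in auto)
    next
      case False
      then have ae: "a < e"
        by simp
      have em: "1 \<le> e" "e \<le> m"
        using ae a1 be bm by auto
      have evene: "even (e - s)"
        using chain_odd[OF chain se order.refl] eX by blast
      have e1: "s \<le> e - 1" "e - 1 \<le> e" "odd (e - 1 - s)" "Suc (e - 1) = e"
      proof -
        show "s \<le> e - 1" "e - 1 \<le> e" "Suc (e - 1) = e"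
          using ae sa by arith+
        then have "e - s = Suc (e - 1 - s)"
          by arith
        then show "odd (e - 1 - s)"
          using evene by simp
      qed
      have Le: "L (v (e - 1)) = A"
        using chain_odd[OF chain e1(1-3)] by simp
      \<comment> \<open>The last chain vertex \<open>v e\<close> is not in \<open>X\<close> and so
        has a third colour \<open>g\<close>, which its predecessor, with list \<open>A\<close>,
        cannot lose. With \<open>g\<close> on \<open>v e\<close>, a deletion coming from
        \<open>v b\<close> can stop.\<close>
      obtain g where g: "g \<in> L (v e)" "g \<notin> A"
        using outside_A[OF em eX] by blast
      show False
      proof (cases "Suc e < b \<or> \<phi> (v b) \<noteq> g")
        case True
        have "\<exists>\<kappa>. \<kappa> e = g \<and> \<kappa> b = \<phi> (v b) \<and> (\<forall>k. e \<le> k \<longrightarrow> k < b \<longrightarrow> \<kappa> k \<in> L (v k)) \<and> (\<forall>k. e \<le> k \<longrightarrow> k < b \<longrightarrow> \<kappa> k \<noteq> \<kappa> (Suc k))"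
        proof -
          have "Suc e = b \<longrightarrow> \<phi> (v b) \<noteq> g"
            using True by auto
          then obtain \<kappa> where k: "\<kappa> e = g" "\<kappa> b = \<phi> (v b)" "\<And>k. e < k \<Longrightarrow> k \<le> b \<Longrightarrow> \<kappa> k \<in> L (v k)"
            "\<And>k. e \<le> k \<Longrightarrow> k < b \<Longrightarrow> \<kappa> k \<noteq> \<kappa> (Suc k)"
            using run_path[OF order.refl be bf region_colours(2)[OF r], of g] by auto
          have "\<kappa> k \<in> L (v k)" if "e \<le> k" "k < b" for k
            using k(1) k(3)[of k] that g(1) by (cases "k = e") auto
          then show ?thesis
            using k by blast
        qed
        then obtain \<kappa> where k: "\<kappa> e = g" "\<kappa> b = \<phi> (v b)" "\<And>k. e \<le> k \<Longrightarrow> k < b \<Longrightarrow> \<kappa> k \<in> L (v k)"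
          "\<And>k. e \<le> k \<Longrightarrow> k < b \<Longrightarrow> \<kappa> k \<noteq> \<kappa> (Suc k)"
          by blast
        show False
        proof (rule region_right[OF r ae _ k(2,3,4)])
          show "if Suc a < e then \<kappa> e \<notin> L (v (e - 1)) else \<kappa> e \<noteq> \<phi> (v a)"
          proof (cases "Suc a < e")
            case False
            then have "a = e - 1"
              using ae by simp
            then have "\<phi> (v a) \<in> A"
              using region_colours(1)[OF r] Le by simp
            then show ?thesis
              using False k(1) g by auto
          qed (use Le g k(1) in simp)
          show "\<kappa> i = \<kappa> l" if "e \<le> i" "i < l" "l \<le> b" "pair i l" for i l
          proof (cases "l = b")
            case True
            then have "bad i b"
              using that em bf be by (simp add: bad_def)
            then show ?thesis
              using maxa[of i] that ae by simp
          next
            case False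
            then have "l \<le> e"
              using good[of i l] that em by simp
            then show ?thesis
              using that by simp
          qed
          show "\<kappa> i \<noteq> \<phi> u" if "e \<le> i" "i < b" "adj u (v i)" for i
            using no_u[of i] that ae by auto
        qed (use be in auto)
      next
        case False
        \<comment> \<open>Now \<open>g\<close> sits on \<open>v b\<close> next to
          \<open>v e\<close>, so every colour of \<open>A\<close> on \<open>v e\<close> is
          compatible with \<open>v b\<close>, and the deletion goes from the left.\<close>
        then have b: "b = Suc e" "\<phi> (v b) = g"
          using be by auto
        show False
        proof (cases "\<phi> (v a) \<in> A")
          case False
          \<comment> \<open>A colour outside \<open>A\<close> shows that \<open>v a\<close> is not
            in \<open>X\<close>, so its successor has list \<open>A\<close> and loses nothing:
            \<open>v a\<close> alone is deleted.\<close>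
          then have "even (a - s)"
            using chain_odd[OF chain sa, of ] ae region_colours(1)[OF r] by auto
          then have "odd (Suc a - s)"
            using sa by (simp add: Suc_diff_le)
          then have La: "L (v (Suc a)) = A"
            using chain_odd[OF chain, of "Suc a"] sa ae by simp
          show False
            by (rule region_left[OF r, of a "\<lambda>_. \<phi> (v a)"]) (use La False far in auto)
        next
          case True
          \<comment> \<open>The colour at \<open>v s\<close> for which the alternating colouring
            agrees with \<open>\<phi>\<close> at \<open>v a\<close>.\<close>
          define c where "c = (if even (a - s) then \<phi> (v a) else oth (\<phi> (v a)))"
          have c: "c \<in> A" "alt c a = \<phi> (v a)"
            using True oth oth_oth sa by (auto simp: c_def alt_def)
          show False
          proof (rule region_left[OF r, of e "alt c"])
            have "alt c e \<in> A"
              by (rule alt_A[OF c(1) se])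
            then show "if Suc e < b then alt c e \<notin> L (v (Suc e)) else alt c e \<noteq> \<phi> (v b)"
              using b g by auto
            show "alt c i \<in> L (v i)" if "a < i" "i \<le> e" for i
              using alt_L[OF chain c(1), of i] that a1 by simp
            show "alt c i \<noteq> alt c (Suc i)" if "a \<le> i" "i < e" for i
              using alt_proper[OF c(1), of i] that a1 by simp
            show "alt c i = alt c l" if "a \<le> i" "i < l" "l \<le> e" "pair i l" for i l
              using good[of i l c] that a1 be by simp
            show "alt c i \<noteq> \<phi> u" if "a < i" "i \<le> e" "adj u (v i)" for i
              using no_u[of i] that be by auto
          qed (use c ae be in auto)
        qed
      qed
    qed
  qed
qed

lemma impossible: False
proof -
  obtain i0 k0 where "bad i0 k0"
    using some_bad by blast
  then have ex: "\<exists>k. \<exists>i. bad i k"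
    by blast
  define b where "b = (LEAST k. \<exists>i. bad i k)"
  have b: "\<exists>i. bad i b" "\<And>i k. k < b \<Longrightarrow> \<not> bad i k"
    using LeastI_ex[OF ex] not_less_Least[of _ "\<lambda>k. \<exists>i. bad i k"] unfolding b_def by blast+
  define a where "a = (GREATEST i. bad i b)"
  have bound: "\<And>i. bad i b \<Longrightarrow> i \<le> b"
    by (auto simp: bad_def)
  have a: "bad a b"
    unfolding a_def using GreatestI_ex_nat[of "\<lambda>i. bad i b" b] b(1) bound by blast
  have "\<not> bad i b" if "a < i" for i
    using Greatest_le_nat[of "\<lambda>i. bad i b" i b] bound that unfolding a_def by (meson not_less)
  then show False
    using bad_False[OF a b(2)] by blast
qed

end

section \<open>The induction\<close>

context opath
begin

text \<open>Maximality of \<open>e\<close> and \<open>f\<close> produces the stopping colour. After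
  a nonempty run the next vertex is in \<open>X\<close> and has fewer colours than
  \<open>v f\<close>. After the bare chain the next list misses a colour of \<open>A\<close>, since
  otherwise the chain or the run could be extended.\<close>

lemma no_opath: False
proof -
  define e where "e = (GREATEST i. s \<le> i \<and> i \<le> m \<and> chain i)"
  have e: "s \<le> e" "e \<le> m" "chain e"
    using GreatestI_nat[of "\<lambda>i. s \<le> i \<and> i \<le> m \<and> chain i" s m] s_le(3) chain_s unfolding e_def by auto
  have emax: "i \<le> e" if "s \<le> i" "i \<le> m" "chain i" for i
    unfolding e_def by (rule Greatest_le_nat[of _ _ m]) (use that in auto)
  define Q where "Q = (\<lambda>i. e \<le> i \<and> i \<le> m \<and> (e < i \<longrightarrow> v e \<notin> X) \<and> (\<forall>k. e < k \<longrightarrow> k \<le> i \<longrightarrow> v k \<notin> X))"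
  define f where "f = (GREATEST i. Q i)"
  have "Q e"
    using e by (simp add: Q_def)
  then have Qf: "Q f"
    unfolding f_def by (rule GreatestI_nat[of _ _ m]) (simp add: Q_def)
  have fmax: "i \<le> f" if "Q i" for i
    unfolding f_def by (rule Greatest_le_nat[of _ _ m]) (use that in \<open>auto simp: Q_def\<close>)
  have e1: "1 \<le> e"
    using e(1) s_le by simp
  have no_chain: "\<not> chain (Suc e)" if "e < m"
    using emax[of "Suc e"] e(1) that by auto
  have extend: "chain (Suc e)" if "even (Suc e - s) \<Longrightarrow> v (Suc e) \<notin> X \<and> A \<subseteq> L (v (Suc e))"
    "odd (Suc e - s) \<Longrightarrow> v (Suc e) \<in> X \<and> L (v (Suc e)) = A"
    unfolding chain_def using e(3) that unfolding chain_def by (metis le_Suc_eq)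
  have par: "even (Suc e - s) \<longleftrightarrow> odd (e - s)"
    using Suc_diff_le[OF e(1)] by simp
  have stop: "\<exists>y\<in>(if f = e then A else L (v f)). if f < m then y \<notin> L (v (Suc f)) else adj (v m) p1 \<longrightarrow> y \<noteq> c1"
  proof (cases "f < m")
    case False
    \<comment> \<open>At the end of the path only \<open>p1\<close> is left to protect, which
      excludes the single colour \<open>c1\<close>.\<close>
    define T where "T = (if f = e then A else L (v f))"
    have "1 \<le> f" "f \<le> m"
      using Qf e1 by (simp_all add: Q_def)
    then have "2 \<le> card T"
      using card_A(1) size_v[of f] by (simp add: T_def)
    then obtain y where "y \<in> T" "y \<noteq> c1"
      using card_pick[of T c1] by blast
    then show ?thesis
      unfolding T_def[symmetric] using False by (intro bexI[of _ y]) simp_all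
  next
    case True
    show ?thesis
    proof (cases "f = e")
      case fe: True
      have em: "e < m"
        using True fe by simp
      have "\<not> A \<subseteq> L (v (Suc e))"
      proof
        assume sub: "A \<subseteq> L (v (Suc e))"
        show False
        proof (cases "v e \<in> X")
          case True
          then have "odd (e - s)"
            using chain_even[OF e(3,1) order.refl] by blast
          moreover have "v (Suc e) \<notin> X"
            by (rule X_alt[OF em True])
          ultimately show False
            using extend par sub no_chain[OF em] by blast
        next
          case False
          have X: "v (Suc e) \<in> X"
          proof (rule ccontr)
            assume "v (Suc e) \<notin> X"
            then have "Q (Suc e)"
              using False em by (auto simp: Q_def le_Suc_eq)
            then show False
              using fmax[of "Suc e"] fe by simp
          qed
          have "even (e - s)"
            using chain_odd[OF e(3,1) order.refl] False by blast
          moreover have "L (v (Suc e)) = A"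
            using card_subset_eq[OF fin_v[of "Suc e"] sub] size_v[of "Suc e"] em X card_A(1) by simp
          ultimately show False
            using extend par X no_chain[OF em] by blast
        qed
      qed
      then show ?thesis
        using True fe by auto
    next
      case False
      then have ef: "e < f"
        using Qf by (simp add: Q_def)
      have "v (Suc f) \<in> X"
      proof (rule ccontr)
        assume "v (Suc f) \<notin> X"
        then have "Q (Suc f)"
          using Qf True ef by (auto simp: Q_def le_Suc_eq)
        then show False
          using fmax[of "Suc f"] by simp
      qed
      moreover have "v f \<notin> X"
        using Qf ef by (simp add: Q_def)
      ultimately have "card (L (v (Suc f))) < card (L (v f))"
        using size_v[of f] size_v[of "Suc f"] True ef by simp
      then show ?thesis
        using card_lt_diff[OF _ fin_v[of "Suc f"], of "L (v f)"] True False by auto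
    qed
  qed
  interpret sweep adj X R U L p1 p2 c1 c2 v m e f
  proof
    show "e \<le> f" "f \<le> m"
      using Qf by (simp_all add: Q_def)
    show "\<And>k. e < k \<Longrightarrow> k \<le> f \<Longrightarrow> v k \<notin> X" "e < f \<Longrightarrow> v e \<notin> X"
      using Qf by (simp_all add: Q_def)
  qed (use e stop in auto)
  show False
    by (rule impossible)
qed

end

section \<open>The boundary path of a minimal counterexample\<close>

context min_inst
begin

text \<open>Maximality replaces a walk around the outer face: beyond \<open>p1\<close>, the last
  vertex has no boundary neighbour off the path.\<close>

lemma longest_path:
  obtains v m where "v 0 = p2" "\<forall>i\<le>m. v i \<in> Bd \<and> v i \<noteq> p1" "inj_on v {..m::nat}" "\<forall>i<m. adj (v i) (v (Suc i))"
    "\<forall>x\<in>Bd. adj (v m) x \<longrightarrow> x \<noteq> p1 \<longrightarrow> (\<exists>i\<le>m. x = v i)"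
proof -
  define Q where "Q = (\<lambda>v m. v 0 = p2 \<and> (\<forall>i\<le>m. v i \<in> Bd \<and> v i \<noteq> p1) \<and> inj_on v {..m::nat} \<and> (\<forall>i<m. adj (v i) (v (Suc i))))"
  have finBd: "finite Bd"
    using fin by (simp add: nb_def)
  have bound: "m \<le> card Bd" if "Q v m" for v m
  proof -
    have "card (v ` {..m}) = Suc m"
      using that by (simp add: Q_def card_image)
    moreover have "card (v ` {..m}) \<le> card Bd"
      by (rule card_mono[OF finBd]) (use that in \<open>auto simp: Q_def\<close>)
    ultimately show ?thesis
      by simp
  qed
  have "p1 \<noteq> p2"
    using pp adj_irrefl by auto
  then have "Q (\<lambda>_. p2) 0"
    using pO by (auto simp: Q_def)
  then have ex: "\<exists>v. Q v 0"
    by blast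
  define m where "m = (GREATEST m. \<exists>v. Q v m)"
  have "\<exists>v. Q v m"
    unfolding m_def using GreatestI_nat[of "\<lambda>m. \<exists>v. Q v m" 0 "card Bd"] ex bound by blast
  then obtain v where v: "Q v m"
    by blast
  have max: "k \<le> m" if "Q w k" for w k
    unfolding m_def by (rule Greatest_le_nat[of _ _ "card Bd"]) (use that bound in blast)+
  show ?thesis
  proof (rule that[of v m])
    show "\<forall>x\<in>Bd. adj (v m) x \<longrightarrow> x \<noteq> p1 \<longrightarrow> (\<exists>i\<le>m. x = v i)"
    proof (intro ballI impI, rule ccontr)
      fix x
      assume x: "x \<in> Bd" "adj (v m) x" "x \<noteq> p1" and no: "\<not> (\<exists>i\<le>m. x = v i)"
      have "Q (v(Suc m := x)) (Suc m)"
        unfolding Q_def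
      proof (intro conjI allI impI)
        show "inj_on (v(Suc m := x)) {..Suc m}"
          using v no by (auto simp: Q_def inj_on_def le_Suc_eq)
      qed (use v x in \<open>auto simp: Q_def le_Suc_eq less_Suc_eq\<close>)
      then show False
        using max[of "v(Suc m := x)" "Suc m"] by simp
    qed
  qed (use v in \<open>auto simp: Q_def\<close>)
qed

lemma no_min_inst: False
proof -
  obtain v m where path: "v 0 = p2" "\<forall>i\<le>m. v i \<in> Bd \<and> v i \<noteq> p1" "inj_on v {..m::nat}" "\<forall>i<m. adj (v i) (v (Suc i))"
    "\<forall>x\<in>Bd. adj (v m) x \<longrightarrow> x \<noteq> p1 \<longrightarrow> (\<exists>i\<le>m. x = v i)"
    using longest_path .
  then have v: "v 0 = p2" "\<And>i. i \<le> m \<Longrightarrow> v i \<in> Bd" "\<And>i. i \<le> m \<Longrightarrow> v i \<noteq> p1" "inj_on v {..m::nat}"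
    "\<And>i. i < m \<Longrightarrow> adj (v i) (v (Suc i))"
    "\<And>x. x \<in> Bd \<Longrightarrow> adj (v m) x \<Longrightarrow> x \<noteq> p1 \<Longrightarrow> \<exists>i\<le>m. x = v i"
    by blast+
  have veq: "v i = v k \<longleftrightarrow> i = k" if "i \<le> m" "k \<le> m" for i k
    using inj_on_eq_iff[OF v(4)] that by simp
  have p12: "p1 \<noteq> p2"
    using pp adj_irrefl by auto
  show False
  proof (cases "m = 0")
    case True
    \<comment> \<open>\<open>p2\<close> has no boundary neighbour but \<open>p1\<close>, so it can
      be deleted alone, which leaves \<open>p1\<close> as the only precoloured vertex.\<close>
    have only: "x = p1" if "x \<in> Bd" "adj p2 x" for x
      using v(6)[of x] that v(1) True adj_irrefl by auto
    have "\<exists>\<psi>. col U L \<psi> \<and> (\<forall>s\<in>{p2}. \<psi> s = c2)"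
    proof (rule delete[OF IH order.refl fin RU cR, of "{p2}" "\<lambda>_. c2" _ "{p1}"])
      show "precol L {p1}"
        by (rule precol_single[of L p1 c1, OF Lp(1)])
      show "need Bd w \<le> card (L w)" if "w \<in> U - {p2} - {p1}" for w
        using size[of w] that by simp
      show "c2 \<notin> L w" if "w \<in> U - {p2} - {p1}" "w \<in> Bd" "s \<in> {p2}" "adj w s" for w s
        using only[of w] that adj_sym by auto
    qed (use pO pU Lp p12 c12 adj_irrefl in auto)
    then show False
      using unsolved by blast
  next
    case False
    then have m1: "1 \<le> m"
      by simp
    have v1: "v 1 \<in> U - {p1, p2}"
      using v(2,3)[of 1] v(1) veq[of 1 0] m1 O_U by auto
    have c: "2 \<le> card (L (v 1))"
      using size[OF v1] by (simp add: need_def)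
    \<comment> \<open>Since \<open>p2\<close> has colour \<open>c2\<close>, trading some colour of
      \<open>v 1\<close> for \<open>c2\<close> keeps the size of the list and offers no new
      colouring. This yields \<open>c2L\<close>.\<close>
    obtain K where K: "c2 \<in> K" "card K = card (L (v 1))" "K \<subseteq> insert c2 (L (v 1))"
    proof (cases "c2 \<in> L (v 1)")
      case False
      obtain y where y: "y \<in> L (v 1)"
        using c by fastforce
      have "finite (L (v 1))"
        using c card_ge_0_finite[of "L (v 1)"] by simp
      then have "card (insert c2 (L (v 1) - {y})) = card (L (v 1))"
        using False y card_Suc_Diff1[of "L (v 1)" y] by simp
      then show ?thesis
        using that[of "insert c2 (L (v 1) - {y})"] by blast
    qed (use that in blast)
    define L' where "L' = L(v 1 := K)"
    have p2v1: "adj p2 (v 1)"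
      using v(5)[of 0] v(1) m1 by simp
    have nbrs: "(i = 0 \<or> i = m) \<and> x = p1 \<or> 0 < i \<and> x = v (i - 1) \<or> i < m \<and> x = v (Suc i)"
      if x: "i \<le> m" "x \<in> Bd" "adj (v i) x" for i x
    proof -
      have two: False if "a \<in> Bd" "b \<in> Bd" "adj (v k) a" "adj (v k) b" "a \<noteq> b" "y \<noteq> a" "y \<noteq> b" "k \<le> m" "y \<in> Bd" "adj (v k) y" for k a b y
        using degree_two[of "v k" a b y] v(2)[of k] that by blast
      \<comment> \<open>With \<open>p1\<close> as predecessor of \<open>v 0\<close>, each path
        vertex has a known boundary neighbour on its left.\<close>
      define prev where "prev = (\<lambda>k. if k = 0 then p1 else v (k - 1))"
      have prev: "prev k \<in> Bd" "adj (v k) (prev k)" if "k \<le> m" for k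
      proof -
        show "prev k \<in> Bd"
          using v(2)[of "k - 1"] that pO by (simp add: prev_def)
        show "adj (v k) (prev k)"
          using v(5)[of "k - 1"] that v(1) pp adj_sym by (auto simp: prev_def)
      qed
      have prev_ne: "prev k \<noteq> v l" if "k \<le> l" "l \<le> m" for k l
        using veq[of "k - 1" l] that v(3)[of l] by (auto simp: prev_def)
      show ?thesis
      proof (cases "x = prev i")
        case True
        then show ?thesis
          by (auto simp: prev_def split: if_splits)
      next
        case np: False
        show ?thesis
        proof (cases "i < m")
          case True
          have "x = v (Suc i)"
          proof (rule ccontr)
            assume "x \<noteq> v (Suc i)"
            then show False
              using two[of "prev i" "v (Suc i)" i x] prev[of i] prev_ne[of i "Suc i"] v(2)[of "Suc i"] v(5)[OF True] x True np by auto
          qed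
          then show ?thesis
            using True by simp
        next
          case False
          then have im: "i = m"
            using x by simp
          show ?thesis
          proof (cases "x = p1")
            case False
            then obtain j where j: "j \<le> m" "x = v j"
              using v(6)[of x] x im by auto
            have "j \<noteq> m"
              using x(3) im j adj_irrefl by auto
            moreover have "Suc j \<noteq> m"
              using np im j by (auto simp: prev_def)
            ultimately have jm: "Suc j < m"
              using j(1) by simp
            \<comment> \<open>An edge from \<open>v m\<close> back to \<open>v j\<close> would make
              \<open>v m\<close> a third boundary neighbour of \<open>v j\<close>.\<close>
            have "adj (v j) (v m)"
              using x(3) im j adj_sym by simp
            then have False
              using two[of "prev j" "v (Suc j)" j "v m"] prev[of j] prev_ne[of j "Suc j"] prev_ne[of j m] v(2)[of "Suc j"]
                v(2)[of m] v(5)[of j] veq[of "Suc j" m] jm by auto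
            then show ?thesis ..
          qed (use im in simp)
        qed
      qed
    qed
    interpret O: opath adj X R U L' p1 p2 c1 c2 v m
    proof
      show "L' p1 = {c1}" "L' p2 = {c2}"
        using v1 Lp by (auto simp: L'_def)
      show "card (L' w) = need Bd w" if "w \<in> U - {p1, p2}" for w
        using size[of w] size[OF v1] K(2) that by (cases "w = v 1") (simp_all add: L'_def)
      show "\<not> col U L' \<phi>" for \<phi>
      proof
        assume \<phi>: "col U L' \<phi>"
        have "\<phi> p2 = c2"
          using \<phi> pU(2) v1 Lp by (auto simp: col_def L'_def)
        moreover have "\<phi> p2 \<noteq> \<phi> (v 1)"
          using \<phi> p2v1 v1 pU(2) unfolding col_def by blast
        moreover have "\<phi> (v 1) \<in> L' (v 1)"
          using \<phi> v1 unfolding col_def by blast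
        ultimately have "\<phi> (v 1) \<in> L (v 1)"
          using K(3) by (auto simp: L'_def)
        then have "\<phi> w \<in> L w" if "w \<in> U" for w
          using \<phi> that unfolding col_def L'_def by (cases "w = v 1") auto
        then have "col U L \<phi>"
          using \<phi> unfolding col_def by blast
        then show False
          using unsolved by blast
      qed
      show "c2 \<in> L' (v 1)"
        using K(1) by (simp add: L'_def)
    qed (use IH fin RU cR pO pp c12 v(1-5) m1 nbrs in blast)+
    show False
      by (rule O.no_opath)
  qed
qed

end

section \<open>From minimal counterexamples to all instances\<close>

context planar_like
begin

lemma need_ge2: "2 \<le> need B v"
  by (simp add: need_def)

text \<open>Shrinking the lists to exactly \<open>need\<close> preserves a counterexample and gives
  the equality \<open>size\<close>, on which conclusions such as \<open>L (v k) = A\<close>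
  rest.\<close>

lemma solve_edge:
  assumes IH: "solvable_below (card U)" and i: "inst R U L {p1, p2}" and ne: "p1 \<noteq> p2"
  shows "\<exists>\<phi>. col U L \<phi>"
proof (rule ccontr)
  assume no: "\<not> (\<exists>\<phi>. col U L \<phi>)"
  have P: "precol L {p1, p2}" "{p1, p2} \<subseteq> nb R U"
    using i by (auto simp: inst_def)
  then obtain c1 c2 where c: "L p1 = {c1}" "L p2 = {c2}"
    by (auto simp: precol_def)
  have pp: "adj p1 p2" "c1 \<noteq> c2"
    using P(1) ne c by (auto simp: precol_def)
  have "\<exists>K. K \<subseteq> L v \<and> card K = need (nb R U) v" if "v \<in> U - {p1, p2}" for v
    using i that obtain_subset_with_card_n[of "need (nb R U) v" "L v"] unfolding inst_def by metis
  then obtain K where K: "\<And>v. v \<in> U - {p1, p2} \<Longrightarrow> K v \<subseteq> L v \<and> card (K v) = need (nb R U) v"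
    by metis
  define L' where "L' = (\<lambda>v. if v \<in> U - {p1, p2} then K v else L v)"
  interpret min_inst adj X R U L' p1 p2 c1 c2
  proof
    show "\<not> col U L' \<phi>" for \<phi>
    proof
      assume \<phi>: "col U L' \<phi>"
      have "L' v \<subseteq> L v" for v
        using K[of v] by (auto simp: L'_def)
      then have "col U L \<phi>"
        using \<phi> by (auto simp: col_def)
      then show False
        using no by blast
    qed
  qed (use IH i P c pp K in \<open>auto simp: inst_def L'_def\<close>)
  show False
    by (rule no_min_inst)
qed

text \<open>A boundary neighbour of \<open>p\<close> is precoloured as the second vertex; without
  one, \<open>p\<close> can be deleted by itself.\<close>

lemma solve_vertex:
  assumes IH: "solvable_below (card U)" and i: "inst R U L {p}"
  shows "\<exists>\<phi>. col U L \<phi>"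
proof -
  obtain c where c: "L p = {c}"
    using i by (auto simp: inst_def precol_def)
  have pB: "p \<in> nb R U" and U: "finite U" "R \<inter> U = {}" "conn adj R"
    and size: "\<And>w. w \<in> U - {p} \<Longrightarrow> need (nb R U) w \<le> card (L w)"
    using i by (auto simp: inst_def)
  show ?thesis
  proof (cases "\<exists>w\<in>nb R U. adj p w")
    case True
    then obtain w where w: "w \<in> nb R U" "adj p w"
      by blast
    have pw: "p \<noteq> w"
      using w(2) adj_irrefl by auto
    have "w \<in> U - {p}"
      using w(1) pw by (auto simp: nb_def)
    then have "2 \<le> card (L w)"
      using size[of w] need_ge2[of "nb R U" w] by simp
    then obtain d where d: "d \<in> L w" "d \<noteq> c"
      using card_pick[of "L w" c] by blast
    define L' where "L' = L(w := {d})"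
    have "precol L' {p, w}"
      by (rule precol_pair[of L' p c w d]) (use c d pw w in \<open>auto simp: L'_def\<close>)
    then have "inst R U L' {p, w}"
      using i w size unfolding inst_def by (auto simp: L'_def)
    then obtain \<phi> where \<phi>: "col U L' \<phi>"
      using solve_edge[OF IH _ pw] by blast
    have "L' x \<subseteq> L x" for x
      using d by (auto simp: L'_def)
    then have "col U L \<phi>"
      using \<phi> by (auto simp: col_def)
    then show ?thesis
      by blast
  next
    case False
    have "\<exists>\<psi>. col U L \<psi> \<and> (\<forall>s\<in>{p}. \<psi> s = c)"
      by (rule delete[OF IH order.refl U, of "{p}" "\<lambda>_. c" L "{}"])
        (use pB c adj_irrefl size False adj_sym in auto)
    then show ?thesis
      by blast
  qed
qed

lemma solve_free:
  assumes IH: "solvable_below (card U)" and i: "inst R U L {}"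
  shows "\<exists>\<phi>. col U L \<phi>"
proof -
  have fin: "finite U" and size: "\<And>w. w \<in> U \<Longrightarrow> need (nb R U) w \<le> card (L w)"
    using i by (auto simp: inst_def)
  have pick: "\<exists>c. c \<in> L w" if "w \<in> U" for w
    using size[OF that] need_ge2[of "nb R U" w] card_pick[of "L w"] by fastforce
  show ?thesis
  proof (cases "nb R U = {}")
    case False
    then obtain p where p: "p \<in> nb R U"
      by blast
    then obtain c where c: "c \<in> L p"
      using pick[of p] by (auto simp: nb_def)
    define L' where "L' = L(p := {c})"
    have "precol L' {p}"
      by (rule precol_single) (simp add: L'_def)
    then have "inst R U L' {p}"
      using i p unfolding inst_def by (auto simp: L'_def)
    then obtain \<phi> where \<phi>: "col U L' \<phi>"
      using solve_vertex[OF IH] by blast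
    have "L' x \<subseteq> L x" for x
      using c by (auto simp: L'_def)
    then have "col U L \<phi>"
      using \<phi> by (auto simp: col_def)
    then show ?thesis
      by blast
  next
    case True
    show ?thesis
    proof (cases "U = {}")
      case False
      then obtain p where p: "p \<in> U"
        by blast
      then obtain c where c: "c \<in> L p"
        using pick by blast
      \<comment> \<open>No vertex of \<open>U\<close> is adjacent to \<open>R\<close>, so
        \<open>R\<close> is replaced rather than enlarged: \<open>p\<close> is the new removed set,
        and its neighbours pay for the lost colour by becoming boundary vertices.\<close>
      define L' where "L' = (\<lambda>w. if adj w p then L w - {c} else L w)"
      have "inst {p} (U - {p}) L' {}"
        unfolding inst_def
      proof (intro conjI ballI)
        fix w
        assume w: "w \<in> U - {p} - {}"
        have "need {} w \<le> card (L w)"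
          using size[of w] True w by simp
        moreover have "card (L w) - 1 \<le> card (L w - {c})"
          by (simp add: card_Diff_singleton_if)
        ultimately show "need (nb {p} (U - {p})) w \<le> card (L' w)"
          using w by (auto simp: need_def nb_def L'_def)
      qed (use fin in auto)
      moreover have "card (U - {p}) < card U"
        using fin p by (rule card_Diff1_less)
      ultimately obtain \<phi> where \<phi>: "col (U - {p}) L' \<phi>"
        using IH unfolding solvable_below_def by blast
      have \<phi>p: "\<phi> w \<noteq> c" if "w \<in> U - {p}" "adj w p" for w
      proof -
        have "\<phi> w \<in> L' w"
          using \<phi> that by (simp add: col_def)
        then show ?thesis
          using that(2) by (simp add: L'_def)
      qed
      have "col (U - {p}) L \<phi>"
        using \<phi> unfolding col_def L'_def by (auto split: if_splits)
      moreover have "col {p} L (\<lambda>_. c)"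
        using c adj_irrefl by (simp add: col_def)
      ultimately have "col ((U - {p}) \<union> {p}) L (\<lambda>x. if x \<in> U - {p} then \<phi> x else c)"
        using \<phi>p by (intro col_glue) auto
      moreover have "(U - {p}) \<union> {p} = U"
        using p by blast
      ultimately have "col U L (\<lambda>x. if x \<in> U - {p} then \<phi> x else c)"
        by simp
      then show ?thesis
        by blast
    qed (simp add: col_def)
  qed
qed

lemma solvable: "solvable_below N"
proof (induction N)
  case (Suc N)
  show ?case
    unfolding solvable_below_def
  proof (intro allI impI)
    fix R U L P
    assume card: "card U < Suc N" and i: "inst R U L P"
    have IH: "solvable_below (card U)"
      using Suc card unfolding solvable_below_def by (metis less_Suc_eq less_trans)
    have "finite U" "P \<subseteq> U" "card P \<le> 2"
      using i by (auto simp: inst_def precol_def nb_def)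
    then have "finite P"
      using finite_subset by blast
    consider "card P = 0" | "card P = 1" | "card P = 2"
      using \<open>card P \<le> 2\<close> by linarith
    then show "\<exists>\<phi>. col U L \<phi>"
    proof cases
      case 1
      then have "P = {}"
        using \<open>finite P\<close> by simp
      then show ?thesis
        using solve_free[OF IH] i by blast
    next
      case 2
      then obtain p where "P = {p}"
        by (auto simp: card_1_singleton_iff)
      then show ?thesis
        using solve_vertex[OF IH] i by blast
    next
      case 3
      then obtain p p' where "P = {p, p'}" "p \<noteq> p'"
        by (auto simp: card_2_iff)
      then show ?thesis
        using solve_edge[OF IH] i by blast
    qed
  qed
qed (simp add: solvable_below_def)

end

theorem theorem2:
  fixes V X :: "'a set" and E :: "'a set set" and L :: "'a \<Rightarrow> int set"
  assumes "simple_graph V E"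
    and "triangle_free E"
    and "planar_graph V E"
    and "independent_in V E X"
    and "\<forall>v\<in>V. finite (L v)"
    and "\<forall>v\<in>X. card (L v) = 3"
    and "\<forall>v\<in>V - X. card (L v) = 4"
  shows "list_colourable V E L"
proof -
  obtain p \<gamma> where "plane_drawing V E p \<gamma>"
    using assms(3) by (auto simp: planar_graph_def)
  then interpret drawing V E p \<gamma>
    using assms(1) by unfold_locales
  interpret planar_like adj X
  proof
    show "symp adj"
      by (rule symp_adj)
    show "\<not> (adj x y \<and> adj y z \<and> adj x z)" for x y z
      using assms(2) unfolding triangle_free_def adj_def by blast
    show "x \<in> X \<Longrightarrow> y \<in> X \<Longrightarrow> \<not> adj x y" for x y
      using assms(4) by (simp add: independent_in_def adj_def)
  qed (fact no_K33, fact no_K5)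
  \<comment> \<open>Nothing is removed or precoloured yet: the boundary is empty and
    \<open>need\<close> is 3 on \<open>X\<close> and 4 elsewhere.\<close>
  have "inst {} V L {}"
    using assms(1,6,7) by (auto simp: inst_def need_def nb_def simple_graph_def)
  then obtain \<phi> where \<phi>: "col V L \<phi>"
    using solvable[of "Suc (card V)"] unfolding solvable_below_def by blast
  have "list_colouring V E L \<phi>"
    unfolding list_colouring_def
  proof (intro conjI allI impI)
    show "\<forall>v\<in>V. \<phi> v \<in> L v"
      using \<phi> by (simp add: col_def)
    show "\<phi> x \<noteq> \<phi> y" if "{x, y} \<in> E" for x y
    proof -
      have "adj x y"
        using that by (simp add: adj_def)
      then show ?thesis
        using \<phi> adj_V[of x y] by (simp add: col_def)
    qed
  qed
  then show ?thesis
    by (auto simp: list_colourable_def)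
qed

end
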